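(* Let $f$ be $C^6$ with $\|\nabla^i f(y)\|_2\le M$ for all $y\in\mathbb{R}^d$ and $i=2,\dots,6$. Let the step sizes $\alpha(n)>0$ of the eigenvector search satisfy $\sum_n\alpha(n)=\infty$ and $\sum_n\alpha(n)^2<\infty$, and let the difference lengths $l(n)>0$ satisfy $l(n)\le L\sqrt{\alpha(n)}$ for all $n$, for some constant $L>0$. Let $\mathbf{x}$ satisfy $\|\mathbf{x}-\mathbf{x}^*\|_2\le\delta$, and let $l_0>0$ be small (so that $\mu-Ml_0^2d/2>0$). Then for any $\epsilon_{\mathbf{v}}>0$ there almost surely exists a finite $n^{max}_{\mathbf{v}}$ (depending on $\epsilon_{\mathbf{v}}$ and on the random realization of the samples $\mathbf{r}(n)$) such that the output $\tilde V=[\tilde{\mathbf{v}}_1,\dots,\tilde{\mathbf{v}}_k]$ of the derivative-free eigenvector-search algorithm at $\mathbf{x}$, run with $n^{max}_{\mathbf{v}}$ iterations per direction, satisfies $$\|\tilde V\tilde V^\top-VV^\top\|_2\le\epsilon_{\mathbf{v}}\quad\text{and}\quad \|\tilde V\tilde V^\top-V_{l_0}V_{l_0}^\top\|_2\le \epsilon_{\mathbf{v}}+\frac{\sqrt{2k}\,Ml_0^2d}{4\mu}.$$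
   Context: Let $d\ge2$, $1\le k\le d-1$, $f:\mathbb{R}^d\to\mathbb{R}$; norms of derivative tensors are operator norms. $\mathbf{x}^*$ is an index-$k$ saddle point of $f$ ($\nabla f(\mathbf{x}^* )=0$, and the Hessian there is nondegenerate with exactly $k$ negative eigenvalues), and $\delta>0$, $\mu\in(0,M)$ are such that for all $\mathbf{x}$ with $\|\mathbf{x}-\mathbf{x}^*\|_2\le\delta$ the eigenvalues of $\nabla^2f(\mathbf{x})$ satisfy $-M\le\lambda_1\le\dots\le\lambda_k<-\mu<0<\mu<\lambda_{k+1}\le\dots\le\lambda_d\le M$. Gaussian smoothing: $f_l(\mathbf{x})=\mathbb{E}_{\mathbf{r}\sim\mathcal N(0,I)}[f(\mathbf{x}+l\mathbf{r})]$. $V$ and $V_{l_0}$ denote $d\times k$ matrices whose columns are orthonormal eigenvectors for the $k$ smallest eigenvalues of $\nabla^2 f(\mathbf{x})$ and $\nabla^2f_{l_0}(\mathbf{x})$, respectively. Estimators: $F(\mathbf{x},\mathbf{r},l)=\frac{f(\mathbf{x}+l\mathbf{r})-f(\mathbf{x}-l\mathbf{r})}{2l}\mathbf{r}$ and $H_{\mathbf{v}}(\mathbf{x},\mathbf{r},l)=\frac{F(\mathbf{x}+l\mathbf{v},\mathbf{r},l)-F(\mathbf{x}-l\mathbf{v},\mathbf{r},l)}{2l}$. Derivative-free eigenvector-search algorithm at $\mathbf{x}$: start from unit vectors $\mathbf{v}_1,\dots,\mathbf{v}_k$. For $j=1,\dots,k$ in turn: if $j\ge2$, replace $\mathbf{v}_j$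 by $(I-\sum_{i<j}\tilde{\mathbf{v}}_i\tilde{\mathbf{v}}_i^\top)\mathbf{v}_j$ and normalize (the projection is assumed nonzero). Then for $n=0,1,\dots,n^{max}_{\mathbf{v}}$, draw a fresh independent $\mathbf{r}(n)\sim\mathcal N(0,I)$, replace $$\mathbf{v}_j\leftarrow\mathbf{v}_j-\alpha(n)\Big(I-\mathbf{v}_j\mathbf{v}_j^\top-\sum_{i<j}\tilde{\mathbf{v}}_i\tilde{\mathbf{v}}_i^\top\Big)H_{\mathbf{v}_j}(\mathbf{x},\mathbf{r}(n),l(n)),$$ and normalize $\mathbf{v}_j\leftarrow\mathbf{v}_j/\|\mathbf{v}_j\|_2$. The final vector is $\tilde{\mathbf{v}}_j$. Standing assumption: the searches do not get trapped at undesired eigenvectors. That is, almost surely, for each $j$, if the $j$-th loop is run indefinitely with $\tilde{\mathbf{v}}_1,\dots,\tilde{\mathbf{v}}_{j-1}$ fixed, every limit point of its iterates lies in the span of the eigenvectors for the $k-j+1$ smallest eigenvalues of the compression of $\nabla^2f(\mathbf{x})$ to the orthogonal complement of $\mathrm{span}\{\tilde{\mathbf{v}}_i\}_{i<j}$. *)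

theory Defs
  imports "HOL-Analysis.Analysis" "HOL-Probability.Probability" "HOL-Library.Multiset"
begin

section \<open>Derivative tensors\<close>

text \<open>\<open>dderiv f [h\<^sub>1, \<dots>, h\<^sub>i] x\<close> is the value of the i-th derivative tensor of \<open>f\<close> at \<open>x\<close>
  on the vectors \<open>h\<^sub>1, \<dots>, h\<^sub>i\<close>. In finite dimension, \<open>C\<^sup>m\<close> smoothness of \<open>f\<close> is the same as
  Frechet differentiability and continuity of all these evaluations.\<close>

primrec dderiv :: "('a::real_normed_vector \<Rightarrow> real) \<Rightarrow> 'a list \<Rightarrow> 'a \<Rightarrow> real" where
  "dderiv f [] = f"
| "dderiv f (h # hs) = (\<lambda>x. frechet_derivative (dderiv f hs) (at x) h)"

definition C_smooth :: "nat \<Rightarrow> ('a::euclidean_space \<Rightarrow> real) \<Rightarrow> bool" where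
  "C_smooth m f \<longleftrightarrow>
     (\<forall>hs. length hs < m \<longrightarrow> (\<forall>x. dderiv f hs differentiable (at x))) \<and>
     (\<forall>hs. length hs \<le> m \<longrightarrow> continuous_on UNIV (dderiv f hs))"

definition dnorm :: "nat \<Rightarrow> ('a::euclidean_space \<Rightarrow> real) \<Rightarrow> 'a \<Rightarrow> real" where
  "dnorm i f x = (SUP hs\<in>{hs. length hs = i \<and> (\<forall>h\<in>set hs. norm h = 1)}. \<bar>dderiv f hs x\<bar>)"

definition grad :: "(real ^ 'n::finite \<Rightarrow> real) \<Rightarrow> real ^ 'n \<Rightarrow> real ^ 'n" where
  "grad f x = (\<chi> i. dderiv f [axis i 1] x)"

definition hess :: "(real ^ 'n::finite \<Rightarrow> real) \<Rightarrow> real ^ 'n \<Rightarrow> real ^ 'n ^ 'n" where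
  "hess f x = (\<chi> i j. dderiv f [axis i 1, axis j 1] x)"


section \<open>Eigenvalues with multiplicity\<close>

text \<open>Eigenvalues of a linear operator \<open>T\<close> on an invariant subspace \<open>W\<close>. All operators considered
  are symmetric on \<open>W\<close>, so that multiplicity means the dimension of the eigenspace.\<close>

definition eigenspace_on :: "'a::euclidean_space set \<Rightarrow> ('a \<Rightarrow> 'a) \<Rightarrow> real \<Rightarrow> 'a set" where
  "eigenspace_on W T t = {y \<in> W. T y = t *\<^sub>R y}"

definition spectrum_on :: "'a::euclidean_space set \<Rightarrow> ('a \<Rightarrow> 'a) \<Rightarrow> real set" where
  "spectrum_on W T = {t. \<exists>y \<in> W. y \<noteq> 0 \<and> T y = t *\<^sub>R y}"

text \<open>The eigenvalues in increasing order, each repeated according to its multiplicity.\<close>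

definition eigvals_on :: "'a::euclidean_space set \<Rightarrow> ('a \<Rightarrow> 'a) \<Rightarrow> real list" where
  "eigvals_on W T =
     sorted_list_of_multiset (\<Sum>t\<in>spectrum_on W T. replicate_mset (dim (eigenspace_on W T t)) t)"

definition eigvals :: "real ^ 'n ^ 'n::finite \<Rightarrow> real list" where
  "eigvals A = eigvals_on UNIV (\<lambda>y. A *v y)"

text \<open>If the m-th and (m+1)-st eigenvalues coincide, the full eigenspace of the m-th eigenvalue
  is included, so that no choice of eigenvectors is involved.\<close>

definition low_eigenspan :: "'a::euclidean_space set \<Rightarrow> ('a \<Rightarrow> 'a) \<Rightarrow> nat \<Rightarrow> 'a set" where
  "low_eigenspan W T m = span (\<Union>i<m. eigenspace_on W T (eigvals_on W T ! i))"

text \<open>A \<open>d \<times> k\<close> matrix is represented by the list of its \<open>k\<close> columns; \<open>gram V\<close> is \<open>V V\<^sup>T\<close>.\<close>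

definition outer :: "real ^ 'n \<Rightarrow> real ^ 'n \<Rightarrow> real ^ 'n ^ 'n" where
  "outer u v = (\<chi> i j. u $ i * v $ j)"

definition gram :: "(real ^ 'n::finite) list \<Rightarrow> real ^ 'n ^ 'n" where
  "gram V = (\<Sum>v\<leftarrow>V. outer v v)"

definition mat_norm :: "real ^ 'n ^ 'n::finite \<Rightarrow> real" where
  "mat_norm A = onorm (\<lambda>y. A *v y)"

definition low_eigenvectors :: "real ^ 'n ^ 'n::finite \<Rightarrow> nat \<Rightarrow> (real ^ 'n) list \<Rightarrow> bool" where
  "low_eigenvectors A k V \<longleftrightarrow>
     length V = k \<and>
     (\<forall>i<k. \<forall>j<k. V ! i \<bullet> V ! j = (if i = j then 1 else 0)) \<and>
     (\<forall>i<k. A *v (V ! i) = (eigvals A ! i) *\<^sub>R (V ! i))"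

definition index_saddle :: "(real ^ 'n::finite \<Rightarrow> real) \<Rightarrow> nat \<Rightarrow> real ^ 'n \<Rightarrow> bool" where
  "index_saddle f k x \<longleftrightarrow>
     grad f x = 0 \<and> invertible (hess f x) \<and>
     length (filter (\<lambda>t. t < 0) (eigvals (hess f x))) = k"


section \<open>Gaussian smoothing and estimators\<close>

definition std_gaussian :: "(real ^ 'n::finite) measure" where
  "std_gaussian = density lborel (\<lambda>z. ennreal (\<Prod>i\<in>UNIV. std_normal_density (z $ i)))"

definition smooth :: "(real ^ 'n::finite \<Rightarrow> real) \<Rightarrow> real \<Rightarrow> real ^ 'n \<Rightarrow> real" where
  "smooth f l x = (\<integral>z. f (x + l *\<^sub>R z) \<partial>std_gaussian)"

definition F_est :: "(real ^ 'n::finite \<Rightarrow> real) \<Rightarrow> real ^ 'n \<Rightarrow> real ^ 'n \<Rightarrow> real \<Rightarrow> real ^ 'n" where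
  "F_est f x r l = ((f (x + l *\<^sub>R r) - f (x - l *\<^sub>R r)) / (2 * l)) *\<^sub>R r"

definition H_est ::
  "(real ^ 'n::finite \<Rightarrow> real) \<Rightarrow> real ^ 'n \<Rightarrow> real ^ 'n \<Rightarrow> real ^ 'n \<Rightarrow> real \<Rightarrow> real ^ 'n" where
  "H_est f v x r l = (F_est f (x + l *\<^sub>R v) r l - F_est f (x - l *\<^sub>R v) r l) /\<^sub>R (2 * l)"


section \<open>Eigenvector search\<close>

text \<open>Below, \<open>ws\<close> is the list of directions found so far and \<open>s n\<close> is the sample drawn in
  step \<open>n\<close>; \<open>sgn v\<close> is \<open>v /\<^sub>R norm v\<close>. Directions are numbered from 0.\<close>

definition search_start :: "(real ^ 'n::finite) list \<Rightarrow> real ^ 'n \<Rightarrow> real ^ 'n" where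
  "search_start ws v = (if ws = [] then v else sgn ((mat 1 - gram ws) *v v))"

primrec search_iter ::
  "(real ^ 'n::finite \<Rightarrow> real) \<Rightarrow> real ^ 'n \<Rightarrow> (nat \<Rightarrow> real) \<Rightarrow> (nat \<Rightarrow> real) \<Rightarrow>
   (nat \<Rightarrow> real ^ 'n) \<Rightarrow> (real ^ 'n) list \<Rightarrow> real ^ 'n \<Rightarrow> nat \<Rightarrow> real ^ 'n" where
  "search_iter f x \<alpha> l s ws v 0 = v"
| "search_iter f x \<alpha> l s ws v (Suc n) =
     (let u = search_iter f x \<alpha> l s ws v n
      in sgn (u - \<alpha> n *\<^sub>R ((mat 1 - outer u u - gram ws) *v H_est f u x (s n) (l n))))"

text \<open>The first \<open>j\<close> directions found from the initial vectors \<open>v\<close> and the samples \<open>s j n\<close>, when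
  each loop runs over \<open>n = 0, \<dots>, N\<close>, hence makes \<open>Suc N\<close> updates.\<close>

primrec search_output ::
  "(real ^ 'n::finite \<Rightarrow> real) \<Rightarrow> real ^ 'n \<Rightarrow> (nat \<Rightarrow> real) \<Rightarrow> (nat \<Rightarrow> real) \<Rightarrow>
   (nat \<Rightarrow> nat \<Rightarrow> real ^ 'n) \<Rightarrow> (nat \<Rightarrow> real ^ 'n) \<Rightarrow> nat \<Rightarrow> nat \<Rightarrow> (real ^ 'n) list" where
  "search_output f x \<alpha> l s v N 0 = []"
| "search_output f x \<alpha> l s v N (Suc j) =
     (let ws = search_output f x \<alpha> l s v N j
      in ws @ [search_iter f x \<alpha> l (s j) ws (search_start ws (v j)) (Suc N)])"

definition seq_limit_point :: "(nat \<Rightarrow> 'a::topological_space) \<Rightarrow> 'a \<Rightarrow> bool" where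
  "seq_limit_point X y \<longleftrightarrow> (\<exists>\<phi>. strict_mono \<phi> \<and> (X \<circ> \<phi>) \<longlonglongrightarrow> y)"

text \<open>The search with fixed orthonormal \<open>ws\<close>, run indefinitely, is not trapped: its limit points
  belong to the \<open>m\<close> smallest eigenvalues of the compression of the Hessian to the orthogonal
  complement of \<open>ws\<close>, the orthogonal projection onto which is \<open>mat 1 - gram ws\<close>.\<close>

definition not_trapped ::
  "(real ^ 'n::finite \<Rightarrow> real) \<Rightarrow> real ^ 'n \<Rightarrow> (nat \<Rightarrow> real) \<Rightarrow> (nat \<Rightarrow> real) \<Rightarrow>
   (nat \<Rightarrow> real ^ 'n) \<Rightarrow> (real ^ 'n) list \<Rightarrow> real ^ 'n \<Rightarrow> nat \<Rightarrow> bool" where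
  "not_trapped f x \<alpha> l s ws v m \<longleftrightarrow>
     (\<forall>y. seq_limit_point (search_iter f x \<alpha> l s ws (search_start ws v)) y \<longrightarrow>
        y \<in> low_eigenspan (orthogonal_comp (span (set ws)))
              (\<lambda>z. (mat 1 - gram ws) *v (hess f x *v z)) m)"

end

theory Submission
  imports Defs
begin

text \<open>
  The output is shown to be close to \<open>V\<close> with probability tending to \<open>1\<close> as the number \<open>N\<close> of iterations
  grows; this yields a finite \<open>N\<close> almost surely.

  Consider one search loop in the orthogonal complement \<open>W\<close> of the directions found before it, and let \<open>a (u)\<close> be
  the squared length of the projection of \<open>u\<close> to the eigenvectors with negative eigenvalue of the Hessian compressed
  to \<open>W\<close>. Up to errors of order \<open>\<alpha>\<^sup>2 a\<close>, a step of size \<open>\<alpha>\<close> raises \<open>a\<close> in mean by a multiple of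
  \<open>\<alpha> a (1 - a)\<close> (descent) plus a multiple of \<open>\<alpha>\<^sup>2\<close> (the sampling noise pushes the iterate away from the undesired
  eigenvectors), with a variance of order \<open>\<alpha>\<^sup>2 (a + \<alpha>\<^sup>2)\<close>.
  The potential \<open>b / (a + b)\<close>, with \<open>b\<close> following the tail sums of \<open>\<alpha>\<^sup>2\<close>, therefore contracts, and the divergence of
  the sum of \<open>\<alpha>\<close> forces \<open>a (1 - a)\<close> to be small at some time. Hence the expectation of \<open>1 - a\<close> tends to \<open>0\<close>, uniformly
  in the starting vector and in \<open>W\<close>. The uniformity in \<open>W\<close> is what allows an induction over the loops: once the earlier
  directions are close to the span of \<open>V\<close>, so are the eigenvectors with negative eigenvalue of the compressed Hessian.

  For the smoothed function, the Hessians differ by at most \<open>M l\<^sub>0\<^sup>2 d / 2\<close>, and the two spectral projections are compared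
  by a \<open>sin (2 \<theta>)\<close> bound.
\<close>

text \<open>All loops stop after the same number of iterations, so the directions that a loop
  deflates change whenever this number changes. Convergence of each loop for fixed predecessors
  cannot be chained, which is why every bound is a bound in expectation, uniform over the
  predecessors. The start is arbitrary too: a loop may begin exactly at an undesired eigenvector,
  where the descent term \<open>a * (1 - a)\<close> vanishes. Only the sampling noise leads away,
  with a gain of order \<open>\<alpha>\<^sup>2\<close>, and it has to beat the bias of the
  difference quotients. That bias is of order \<open>l\<^sup>2\<close>, hence of order \<alpha> by
  the bound on \<open>l\<close>; it enters through a step of size \<alpha> and is tested against a
  vector of length at most \<open>sqrt a\<close>. The product
  \<open>\<alpha>\<^sup>2 * sqrt a\<close> splits into a small share of the gain and a multiple of
  \<open>\<alpha>\<^sup>2 * a\<close>. Near \<open>a = 0\<close> the natural scale for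
  \<open>a\<close> is the sum of the squares still to come. Measured on this scale, the contraction
  factor does not depend on how small that sum is, so arbitrarily late time windows contract equally
  well and can be iterated.\<close>

section \<open>A chain driven away from the zeros of a function\<close>

text \<open>The proof expands \<open>1 / (X z + b')\<close> to second order around \<open>1 / (a + b)\<close>; the decrease \<open>K * s\<close> of \<open>b\<close> pays for
  the drift \<open>C * s * a\<close> and for the variance.\<close>
lemma potential_step:
  fixes X :: "'z \<Rightarrow> real"
  assumes "prob_space P" and meas: "X \<in> borel_measurable P"
    and X: "\<And>z. z \<in> space P \<Longrightarrow> 0 \<le> X z \<and> X z \<le> 1" and a: "0 \<le> a" "a \<le> 1"
    and mean: "(\<integral>z. X z \<partial>P) - a \<ge> c * s - C * s * a"
    and var: "(\<integral>z. (X z - a)\<^sup>2 \<partial>P) \<le> C * s * (a + s)"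
    and c: "0 < c" "0 \<le> C" "0 \<le> s" and K: "K = 5 * C + 1"
    and b: "0 < b" "b \<le> 1" "2 * K * s \<le> b" "16 * (C + K\<^sup>2) * s \<le> c * b"
  shows "(\<integral>z. (b - K * s) / (X z + (b - K * s)) \<partial>P) \<le> b / (a + b) * (1 - min 1 (c / 4) * s / b)"
proof -
  interpret prob_space P by fact
  define y where "y = a + b"
  define b' where "b' = b - K * s"
  have y: "0 < y" using a b by (simp add: y_def)
  have Kpos: "0 < K" using K c by simp
  have b': "b / 2 \<le> b'" "b' \<le> b" "0 < b'" using b Kpos c by (auto simp: b'_def)
  have intX: "integrable P X"
    by (rule integrable_const_bound[where B=1]) (use X meas in \<open>auto intro!: AE_I2\<close>)
  have intX2: "integrable P (\<lambda>z. (X z - a)\<^sup>2)"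
  proof (rule integrable_const_bound[where B=1])
    show "AE z in P. norm ((X z - a)\<^sup>2) \<le> 1"
      using X a by (intro AE_I2) (simp add: abs_square_le_1 abs_le_iff, smt (verit))
  qed (use meas in measurable)
  have pt: "b' / (X z + b') \<le> b' / y - b' * ((X z - a) - K * s) / y\<^sup>2 + (4 * (X z - a)\<^sup>2 + 4 * K\<^sup>2 * s\<^sup>2) / y\<^sup>2"
    if z: "z \<in> space P" for z
  proof -
    define D where "D = X z - a"
    define y' where "y' = X z + b'"
    have y'b: "b / 2 \<le> y'" using X[OF z] b' by (simp add: y'_def)
    then have y': "0 < y'" using b by simp
    have \<Delta>: "y' - y = D - K * s" by (simp add: y'_def y_def D_def b'_def)
    \<comment> \<open>The remainder is exact. Bounding its last factor \<open>y'\<close> below by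
      \<open>b / 2\<close> costs \<open>2 / b\<close>, which the prefactor \<open>b' \<le> b\<close>
      pays for.\<close>
    have "1 / y' = 1 / y - (y' - y) / y\<^sup>2 + (y' - y)\<^sup>2 / (y\<^sup>2 * y')"
      using y y' by (simp add: field_simps power2_eq_square)
    also have "(y' - y)\<^sup>2 / (y\<^sup>2 * y') \<le> (y' - y)\<^sup>2 / (y\<^sup>2 * (b / 2))"
      using y y' y'b b by (intro divide_left_mono mult_left_mono mult_pos_pos) auto
    finally have "b' * (1 / y') \<le> b' * (1 / y - (y' - y) / y\<^sup>2 + (y' - y)\<^sup>2 / (y\<^sup>2 * (b / 2)))"
      using b' by (intro mult_left_mono) auto
    also have "\<dots> = b' / y - b' * (y' - y) / y\<^sup>2 + b' / b * (2 * (y' - y)\<^sup>2 / y\<^sup>2)"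
      using b y by (simp add: field_simps)
    also have "b' / b * (2 * (y' - y)\<^sup>2 / y\<^sup>2) \<le> 1 * (2 * (y' - y)\<^sup>2 / y\<^sup>2)"
      using b b' by (intro mult_right_mono) auto
    also have "2 * (y' - y)\<^sup>2 \<le> 4 * D\<^sup>2 + 4 * (K * s)\<^sup>2"
      using zero_le_power2[of "D + K * s"] unfolding \<Delta>
      by (simp add: power2_eq_square algebra_simps)
    then have "1 * (2 * (y' - y)\<^sup>2 / y\<^sup>2) \<le> (4 * D\<^sup>2 + 4 * (K * s)\<^sup>2) / y\<^sup>2"
      by (simp add: divide_right_mono)
    finally show ?thesis unfolding \<Delta> by (simp add: y'_def D_def power_mult_distrib algebra_simps)
  qed
  have int1: "integrable P (\<lambda>z. b' / (X z + b'))"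
  proof (rule integrable_const_bound[where B=1])
    show "AE z in P. norm (b' / (X z + b')) \<le> 1"
    proof (rule AE_I2)
      fix z assume "z \<in> space P"
      then have "0 \<le> X z" using X by simp
      then show "norm (b' / (X z + b')) \<le> 1" using b' by simp
    qed
  qed (use meas in measurable)
  have int2: "integrable P (\<lambda>z. b' / y - b' * ((X z - a) - K * s) / y\<^sup>2 + (4 * (X z - a)\<^sup>2 + 4 * K\<^sup>2 * s\<^sup>2) / y\<^sup>2)"
    using intX intX2 by auto
  have "(\<integral>z. b' / (X z + b') \<partial>P) \<le> (\<integral>z. b' / y - b' * ((X z - a) - K * s) / y\<^sup>2 + (4 * (X z - a)\<^sup>2 + 4 * K\<^sup>2 * s\<^sup>2) / y\<^sup>2 \<partial>P)"
    by (rule integral_mono[OF int1 int2 pt])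
  also have "\<dots> = b' / y - b' * (((\<integral>z. X z \<partial>P) - a) - K * s) / y\<^sup>2 + (4 * (\<integral>z. (X z - a)\<^sup>2 \<partial>P) + 4 * K\<^sup>2 * s\<^sup>2) / y\<^sup>2"
    using intX intX2 by (simp add: prob_space)
  also have "\<dots> \<le> b' / y - b' * ((c * s - C * s * a) - K * s) / y\<^sup>2 + (4 * (C * s * (a + s)) + 4 * K\<^sup>2 * s\<^sup>2) / y\<^sup>2"
  proof -
    have "b' * ((c * s - C * s * a) - K * s) / y\<^sup>2 \<le> b' * (((\<integral>z. X z \<partial>P) - a) - K * s) / y\<^sup>2"
      using mean b' by (intro divide_right_mono mult_left_mono) auto
    moreover have "(4 * (\<integral>z. (X z - a)\<^sup>2 \<partial>P) + 4 * K\<^sup>2 * s\<^sup>2) / y\<^sup>2 \<le> (4 * (C * s * (a + s)) + 4 * K\<^sup>2 * s\<^sup>2) / y\<^sup>2"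
      using var by (intro divide_right_mono) auto
    ultimately show ?thesis by linarith
  qed
  also have "\<dots> = b / y + ((- K * s * y) - b' * ((c * s - C * s * a) - K * s) + (4 * (C * s * (a + s)) + 4 * K\<^sup>2 * s\<^sup>2)) / y\<^sup>2"
    using y by (simp add: b'_def field_simps power2_eq_square)
  \<comment> \<open>Origin of \<open>K = 5 * C + 1\<close>: the terms \<open>s * a\<close> cost
    \<open>C\<close> from the drift and \<open>4 * C\<close> from the variance, which leaves
    \<open>- s * a\<close>. The terms in \<open>s\<^sup>2\<close> are at most
    \<open>4 * (C + K\<^sup>2) * s\<^sup>2\<close>, that is at most \<open>c * b * s / 4\<close>,
    while the noise gains \<open>c * b * s / 2\<close>. Together
    \<open>- s * (a + c / 4 * b)\<close> remains.\<close>
  also have "\<dots> \<le> b / y + (- s * (min 1 (c / 4) * y)) / y\<^sup>2"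
  proof (intro add_mono divide_right_mono)
    have e1: "b' * (c * s) \<ge> (b / 2) * (c * s)" using b' c by (intro mult_right_mono) auto
    have e2: "b' * (C * s * a) \<le> 1 * (C * s * a)" using b' b c a by (intro mult_right_mono) auto
    have e3: "s * (16 * (C + K\<^sup>2) * s) \<le> s * (c * b)" using b c by (intro mult_left_mono) auto
    have e4: "min 1 (c / 4) * a \<le> 1 * a" "min 1 (c / 4) * b \<le> c / 4 * b"
      using mult_right_mono[OF min.cobounded1 a(1), of 1 "c / 4"]
        mult_right_mono[OF min.cobounded2 less_imp_le[OF b(1)], of 1 "c / 4"] by auto
    have "s * (min 1 (c / 4) * y) \<le> s * (a + c / 4 * b)"
      using e4 c by (intro mult_left_mono) (auto simp: y_def algebra_simps)
    moreover have "(- K * s * y) + b' * (K * s) = - K * s * a - K\<^sup>2 * s\<^sup>2"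
      by (simp add: y_def b'_def algebra_simps power2_eq_square)
    moreover have "0 \<le> K\<^sup>2 * s\<^sup>2" by simp
    ultimately show "(- K * s * y) - b' * ((c * s - C * s * a) - K * s) + (4 * (C * s * (a + s)) + 4 * K\<^sup>2 * s\<^sup>2) \<le> - s * (min 1 (c / 4) * y)"
      using e1 e2 e3 unfolding K by (simp add: algebra_simps power2_eq_square)
  qed (use y in auto)
  also have "\<dots> = b / (a + b) * (1 - min 1 (c / 4) * s / b)"
    using y b a unfolding y_def[symmetric] by (simp add: field_simps power2_eq_square)
  finally show ?thesis by (simp add: b'_def)
qed

section \<open>Transition operators of a time-dependent chain driven by independent samples\<close>

locale markov_steps = prob_space \<gamma> for \<gamma> :: "'z measure" +
  fixes step :: "nat \<Rightarrow> 'u::topological_space \<Rightarrow> 'z \<Rightarrow> 'u" and S :: "'u set"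
  assumes step_measurable: "(\<lambda>p. step n (fst p) (snd p)) \<in> borel \<Otimes>\<^sub>M \<gamma> \<rightarrow>\<^sub>M borel"
    and step_in: "u \<in> S \<Longrightarrow> z \<in> space \<gamma> \<Longrightarrow> step n u z \<in> S"
begin

definition opr :: "nat \<Rightarrow> ('u \<Rightarrow> real) \<Rightarrow> 'u \<Rightarrow> real" where
  "opr n \<phi> u = (\<integral>z. \<phi> (step n u z) \<partial>\<gamma>)"

text \<open>The \<open>i\<close>-step transition operator from time \<open>m\<close>: the
  conditional expectation of \<phi> at time \<open>m + i\<close>, given the state at time
  \<open>m\<close>. As an iterated integral over single samples it requires no measure on paths;
  \<open>loop_expectation\<close> connects it with the random search.\<close>

primrec oprs :: "nat \<Rightarrow> nat \<Rightarrow> ('u \<Rightarrow> real) \<Rightarrow> 'u \<Rightarrow> real" where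
  "oprs 0 m \<phi> = \<phi>"
| "oprs (Suc i) m \<phi> = opr m (oprs i (Suc m) \<phi>)"

definition test_fn :: "('u \<Rightarrow> real) \<Rightarrow> bool" where
  "test_fn \<phi> \<longleftrightarrow> \<phi> \<in> borel_measurable borel \<and> (\<exists>B. \<forall>u\<in>S. \<bar>\<phi> u\<bar> \<le> B)"

lemma oprs_add: "oprs (i + j) m \<phi> = oprs i m (oprs j (m + i) \<phi>)"
  by (induction i arbitrary: m) auto

lemma oprs_Suc_right: "oprs (Suc i) m \<phi> = oprs i m (opr (m + i) \<phi>)"
  using oprs_add[of i 1 m \<phi>] by simp

lemma step_measurable_section: "(\<lambda>z. step n u z) \<in> \<gamma> \<rightarrow>\<^sub>M borel"
proof -
  have "(\<lambda>z. (u, z)) \<in> \<gamma> \<rightarrow>\<^sub>M borel \<Otimes>\<^sub>M \<gamma>" by simp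
  from measurable_compose[OF this step_measurable[of n]] show ?thesis by simp
qed

lemma integrable_test: "test_fn \<phi> \<Longrightarrow> u \<in> S \<Longrightarrow> integrable \<gamma> (\<lambda>z. \<phi> (step n u z))"
  unfolding test_fn_def
  by (auto intro!: integrable_const_bound AE_I2 measurable_compose[OF step_measurable_section] step_in)

lemma test_fn_opr: assumes "test_fn \<phi>" shows "test_fn (opr n \<phi>)"
proof -
  obtain B where B: "\<And>u. u \<in> S \<Longrightarrow> \<bar>\<phi> u\<bar> \<le> B" and meas: "\<phi> \<in> borel_measurable borel"
    using assms by (auto simp: test_fn_def)
  have "(\<lambda>p. \<phi> (step n (fst p) (snd p))) \<in> borel_measurable (borel \<Otimes>\<^sub>M \<gamma>)"
    by (rule measurable_compose[OF step_measurable meas])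
  then have "opr n \<phi> \<in> borel_measurable borel"
    unfolding opr_def by (intro borel_measurable_lebesgue_integral) (simp add: split_def)
  moreover have "\<bar>opr n \<phi> u\<bar> \<le> B" if "u \<in> S" for u
  proof -
    have "\<bar>opr n \<phi> u\<bar> \<le> (\<integral>z. \<bar>\<phi> (step n u z)\<bar> \<partial>\<gamma>)"
      unfolding opr_def by (rule integral_abs_bound)
    also have "\<dots> \<le> (\<integral>z. B \<partial>\<gamma>)"
      using B[OF step_in[OF that]] integrable_test[OF assms that]
      by (intro integral_mono integrable_abs) auto
    finally show ?thesis by (simp add: prob_space)
  qed
  ultimately show ?thesis by (auto simp: test_fn_def)
qed

lemma test_fn_oprs: "test_fn \<phi> \<Longrightarrow> test_fn (oprs i m \<phi>)"
  by (induction i arbitrary: m) (auto intro: test_fn_opr)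

lemma test_fn_affine: "test_fn \<phi> \<Longrightarrow> test_fn \<psi> \<Longrightarrow> test_fn (\<lambda>u. p * \<phi> u + q * \<psi> u + e)"
proof -
  assume a: "test_fn \<phi>" "test_fn \<psi>"
  then obtain A B where "\<forall>u\<in>S. \<bar>\<phi> u\<bar> \<le> A" "\<forall>u\<in>S. \<bar>\<psi> u\<bar> \<le> B" by (auto simp: test_fn_def)
  then have "\<forall>u\<in>S. \<bar>p * \<phi> u + q * \<psi> u + e\<bar> \<le> \<bar>p\<bar> * A + \<bar>q\<bar> * B + \<bar>e\<bar>"
    by (auto intro!: order_trans[OF abs_triangle_ineq] add_mono simp: abs_mult mult_left_mono)
  then show ?thesis using a by (auto simp: test_fn_def)
qed

lemma oprs_mono:
  assumes "test_fn \<phi>" "test_fn \<psi>" "\<And>u. u \<in> S \<Longrightarrow> \<phi> u \<le> \<psi> u" "u \<in> S"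
  shows "oprs i m \<phi> u \<le> oprs i m \<psi> u"
  using assms(4)
proof (induction i arbitrary: m u)
  case (Suc i)
  then show ?case unfolding oprs.simps opr_def
    by (intro integral_mono integrable_test test_fn_oprs assms(1,2)) (auto intro: step_in)
qed (use assms in auto)

lemma oprs_affine:
  assumes "test_fn \<phi>" "test_fn \<psi>" "u \<in> S"
  shows "oprs i m (\<lambda>u. p * \<phi> u + q * \<psi> u + e) u = p * oprs i m \<phi> u + q * oprs i m \<psi> u + e"
  using assms(3)
proof (induction i arbitrary: m u)
  case (Suc i)
  have "oprs (Suc i) m (\<lambda>u. p * \<phi> u + q * \<psi> u + e) u =
      (\<integral>z. p * oprs i (Suc m) \<phi> (step m u z) + q * oprs i (Suc m) \<psi> (step m u z) + e \<partial>\<gamma>)"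
    unfolding oprs.simps opr_def by (intro Bochner_Integration.integral_cong refl Suc step_in)
  also have "\<dots> = p * oprs (Suc i) m \<phi> u + q * oprs (Suc i) m \<psi> u + e"
    using integrable_test[OF test_fn_oprs[OF assms(1)] Suc.prems] integrable_test[OF test_fn_oprs[OF assms(2)] Suc.prems]
    by (simp add: opr_def prob_space)
  finally show ?case .
qed auto

end

text \<open>Here \<open>g\<close> measures the descent, \<open>c\<close> the noise leading away from
  \<open>a = 0\<close>, and \<open>C\<close> the errors. The error in the mean carries a factor
  \<open>a\<close>, and the variance is of order \<open>\<alpha>\<^sup>4\<close> where
  \<open>a\<close> vanishes, so neither can cancel the term with \<open>c\<close> near
  \<open>a = 0\<close>.\<close>

locale gap_chain = markov_steps +
  fixes a :: "'b::topological_space \<Rightarrow> real" and \<alpha> :: "nat \<Rightarrow> real" and g c C :: real and n\<^sub>0 :: nat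
  assumes a_measurable: "a \<in> borel_measurable borel"
    and a_range: "u \<in> S \<Longrightarrow> 0 \<le> a u \<and> a u \<le> 1"
    and a_nonneg: "0 \<le> a u"
    and mean_step: "u \<in> S \<Longrightarrow> n\<^sub>0 \<le> n \<Longrightarrow>
      opr n a u - a u \<ge> g * \<alpha> n * (a u * (1 - a u)) + c * (\<alpha> n)\<^sup>2 - C * (\<alpha> n)\<^sup>2 * a u"
    and var_step: "u \<in> S \<Longrightarrow> n\<^sub>0 \<le> n \<Longrightarrow>
      (\<integral>z. (a (step n u z) - a u)\<^sup>2 \<partial>\<gamma>) \<le> C * (\<alpha> n)\<^sup>2 * (a u + (\<alpha> n)\<^sup>2)"
    and params: "0 < c" "0 \<le> C" "0 < g" "\<And>n. 0 < \<alpha> n"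
begin

text \<open>A smooth substitute for the indicator of \<open>a\<close> being at most of size
  \<open>b\<close>: near 1 if \<open>a\<close> is much smaller than \<open>b\<close>, near 0 if it
  is much larger.\<close>

definition pot :: "real \<Rightarrow> 'b \<Rightarrow> real" where "pot b u = b / (a u + b)"

lemma test_a: "test_fn a"
  unfolding test_fn_def using a_measurable a_range by (auto intro!: exI[of _ 1])

lemma test_1_a: "test_fn (\<lambda>u. 1 - a u)"
  unfolding test_fn_def using a_measurable a_range by (auto intro!: exI[of _ 1])

lemma test_a1: "test_fn (\<lambda>u. a u * (1 - a u))"
  unfolding test_fn_def using a_measurable a_range
  by (auto intro!: exI[of _ 1] simp: abs_mult mult_le_one)

lemma test_pot: "0 < b \<Longrightarrow> test_fn (pot b)"
  unfolding test_fn_def pot_def using a_measurable a_range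
  by (auto intro!: exI[of _ 1] simp: abs_le_iff divide_le_eq; smt (verit))

lemma oprs_const: "u \<in> S \<Longrightarrow> oprs i m (\<lambda>_. e) u = e"
  using oprs_affine[OF test_a test_a, of u i m 0 0 e] by simp

lemma oprs_cmult: "test_fn \<phi> \<Longrightarrow> u \<in> S \<Longrightarrow> oprs i m (\<lambda>u. p * \<phi> u) u = p * oprs i m \<phi> u"
  using oprs_affine[of \<phi> \<phi> u i m p 0 0] by simp

lemma one_step:
  assumes "u \<in> S" "n\<^sub>0 \<le> n"
  shows "opr n (\<lambda>u. 1 - a u) u \<le> (1 - a u) + (- g * \<alpha> n) * (a u * (1 - a u)) + C * (\<alpha> n)\<^sup>2"
proof -
  have "opr n (\<lambda>u. 1 - a u) u = 1 - opr n a u"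
    using oprs_affine[OF test_a test_a, of u 1 n "-1" 0 1] assms(1) by simp
  moreover have "C * (\<alpha> n)\<^sup>2 * a u \<le> C * (\<alpha> n)\<^sup>2 * 1"
    using a_range[OF assms(1)] params by (intro mult_left_mono) auto
  moreover have "0 \<le> c * (\<alpha> n)\<^sup>2" using params by simp
  ultimately show ?thesis using mean_step[OF assms] by simp
qed

lemma steps_Suc:
  assumes "u \<in> S" "n\<^sub>0 \<le> m"
  shows "oprs (Suc i) m (\<lambda>u. 1 - a u) u + g * \<alpha> (m + i) * oprs i m (\<lambda>u. a u * (1 - a u)) u
    \<le> oprs i m (\<lambda>u. 1 - a u) u + C * (\<alpha> (m + i))\<^sup>2"
proof -
  have "oprs (Suc i) m (\<lambda>u. 1 - a u) u \<le>
      oprs i m (\<lambda>u. 1 * (1 - a u) + (- g * \<alpha> (m + i)) * (a u * (1 - a u)) + C * (\<alpha> (m + i))\<^sup>2) u"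
    unfolding oprs_Suc_right using one_step assms
    by (intro oprs_mono test_fn_opr test_1_a test_fn_affine test_a1) auto
  also have "\<dots> = 1 * oprs i m (\<lambda>u. 1 - a u) u + (- g * \<alpha> (m + i)) * oprs i m (\<lambda>u. a u * (1 - a u)) u + C * (\<alpha> (m + i))\<^sup>2"
    by (rule oprs_affine[OF test_1_a test_a1 assms(1)])
  finally show ?thesis by simp
qed

lemma oprs_range:
  assumes "u \<in> S"
  shows "0 \<le> oprs i m (\<lambda>u. 1 - a u) u" "oprs i m (\<lambda>u. 1 - a u) u \<le> 1"
    "0 \<le> oprs i m (\<lambda>u. a u * (1 - a u)) u"
proof -
  have t: "test_fn (\<lambda>_. e)" for e by (auto simp: test_fn_def)
  show "0 \<le> oprs i m (\<lambda>u. 1 - a u) u"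
    using oprs_mono[OF t test_1_a, of 0 u i m] oprs_const[OF assms] a_range assms by simp
  show "oprs i m (\<lambda>u. 1 - a u) u \<le> 1"
    using oprs_mono[OF test_1_a t, of 1 u i m] oprs_const[OF assms] a_range assms by simp
  show "0 \<le> oprs i m (\<lambda>u. a u * (1 - a u)) u"
    using oprs_mono[OF t test_a1, of 0 u i m] oprs_const[OF assms] a_range assms by simp
qed

text \<open>Telescoped \<open>steps_Suc\<close>, used in two ways. The total descent over a stretch
  is bounded, so \<open>a * (1 - a)\<close> has a small mean somewhere on a long stretch; and with
  the descent dropped, \<open>1 - a\<close> grows in mean by at most \<open>C\<close> times the sum
  of squares.\<close>

lemma steps_decrease:
  assumes "u \<in> S" "n\<^sub>0 \<le> m" "i \<le> j"
  shows "oprs j m (\<lambda>u. 1 - a u) u + (\<Sum>n=i..<j. g * \<alpha> (m + n) * oprs n m (\<lambda>u. a u * (1 - a u)) u)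
    \<le> oprs i m (\<lambda>u. 1 - a u) u + C * (\<Sum>n=i..<j. (\<alpha> (m + n))\<^sup>2)"
  using assms(3)
proof (induction j rule: dec_induct)
  case (step j)
  then show ?case using steps_Suc[OF assms(1,2), of j] by (simp add: algebra_simps)
qed simp

end

text \<open>The level \<open>b i\<close> is \<open>K\<close> times the unspent part of the budget
  \<tau>, so it falls by \<open>K * s\<close> in each step, as \<open>potential_step\<close>
  demands. The floor \<open>K * R * \<tau>\<close> keeps it large against \<open>s\<close>, which
  yields the side conditions there. Each factor is at most an exponential with the largest level
  \<open>K * (1 + R) * \<tau>\<close> in the denominator. As this level and the sum of squares are
  both of order \<tau>, the total contraction is independent of \<tau>.\<close>

lemma (in gap_chain) pot_contracts:
  assumes "u \<in> S" "n\<^sub>0 \<le> m" and K: "K = 5 * C + 1"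
    and R: "2 \<le> R" "16 * (C + K\<^sup>2) \<le> c * K * R"
    and \<tau>: "0 < \<tau>" "K * (1 + R) * \<tau> \<le> 1" "\<And>i. (\<Sum>n<i. (\<alpha> (m + n))\<^sup>2) \<le> \<tau>"
    and b: "\<And>i. b i = K * (\<tau> - (\<Sum>n<i. (\<alpha> (m + n))\<^sup>2) + R * \<tau>)"
  shows "oprs i m (pot (b i)) u \<le> exp (- min 1 (c / 4) / (K * (1 + R) * \<tau>) * (\<Sum>n<i. (\<alpha> (m + n))\<^sup>2)) * pot (b 0) u"
proof (induction i)
  case (Suc i)
  define s where "s = (\<alpha> (m + i))\<^sup>2"
  define B where "B = K * (1 + R) * \<tau>"
  have K1: "1 \<le> K" using K params by simp
  have s0: "0 \<le> s" by (simp add: s_def)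
  have sum0: "0 \<le> (\<Sum>n<i. (\<alpha> (m + n))\<^sup>2)" for i by (simp add: sum_nonneg)
  have s\<tau>: "s \<le> \<tau>" using \<tau>(3)[of "Suc i"] sum0[of i] by (simp add: s_def)
  have bSuc: "b (Suc i) = b i - K * s" by (simp add: b s_def algebra_simps)
  have bge: "K * (R * \<tau>) \<le> b j" for j
    unfolding b using \<tau>(3)[of j] K1 by (intro mult_left_mono) auto
  have ble: "b j \<le> B" for j
  proof -
    have "b j \<le> K * (\<tau> + R * \<tau>)" unfolding b using sum0[of j] K1 by (intro mult_left_mono) auto
    then show ?thesis by (simp add: B_def algebra_simps)
  qed
  have bpos: "0 < b j" for j
    by (rule less_le_trans[OF _ bge]) (use K1 R \<tau> in auto)
  have Bpos: "0 < B" using bpos[of 0] ble[of 0] by simp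
  have "K * (2 * s) \<le> K * (R * \<tau>)" using R s\<tau> s0 \<tau>(1) K1 by (intro mult_left_mono mult_mono) auto
  then have b2: "2 * K * s \<le> b i" using bge[of i] by simp
  have "16 * (C + K\<^sup>2) * s \<le> c * K * R * \<tau>"
    by (rule mult_mono[OF R(2) s\<tau> order_trans[OF _ R(2)] s0]) (use params in simp)
  also have "\<dots> \<le> c * b i" using bge[of i] params by (simp add: mult.assoc)
  finally have b3: "16 * (C + K\<^sup>2) * s \<le> c * b i" .
  have st: "opr (m + i) (pot (b (Suc i))) u \<le> exp (- min 1 (c / 4) / B * s) * pot (b i) u" if u: "u \<in> S" for u
  proof -
    have "opr (m + i) (pot (b (Suc i))) u = (\<integral>z. (b i - K * s) / (a (step (m + i) u z) + (b i - K * s)) \<partial>\<gamma>)"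
      by (simp add: opr_def pot_def bSuc)
    also have "\<dots> \<le> b i / (a u + b i) * (1 - min 1 (c / 4) * s / b i)"
    proof (rule potential_step[OF prob_space_axioms])
      show "(\<lambda>z. a (step (m + i) u z)) \<in> borel_measurable \<gamma>"
        using measurable_compose[OF step_measurable_section a_measurable] .
      show "0 \<le> a (step (m + i) u z) \<and> a (step (m + i) u z) \<le> 1" if "z \<in> space \<gamma>" for z
        using a_range step_in u that by blast
      have "0 \<le> g * \<alpha> (m + i) * (a u * (1 - a u))"
        using params(3) params(4)[of "m + i"] a_range[OF u] by (intro mult_nonneg_nonneg) auto
      then show "c * s - C * s * a u \<le> (\<integral>z. a (step (m + i) u z) \<partial>\<gamma>) - a u"
        using mean_step[OF u, of "m + i"] assms(2) by (simp add: opr_def s_def)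
      show "(\<integral>z. (a (step (m + i) u z) - a u)\<^sup>2 \<partial>\<gamma>) \<le> C * s * (a u + s)"
        using var_step[OF u, of "m + i"] assms(2) by (simp add: s_def)
      show "b i \<le> 1" using ble[of i] \<tau>(2) by (simp add: B_def)
    qed (use a_range[OF u] params K bpos s0 b2 b3 in auto)
    also have "\<dots> \<le> pot (b i) u * exp (- min 1 (c / 4) / B * s)"
      unfolding pot_def
    proof (intro mult_left_mono)
      have "min 1 (c / 4) * s / B \<le> min 1 (c / 4) * s / b i"
        using ble[of i] bpos[of i] Bpos s0 params by (intro divide_left_mono) auto
      then have "1 - min 1 (c / 4) * s / b i \<le> 1 + (- min 1 (c / 4) / B * s)" by simp
      also have "\<dots> \<le> exp (- min 1 (c / 4) / B * s)" by (rule exp_ge_add_one_self)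
      finally show "1 - min 1 (c / 4) * s / b i \<le> exp (- min 1 (c / 4) / B * s)" .
    qed (use a_nonneg[of u] bpos[of i] in auto)
    finally show ?thesis by (simp add: mult.commute)
  qed
  have "oprs (Suc i) m (pot (b (Suc i))) u \<le> oprs i m (\<lambda>u. exp (- min 1 (c / 4) / B * s) * pot (b i) u) u"
    unfolding oprs_Suc_right using st
    by (intro oprs_mono test_fn_opr test_pot bpos assms(1))
      (use test_fn_affine[OF test_pot[OF bpos[of i]] test_a, of _ 0 0] in auto)
  also have "\<dots> = exp (- min 1 (c / 4) / B * s) * oprs i m (pot (b i)) u"
    by (rule oprs_cmult[OF test_pot[OF bpos] assms(1)])
  also have "\<dots> \<le> exp (- min 1 (c / 4) / B * s) * (exp (- min 1 (c / 4) / B * (\<Sum>n<i. (\<alpha> (m + n))\<^sup>2)) * pot (b 0) u)"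
    using Suc by (intro mult_left_mono) (auto simp: B_def)
  also have "\<dots> = exp (- min 1 (c / 4) / B * (\<Sum>n<Suc i. (\<alpha> (m + n))\<^sup>2)) * pot (b 0) u"
    by (simp add: s_def algebra_simps flip: exp_add)
  finally show ?case unfolding B_def .
qed simp

text \<open>Before \<open>i1\<close> the potential contracts by a fixed factor; between \<open>i1\<close> and \<open>i2\<close> there is a time at which \<open>a (1 - a)\<close>
  is so small that the potential controls \<open>1 - a\<close>; afterwards \<open>1 - a\<close> hardly grows in mean.\<close>
lemma (in gap_chain) window:
  assumes "u \<in> S" "n\<^sub>0 \<le> m" and K: "K = 5 * C + 1"
    and R: "2 \<le> R" "16 * (C + K\<^sup>2) \<le> c * K * R"
    and \<tau>: "0 < \<tau>" "K * (1 + R) * \<tau> \<le> 1" "\<And>i. (\<Sum>n<i. (\<alpha> (m + n))\<^sup>2) \<le> \<tau>"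
    and i1: "\<tau> / 2 \<le> (\<Sum>n<i1. (\<alpha> (m + n))\<^sup>2)"
    and i2: "i1 \<le> i2" "1 + C * \<tau> \<le> g * (K * R * \<tau>\<^sup>2) * (\<Sum>n=i1..<i2. \<alpha> (m + n))"
    and N: "i2 \<le> N"
  shows "oprs N m (\<lambda>u. 1 - a u) u
    \<le> exp (- min 1 (c / 4) / (2 * K * (1 + R))) * (1 - a u) + (K * (1 + R) + 1 + C) * \<tau>"
proof -
  define w where "w n = oprs n m (\<lambda>u. a u * (1 - a u)) u" for n
  \<comment> \<open>Chosen so that division by the lower bound \<open>K * R * \<tau>\<close> of the
    level \<open>b i\<close> leaves exactly \<tau>.\<close>
  define \<eta> where "\<eta> = K * R * \<tau>\<^sup>2"
  define b where "b i = K * (\<tau> - (\<Sum>n<i. (\<alpha> (m + n))\<^sup>2) + R * \<tau>)" for i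
  define \<theta> where "\<theta> = exp (- min 1 (c / 4) / (2 * K * (1 + R)))"
  have K1: "1 \<le> K" using K params by simp
  have sumle: "C * (\<Sum>n=i..<j. (\<alpha> (m + n))\<^sup>2) \<le> C * \<tau>" for i j
  proof -
    have "(\<Sum>n=i..<j. (\<alpha> (m + n))\<^sup>2) \<le> (\<Sum>n<j. (\<alpha> (m + n))\<^sup>2)"
      by (intro sum_mono2) auto
    then show ?thesis using \<tau>(3)[of j] params by (intro mult_left_mono) auto
  qed
  have w0: "0 \<le> w n" for n unfolding w_def by (rule oprs_range(3)[OF assms(1)])
  \<comment> \<open>If the mean of \<open>a * (1 - a)\<close> exceeded \<eta> throughout, the
    descent over this stretch would exceed the \<open>1 + C * \<tau>\<close> that
    \<open>steps_decrease\<close> allows; \<open>i2\<close> was placed far enough for that.\<close>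
  obtain i where i: "i1 \<le> i" "i < i2" "w i \<le> \<eta>"
  proof (rule ccontr)
    assume no: "\<not> thesis"
    note ob = that
    have gt: "\<eta> < w n" if "n \<in> {i1..<i2}" for n
      using no ob[of n] that by (cases "\<eta> < w n") auto
    have "i1 \<noteq> i2" using i2(2) mult_nonneg_nonneg[OF params(2), of \<tau>] \<tau>(1) by auto
    then have "(\<Sum>n=i1..<i2. g * \<alpha> (m + n) * \<eta>) < (\<Sum>n=i1..<i2. g * \<alpha> (m + n) * w n)"
      using gt i2(1) params by (intro sum_strict_mono) auto
    also have "\<dots> \<le> 1 + C * \<tau>"
      using steps_decrease[OF assms(1,2) i2(1)] sumle[of i1 i2] oprs_range(1,2)[OF assms(1), of i2 m]
        oprs_range(2)[OF assms(1), of i1 m] by (simp add: w_def)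
    also have "\<dots> \<le> (\<Sum>n=i1..<i2. g * \<alpha> (m + n) * \<eta>)"
      using i2(2) by (simp add: \<eta>_def sum_distrib_left sum_distrib_right mult_ac)
    finally show False by simp
  qed
  have sum0: "0 \<le> (\<Sum>n<i. (\<alpha> (m + n))\<^sup>2)" for i by (simp add: sum_nonneg)
  have bge: "K * (R * \<tau>) \<le> b i"
    unfolding b_def using \<tau>(3)[of i] K1 by (intro mult_left_mono) auto
  have KRpos: "0 < K * (R * \<tau>)" using K1 R \<tau> by auto
  with bge have bpos: "0 < b i" by linarith
  have b0: "b 0 = K * (1 + R) * \<tau>" by (simp add: b_def algebra_simps)
  have b0pos: "0 < b 0" using K1 R \<tau> by (simp add: b0)
  \<comment> \<open>The difference \<open>1 - a - pot b\<close> equals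
    \<open>a * (1 - a - b) / (a + b)\<close>. Thus the potential accounts for the states with tiny
    \<open>a\<close>, and \<open>a * (1 - a) / b\<close> for the others.\<close>
  have "oprs i m (\<lambda>u. 1 - a u) u \<le> oprs i m (\<lambda>u. 1 * pot (b i) u + 1 / b i * (a u * (1 - a u)) + 0) u"
  proof (intro oprs_mono test_1_a test_fn_affine test_pot bpos test_a1 assms(1))
    fix u assume u: "u \<in> S"
    have au: "0 \<le> a u" "a u \<le> 1" using a_range[OF u] by auto
    have "1 - a u - pot (b i) u = (a u * (1 - a u) - a u * b i) / (a u + b i)"
      using au bpos by (simp add: pot_def field_simps)
    also have "\<dots> \<le> a u * (1 - a u) / (a u + b i)" using au bpos by (intro divide_right_mono) auto
    also have "\<dots> \<le> a u * (1 - a u) / b i" using au bpos by (intro divide_left_mono) auto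
    finally show "1 - a u \<le> 1 * pot (b i) u + 1 / b i * (a u * (1 - a u)) + 0" by simp
  qed
  also have "\<dots> = 1 * oprs i m (pot (b i)) u + 1 / b i * w i + 0"
    unfolding w_def by (rule oprs_affine[OF test_pot[OF bpos] test_a1 assms(1)])
  also have "1 / b i * w i \<le> 1 / (K * (R * \<tau>)) * \<eta>"
    using i(3) w0[of i] bge KRpos bpos by (intro mult_mono divide_left_mono) auto
  also have "\<dots> = \<tau>" using K1 R \<tau>(1) by (simp add: \<eta>_def power2_eq_square)
  also have "oprs i m (pot (b i)) u \<le> \<theta> * pot (b 0) u"
  proof -
    have s: "\<tau> / 2 \<le> (\<Sum>n<i. (\<alpha> (m + n))\<^sup>2)"
      by (rule order_trans[OF i1 sum_mono2]) (use i(1) in auto)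
    have "oprs i m (pot (b i)) u \<le> exp (- min 1 (c / 4) / (K * (1 + R) * \<tau>) * (\<Sum>n<i. (\<alpha> (m + n))\<^sup>2)) * pot (b 0) u"
      by (rule pot_contracts[OF assms(1,2) K R \<tau>]) (simp add: b_def)
    also have "\<dots> \<le> \<theta> * pot (b 0) u"
    proof (intro mult_right_mono)
      have "min 1 (c / 4) / (K * (1 + R) * \<tau>) * (\<tau> / 2) \<le> min 1 (c / 4) / (K * (1 + R) * \<tau>) * (\<Sum>n<i. (\<alpha> (m + n))\<^sup>2)"
        using s K1 R \<tau> params by (intro mult_left_mono) auto
      then show "exp (- min 1 (c / 4) / (K * (1 + R) * \<tau>) * (\<Sum>n<i. (\<alpha> (m + n))\<^sup>2)) \<le> \<theta>"
        using \<tau>(1) by (simp add: \<theta>_def mult_ac)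
    qed (use a_nonneg[of u] b0pos in \<open>auto simp: pot_def\<close>)
    finally show ?thesis .
  qed
  \<comment> \<open>Returns from the potential to \<open>1 - a\<close> at the price of
    \<open>b 0\<close>, which is of order \<tau>. Now the bound has the same quantity on both sides
    and windows can be iterated.\<close>
  also have "\<theta> * pot (b 0) u \<le> \<theta> * ((1 - a u) + b 0)"
  proof (intro mult_left_mono)
    have au: "0 \<le> a u" "a u \<le> 1" using a_range[OF assms(1)] by auto
    have "b 0 \<le> ((1 - a u) + b 0) * (a u + b 0)"
    proof -
      have "((1 - a u) + b 0) * (a u + b 0) = b 0 + a u * (1 - a u) + b 0 * b 0"
        by (simp add: algebra_simps)
      then show ?thesis using au by simp
    qed
    then show "pot (b 0) u \<le> (1 - a u) + b 0" using au b0pos by (simp add: pot_def divide_le_eq)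
  qed (simp add: \<theta>_def)
  also have "\<theta> * ((1 - a u) + b 0) \<le> \<theta> * (1 - a u) + b 0"
  proof -
    have "\<theta> \<le> 1" using params K1 R by (simp add: \<theta>_def)
    then have "\<theta> * b 0 \<le> 1 * b 0" using b0pos by (intro mult_right_mono) auto
    then show ?thesis by (simp add: algebra_simps)
  qed
  finally have at_i: "oprs i m (\<lambda>u. 1 - a u) u \<le> \<theta> * (1 - a u) + K * (1 + R) * \<tau> + \<tau>"
    by (simp add: b0)
  have "oprs N m (\<lambda>u. 1 - a u) u \<le> oprs i m (\<lambda>u. 1 - a u) u + C * \<tau>"
  proof -
    have "0 \<le> (\<Sum>n=i..<N. g * \<alpha> (m + n) * oprs n m (\<lambda>u. a u * (1 - a u)) u)"
      using w0 params by (intro sum_nonneg mult_nonneg_nonneg) (auto simp: w_def less_imp_le)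
    then show ?thesis using steps_decrease[OF assms(1,2), of i N] sumle[of i N] i N by simp
  qed
  with at_i show ?thesis by (simp add: \<theta>_def algebra_simps)
qed

text \<open>The time \<open>N0\<close> is chosen before the chain, its state space and its start;
  this order of quantifiers is the point. Each application of \<open>window\<close> turns a bound
  \<delta> into \<theta> times \<delta> plus a multiple of the tail sum \<tau>. Starting the window
  so late that this multiple is at most half of \<open>(1 - \<theta>) * \<delta>\<close> improves
  the bound by the fixed factor \<open>(1 + \<theta>) / 2\<close>.\<close>

lemma gap_chain_uniform:
  fixes \<gamma> :: "'z measure"
  assumes \<alpha>: "\<And>n. 0 < \<alpha> n" "\<not> summable \<alpha>" "summable (\<lambda>n. (\<alpha> n)\<^sup>2)"
    and par: "0 < c" "0 \<le> C" "0 < g" and "0 < \<delta>"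
  shows "\<exists>N0. \<forall>N\<ge>N0. \<forall>(step :: nat \<Rightarrow> 'u::topological_space \<Rightarrow> 'z \<Rightarrow> 'u) S a u.
    gap_chain \<gamma> step S a \<alpha> g c C n\<^sub>0 \<longrightarrow> u \<in> S \<longrightarrow> markov_steps.oprs \<gamma> step N 0 (\<lambda>u. 1 - a u) u \<le> \<delta>"
proof -
  define K where "K = 5 * C + 1"
  define R where "R = max 2 (16 * (C + K\<^sup>2) / (c * K))"
  define \<theta> where "\<theta> = exp (- min 1 (c / 4) / (2 * K * (1 + R)))"
  define bd where "bd \<delta> N0 \<longleftrightarrow> (\<forall>N\<ge>N0. \<forall>(step :: nat \<Rightarrow> 'u \<Rightarrow> 'z \<Rightarrow> 'u) S a u.
    gap_chain \<gamma> step S a \<alpha> g c C n\<^sub>0 \<longrightarrow> u \<in> S \<longrightarrow> markov_steps.oprs \<gamma> step N 0 (\<lambda>u. 1 - a u) u \<le> \<delta>)" for \<delta> N0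
  have K1: "1 \<le> K" using par by (simp add: K_def)
  have R: "2 \<le> R" by (simp add: R_def)
  have R2: "16 * (C + K\<^sup>2) \<le> c * K * R"
  proof -
    have "16 * (C + K\<^sup>2) / (c * K) \<le> R" by (simp add: R_def)
    then show ?thesis using par K1 by (simp add: divide_le_eq mult_ac)
  qed
  have \<theta>: "0 < \<theta>" "\<theta> < 1" using K1 R par by (auto simp: \<theta>_def)
  have tail: "(\<lambda>m. \<Sum>n. (\<alpha> (n + m))\<^sup>2) \<longlonglongrightarrow> 0"
    by (rule suminf_exist_split2[OF \<alpha>(3)])
  have step: "\<exists>N1. bd ((1 + \<theta>) / 2 * \<delta>) N1" if "bd \<delta> N0" "0 < \<delta>" for \<delta> N0
  proof -
    define B where "B = K * (1 + R) + 1 + C"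
    have B: "0 < B" "K * (1 + R) \<le> B" using K1 R par mult_nonneg_nonneg[of K "1 + R"]
      by (auto simp: B_def simp del: mult_nonneg_nonneg)
    have "0 < min (1 / B) ((1 - \<theta>) / 2 * \<delta> / B)" using B \<theta> that by auto
    from order_tendstoD(2)[OF tail this]
    obtain m0 where m0: "\<And>m. m \<ge> m0 \<Longrightarrow> (\<Sum>n. (\<alpha> (n + m))\<^sup>2) < min (1 / B) ((1 - \<theta>) / 2 * \<delta> / B)"
      by (auto simp: eventually_sequentially)
    \<comment> \<open>Beyond \<open>m0\<close> the tail sum is small, beyond \<open>N0\<close> the
      previous bound \<delta> holds at the start of the window, and beyond \<open>n\<^sub>0\<close>
      the step estimates hold.\<close>
    define m where "m = max m0 (max N0 n\<^sub>0)"
    define \<tau> where "\<tau> = (\<Sum>n. (\<alpha> (m + n))\<^sup>2)"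
    have "\<tau> < min (1 / B) ((1 - \<theta>) / 2 * \<delta> / B)" using m0[of m] by (simp add: \<tau>_def m_def add.commute)
    then have \<tau>B: "B * \<tau> \<le> 1" "B * \<tau> \<le> (1 - \<theta>) / 2 * \<delta>" using B by (auto simp: field_simps)
    have sm: "summable (\<lambda>n. (\<alpha> (m + n))\<^sup>2)"
      using summable_ignore_initial_segment[OF \<alpha>(3), of m] by (simp add: add.commute)
    have \<tau>0: "0 < \<tau>" unfolding \<tau>_def using \<alpha>(1) by (intro suminf_pos sm) (simp add: less_imp_neq[THEN not_sym])
    have \<tau>le: "(\<Sum>n<i. (\<alpha> (m + n))\<^sup>2) \<le> \<tau>" for i unfolding \<tau>_def by (intro sum_le_suminf sm) auto
    have "(\<lambda>i. \<Sum>n<i. (\<alpha> (m + n))\<^sup>2) \<longlonglongrightarrow> \<tau>" unfolding \<tau>_def by (rule summable_LIMSEQ[OF sm])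
    from order_tendstoD(1)[OF this, of "\<tau> / 2"] \<tau>0
    obtain i1 where i1: "\<tau> / 2 \<le> (\<Sum>n<i1. (\<alpha> (m + n))\<^sup>2)"
      by (auto simp: eventually_sequentially intro: less_imp_le)
    define G where "G = g * (K * R * \<tau>\<^sup>2)"
    have G: "0 < G" using par K1 R \<tau>0 by (simp add: G_def)
    have "\<not> summable (\<lambda>n. \<alpha> (n + (m + i1)))" using \<alpha>(2) summable_iff_shift by blast
    then obtain i where i: "(1 + C * \<tau>) / G \<le> (\<Sum>n<i. \<alpha> (n + (m + i1)))"
      using summableI_nonneg_bounded[of "\<lambda>n. \<alpha> (n + (m + i1))" "(1 + C * \<tau>) / G"] \<alpha>(1)
      by (meson less_imp_le linear)
    have "(\<Sum>n<i. \<alpha> (n + (m + i1))) = (\<Sum>n=i1..<i1+i. \<alpha> (m + n))"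
      by (rule sum.reindex_bij_witness[of _ "\<lambda>n. n - i1" "\<lambda>n. n + i1"]) (auto simp: add_ac)
    with i G have i2: "1 + C * \<tau> \<le> G * (\<Sum>n=i1..<i1+i. \<alpha> (m + n))" by (simp add: divide_le_eq mult.commute)
    have KR\<tau>: "K * (1 + R) * \<tau> \<le> 1" using mult_right_mono[OF B(2), of \<tau>] \<tau>B(1) \<tau>0 by linarith
    show ?thesis
    proof (intro exI[of _ "m + (i1 + i)"], unfold bd_def, intro allI impI)
      fix N step S a u
      assume N: "m + (i1 + i) \<le> N" and ch: "gap_chain \<gamma> (step :: nat \<Rightarrow> 'u \<Rightarrow> 'z \<Rightarrow> 'u) S a \<alpha> g c C n\<^sub>0" and u: "u \<in> S"
      interpret gap_chain \<gamma> step S a \<alpha> g c C n\<^sub>0 by fact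
      have t: "test_fn (\<lambda>u. \<theta> * (1 - a u) + 0 * a u + B * \<tau>)"
        by (intro test_fn_affine test_1_a test_a)
      have "oprs N 0 (\<lambda>u. 1 - a u) u = oprs m 0 (oprs (N - m) m (\<lambda>u. 1 - a u)) u"
        using oprs_add[of m "N - m" 0] N by simp
      also have "\<dots> \<le> oprs m 0 (\<lambda>u. \<theta> * (1 - a u) + 0 * a u + B * \<tau>) u"
      proof (intro oprs_mono test_fn_oprs test_1_a t u)
        fix u assume "u \<in> S"
        from window[OF this _ K_def R R2 \<tau>0 KR\<tau> \<tau>le i1, of "i1 + i" "N - m"]
        show "oprs (N - m) m (\<lambda>u. 1 - a u) u \<le> \<theta> * (1 - a u) + 0 * a u + B * \<tau>"
          using N i2 by (simp add: \<theta>_def B_def G_def m_def)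
      qed
      also have "\<dots> = \<theta> * oprs m 0 (\<lambda>u. 1 - a u) u + 0 * oprs m 0 a u + B * \<tau>"
        by (rule oprs_affine[OF test_1_a test_a u])
      also have "\<dots> \<le> \<theta> * \<delta> + (1 - \<theta>) / 2 * \<delta>"
        using that(1) \<theta> \<tau>B(2) ch u unfolding bd_def m_def by (intro add_mono) (auto intro!: mult_left_mono)
      finally show "oprs N 0 (\<lambda>u. 1 - a u) u \<le> (1 + \<theta>) / 2 * \<delta>" by (simp add: field_simps)
    qed
  qed
  have "\<exists>N0. bd (((1 + \<theta>) / 2) ^ n) N0" for n
  proof (induction n)
    case 0
    have "bd 1 0" unfolding bd_def
    proof (intro allI impI)
      fix N step S a u
      assume ch: "gap_chain \<gamma> (step :: nat \<Rightarrow> 'u \<Rightarrow> 'z \<Rightarrow> 'u) S a \<alpha> g c C n\<^sub>0" and u: "u \<in> S"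
      interpret gap_chain \<gamma> step S a \<alpha> g c C n\<^sub>0 by fact
      show "oprs N 0 (\<lambda>u. 1 - a u) u \<le> 1" by (rule oprs_range(2)[OF u])
    qed
    then show ?case by auto
  next
    case (Suc n)
    then show ?case using step \<theta> by fastforce
  qed
  moreover obtain n where "((1 + \<theta>) / 2) ^ n < \<delta>"
    using real_arch_pow_inv[OF \<open>0 < \<delta>\<close>, of "(1 + \<theta>) / 2"] \<theta> by auto
  ultimately show ?thesis unfolding bd_def by (meson less_imp_le order_trans)
qed

section \<open>Orthonormal eigenbases\<close>

definition onset :: "'a::euclidean_space set \<Rightarrow> bool" where
  "onset E \<longleftrightarrow> finite E \<and> (\<forall>e\<in>E. \<forall>e'\<in>E. e \<bullet> e' = (if e = e' then 1 else 0))"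

lemma onset_finite: "onset E \<Longrightarrow> finite E" by (simp add: onset_def)

lemma onset_subset: "onset E \<Longrightarrow> F \<subseteq> E \<Longrightarrow> onset F"
  unfolding onset_def by (meson finite_subset subset_iff)

lemma onset_norm: "onset E \<Longrightarrow> e \<in> E \<Longrightarrow> norm e = 1"
  unfolding onset_def norm_eq_1 by auto

lemma onset_independent: assumes "onset E" shows "independent E"
proof (rule pairwise_orthogonal_independent)
  show "pairwise orthogonal E" using assms unfolding onset_def pairwise_def orthogonal_def by auto
  show "0 \<notin> E" using onset_norm[OF assms] by force
qed

lemma onset_dim_span: "onset E \<Longrightarrow> dim (span E) = card E"
  by (simp add: onset_independent dim_eq_card_independent)

lemma onset_coeff:
  assumes "onset E" "e \<in> E" shows "e \<bullet> (\<Sum>x\<in>E. f x *\<^sub>R x) = f e"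
proof -
  have "e \<bullet> (\<Sum>x\<in>E. f x *\<^sub>R x) = (\<Sum>x\<in>E. if x = e then f e else 0)"
    unfolding inner_sum_right using assms by (intro sum.cong) (auto simp: onset_def)
  then show ?thesis using assms by (simp add: onset_def)
qed

lemma onset_inner_sums:
  assumes "onset E"
  shows "(\<Sum>x\<in>E. f x *\<^sub>R x) \<bullet> (\<Sum>x\<in>E. h x *\<^sub>R x) = (\<Sum>x\<in>E. f x * h x)"
  unfolding inner_sum_left[of _ E] by (intro sum.cong) (simp_all add: onset_coeff[OF assms])

lemma onset_expand:
  assumes "onset E" "y \<in> span E" shows "y = (\<Sum>e\<in>E. (e \<bullet> y) *\<^sub>R e)"
proof -
  obtain f where f: "y = (\<Sum>e\<in>E. f e *\<^sub>R e)"
    using assms span_finite[of E] by (auto simp: onset_def)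
  have "f e = e \<bullet> y" if "e \<in> E" for e unfolding f using onset_coeff[OF assms(1) that] by simp
  then have "(\<Sum>e\<in>E. (e \<bullet> y) *\<^sub>R e) = (\<Sum>e\<in>E. f e *\<^sub>R e)" by (intro sum.cong) auto
  then show ?thesis using f by metis
qed

lemma onset_parseval: "onset E \<Longrightarrow> y \<in> span E \<Longrightarrow> (norm y)\<^sup>2 = (\<Sum>e\<in>E. (e \<bullet> y)\<^sup>2)"
  using onset_inner_sums[of E "\<lambda>e. e \<bullet> y" "\<lambda>e. e \<bullet> y"] onset_expand[of E y]
  unfolding power2_norm_eq_inner power2_eq_square[of "_ \<bullet> _"] by metis

lemma onset_bessel:
  assumes "onset E" shows "(\<Sum>e\<in>E. (e \<bullet> y)\<^sup>2) \<le> (norm y)\<^sup>2"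
proof -
  define p where "p = (\<Sum>e\<in>E. (e \<bullet> y) *\<^sub>R e)"
  have pp: "p \<bullet> p = (\<Sum>e\<in>E. (e \<bullet> y)\<^sup>2)"
    unfolding p_def onset_inner_sums[OF assms] by (simp add: power2_eq_square)
  have py: "p \<bullet> y = (\<Sum>e\<in>E. (e \<bullet> y)\<^sup>2)"
    unfolding p_def inner_sum_left by (simp add: power2_eq_square)
  have "0 \<le> (y - p) \<bullet> (y - p)" by simp
  also have "\<dots> = y \<bullet> y - p \<bullet> p" using pp py by (simp add: algebra_simps inner_commute)
  finally show ?thesis using pp by (simp add: power2_norm_eq_inner)
qed

text \<open>First-order optimality without derivatives: perturbing a maximizer by \<open>t\<close>
  times a direction yields such an inequality, with \<open>p\<close> the directional
  derivative.\<close>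

lemma quadratic_bound_zero:
  fixes p q :: real
  assumes "\<And>t. 2 * t * p \<le> t\<^sup>2 * q" shows "p = 0"
proof (rule ccontr)
  assume "p \<noteq> 0"
  define r where "r = \<bar>q\<bar> + 1"
  have r: "0 < r" "q < r" by (auto simp: r_def)
  have "2 * (p / r) * p \<le> (p / r)\<^sup>2 * q" by (rule assms)
  then have "2 * p\<^sup>2 * r \<le> p\<^sup>2 * q" using r by (simp add: field_simps power2_eq_square)
  then have "2 * r \<le> q" using \<open>p \<noteq> 0\<close> by (simp add: mult.commute[of _ "p\<^sup>2"] mult.assoc)
  then show False using r by linarith
qed

text \<open>Spectral theorem: maximize \<open>x \<bullet> T x\<close> on the unit sphere of
  \<open>W\<close> and pass to the orthogonal complement of the maximizer in \<open>W\<close>.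
  Symmetry is assumed on \<open>W\<close> only, because the compression to which it is applied is
  not symmetric on the whole space.\<close>

lemma self_adjoint_eigenbasis:
  fixes T :: "'a::euclidean_space \<Rightarrow> 'a"
  assumes "linear T" "subspace W" "\<And>x. x \<in> W \<Longrightarrow> T x \<in> W"
    and "\<And>x y. x \<in> W \<Longrightarrow> y \<in> W \<Longrightarrow> T x \<bullet> y = x \<bullet> T y"
  shows "\<exists>E \<theta>. onset E \<and> span E = W \<and> (\<forall>e\<in>E. T e = \<theta> e *\<^sub>R e)"
  using assms(2-)
proof (induction "dim W" arbitrary: W rule: less_induct)
  case less
  interpret T: linear T by fact
  show ?case
  proof (cases "W \<subseteq> {0}")
    case True
    then have "W = {0}" using subspace_0[OF less.prems(1)] by auto
    then show ?thesis by (intro exI[of _ "{}"]) (auto simp: onset_def)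
  next
    case False
    then obtain w0 where w0: "w0 \<in> W" "w0 \<noteq> 0" by auto
    have ne: "sphere 0 1 \<inter> W \<noteq> {}"
    proof -
      have "w0 /\<^sub>R norm w0 \<in> sphere 0 1 \<inter> W"
        using w0 subspace_scale[OF less.prems(1) w0(1)] by simp
      then show ?thesis by blast
    qed
    have cpt: "compact (sphere 0 1 \<inter> W)"
      by (intro compact_Int_closed closed_subspace less.prems) simp
    have cont: "continuous_on (sphere 0 1 \<inter> W) (\<lambda>x. x \<bullet> T x)"
      by (intro continuous_intros linear_continuous_on linear_conv_bounded_linear[THEN iffD1] assms(1))
    from continuous_attains_sup[OF cpt ne cont] obtain e
      where e: "norm e = 1" "e \<in> W" and max: "\<And>x. x \<in> W \<Longrightarrow> norm x = 1 \<Longrightarrow> x \<bullet> T x \<le> e \<bullet> T e"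
      by auto
    define L where "L = e \<bullet> T e"
    have ee: "e \<bullet> e = 1" using e by (simp add: norm_eq_1)
    have max': "x \<bullet> T x \<le> L * (x \<bullet> x)" if x: "x \<in> W" for x
    proof (cases "x = 0")
      case False
      have "(x /\<^sub>R norm x) \<bullet> T (x /\<^sub>R norm x) \<le> L"
        unfolding L_def using False x by (intro max subspace_scale[OF less.prems(1)]) auto
      then have "(x \<bullet> T x) / (norm x)\<^sup>2 \<le> L" by (simp add: T.scaleR field_simps power2_eq_square)
      then show ?thesis using False by (simp add: divide_le_eq power2_norm_eq_inner)
    qed (simp add: T.zero)
    have orth: "w \<bullet> T e = 0" if w: "w \<in> W" "w \<bullet> e = 0" for w
    proof (rule quadratic_bound_zero)
      fix t
      have "e + t *\<^sub>R w \<in> W" using e w less.prems(1) by (simp add: subspace_add subspace_scale)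
      from max'[OF this] have "(e + t *\<^sub>R w) \<bullet> (T e + t *\<^sub>R T w) \<le> L * ((e + t *\<^sub>R w) \<bullet> (e + t *\<^sub>R w))"
        by (simp add: T.add T.scaleR)
      moreover have "e \<bullet> T w = w \<bullet> T e" using less.prems(3)[OF e(2) w(1)] by (simp add: inner_commute)
      ultimately show "2 * t * (w \<bullet> T e) \<le> t\<^sup>2 * (L * (w \<bullet> w) - w \<bullet> T w)"
        using w(2) ee by (simp add: algebra_simps L_def inner_commute power2_eq_square)
    qed
    have Te: "T e = L *\<^sub>R e"
    proof -
      have "T e - L *\<^sub>R e \<in> W" using less.prems e by (simp add: subspace_diff subspace_scale)
      moreover have "(T e - L *\<^sub>R e) \<bullet> e = 0" using ee by (simp add: L_def algebra_simps inner_commute)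
      ultimately have "(T e - L *\<^sub>R e) \<bullet> (T e - L *\<^sub>R e) = 0"
        using orth by (simp add: inner_diff_right)
      then show ?thesis by simp
    qed
    define W' where "W' = W \<inter> {x. e \<bullet> x = 0}"
    have sub: "subspace W'" unfolding W'_def by (intro subspace_inter less.prems subspace_hyperplane)
    have lt: "dim W' < dim W"
    proof (rule dim_psubset)
      have "e \<notin> W'" using ee by (simp add: W'_def)
      then show "span W' \<subset> span W"
        using e(2) sub less.prems(1) unfolding span_eq_iff[THEN iffD2, OF sub] span_eq_iff[THEN iffD2, OF less.prems(1)]
        by (metis Int_lower1 W'_def psubsetI)
    qed
    have inv: "T x \<in> W'" if "x \<in> W'" for x
      using that less.prems(2)[of x] less.prems(3)[OF e(2), of x] by (simp add: W'_def Te)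
    obtain E \<theta> where E: "onset E" "span E = W'" "\<forall>e\<in>E. T e = \<theta> e *\<^sub>R e"
      using less.hyps[OF lt sub inv] less.prems(3) by (auto simp: W'_def)
    have EW: "E \<subseteq> W'" using E(2) span_superset by auto
    have eE: "e \<notin> E" using EW ee by (auto simp: W'_def)
    have "onset (insert e E)"
      using E(1) EW ee eE by (auto simp: onset_def W'_def inner_commute)
    moreover have "span (insert e E) = W"
    proof
      show "span (insert e E) \<subseteq> W" using EW e(2) by (intro span_minimal less.prems) (auto simp: W'_def)
      show "W \<subseteq> span (insert e E)"
      proof
        fix x assume x: "x \<in> W"
        have "x - (e \<bullet> x) *\<^sub>R e \<in> W'"
          using x e(2) less.prems(1) ee by (simp add: W'_def subspace_diff subspace_scale inner_diff_right)
        then have "x - (e \<bullet> x) *\<^sub>R e \<in> span E" using E(2) by simp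
        then show "x \<in> span (insert e E)" by (auto simp: span_insert)
      qed
    qed
    moreover have "\<forall>x\<in>insert e E. T x = (if x = e then L else \<theta> x) *\<^sub>R x" using E(3) Te by auto
    ultimately show ?thesis by (intro exI conjI)
  qed
qed

text \<open>Connects the list built from eigenspace dimensions with an orthonormal basis: the
  eigenspace of \<open>t\<close> is spanned by the basis vectors with eigenvalue \<open>t\<close>,
  so both count the same multiplicities. Sorting the basis by eigenvalue aligns its positions with
  those of \<open>eigvals A\<close>.\<close>

lemma eigvals_eigenbasis:
  fixes A :: "real^'n::finite^'n"
  assumes sym: "\<And>x y. (A *v x) \<bullet> y = x \<bullet> (A *v y)"
  obtains E where "low_eigenvectors A CARD('n) E" "length (eigvals A) = CARD('n)" "sorted (eigvals A)"
proof -
  define T where "T = (\<lambda>y. A *v y)"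
  have "\<exists>E \<theta>. onset E \<and> span E = UNIV \<and> (\<forall>e\<in>E. T e = \<theta> e *\<^sub>R e)"
    by (rule self_adjoint_eigenbasis) (auto simp: T_def sym)
  then obtain E \<theta> where E: "onset E" "span E = UNIV" "\<And>e. e \<in> E \<Longrightarrow> T e = \<theta> e *\<^sub>R e" by blast
  have fin: "finite E" by (rule onset_finite[OF E(1)])
  have cardE: "card E = CARD('n)" using onset_dim_span[OF E(1)] E(2) by simp
  have coeff: "e \<bullet> y = 0" if "e \<in> E" "T y = t *\<^sub>R y" "\<theta> e \<noteq> t" for e y t
  proof -
    have "t * (e \<bullet> y) = e \<bullet> T y" using that by simp
    also have "\<dots> = T e \<bullet> y" by (simp add: T_def sym)
    finally show ?thesis using that E(3) by simp
  qed
  have espace: "eigenspace_on UNIV T t = span {e\<in>E. \<theta> e = t}" for t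
  proof
    show "eigenspace_on UNIV T t \<subseteq> span {e\<in>E. \<theta> e = t}"
    proof
      fix y assume "y \<in> eigenspace_on UNIV T t"
      then have y: "T y = t *\<^sub>R y" by (simp add: eigenspace_on_def)
      have "y = (\<Sum>e\<in>E. (e \<bullet> y) *\<^sub>R e)" using onset_expand[OF E(1)] E(2) by simp
      also have "\<dots> = (\<Sum>e\<in>{e\<in>E. \<theta> e = t}. (e \<bullet> y) *\<^sub>R e)"
        by (rule sum.mono_neutral_right) (use fin coeff[OF _ y] in auto)
      also have "\<dots> \<in> span {e\<in>E. \<theta> e = t}" by (intro span_sum span_scale span_base)
      finally show "y \<in> span {e\<in>E. \<theta> e = t}" .
    qed
    have "subspace (eigenspace_on UNIV T t)"
      unfolding subspace_def eigenspace_on_def T_def by (auto simp: matrix_vector_right_distrib scaleR_add_right matrix_vector_mult_scaleR)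
    then show "span {e\<in>E. \<theta> e = t} \<subseteq> eigenspace_on UNIV T t"
      by (intro span_minimal) (auto simp: eigenspace_on_def E(3))
  qed
  have dims: "dim (eigenspace_on UNIV T t) = card {e\<in>E. \<theta> e = t}" for t
    unfolding espace by (rule onset_dim_span[OF onset_subset[OF E(1)]]) auto
  have spec: "spectrum_on UNIV T = \<theta> ` E"
  proof
    show "spectrum_on UNIV T \<subseteq> \<theta> ` E"
    proof
      fix t assume "t \<in> spectrum_on UNIV T"
      then obtain y where y: "y \<noteq> 0" "T y = t *\<^sub>R y" by (auto simp: spectrum_on_def)
      show "t \<in> \<theta> ` E"
      proof (rule ccontr)
        assume "t \<notin> \<theta> ` E"
        then have "e \<bullet> y = 0" if "e \<in> E" for e using coeff[OF that y(2)] that by auto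
        then have "y = 0" using onset_expand[OF E(1), of y] E(2) by simp
        then show False using y by simp
      qed
    qed
    show "\<theta> ` E \<subseteq> spectrum_on UNIV T"
    proof
      fix t assume "t \<in> \<theta> ` E"
      then obtain e where e: "e \<in> E" "t = \<theta> e" by auto
      then have "e \<noteq> 0" using onset_norm[OF E(1)] by force
      then show "t \<in> spectrum_on UNIV T" using E(3) e by (auto simp: spectrum_on_def)
    qed
  qed
  have cnt: "count (\<Sum>t\<in>I. replicate_mset (N t) t) s = (if s \<in> I then N s else 0)" if "finite I"
    for I :: "real set" and N :: "real \<Rightarrow> nat" and s
    using that by (induction I rule: finite_induct) auto
  have "(\<Sum>t\<in>spectrum_on UNIV T. replicate_mset (dim (eigenspace_on UNIV T t)) t) = image_mset \<theta> (mset_set E)"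
    unfolding spec dims
  proof (rule multiset_eqI)
    fix s
    have "count (image_mset \<theta> (mset_set E)) s = (\<Sum>e\<in>{e\<in>E. \<theta> e = s}. count (mset_set E) e)"
      unfolding count_image_mset using fin by (intro sum.cong) auto
    also have "\<dots> = (\<Sum>e\<in>{e\<in>E. \<theta> e = s}. 1)" by (intro sum.cong) (auto simp: fin)
    finally have "count (image_mset \<theta> (mset_set E)) s = card {e\<in>E. \<theta> e = s}" by simp
    then show "count (\<Sum>t\<in>\<theta> ` E. replicate_mset (card {e\<in>E. \<theta> e = t}) t) s = count (image_mset \<theta> (mset_set E)) s"
      using fin by (auto simp: cnt)
  qed
  moreover obtain es where es: "set es = E" "distinct es" using finite_distinct_list[OF fin] by blast
  ultimately have "eigvals A = sorted_list_of_multiset (mset (map \<theta> (sort_key \<theta> es)))"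
    unfolding eigvals_def eigvals_on_def T_def by (simp add: mset_set_set[symmetric] flip: T_def)
  then have ev: "eigvals A = map \<theta> (sort_key \<theta> es)"
    unfolding sorted_list_of_multiset_mset by (simp only: sorted_sort_id[OF sorted_sort_key])
  have len: "length es = CARD('n)" using es cardE distinct_card by metis
  have "low_eigenvectors A CARD('n) (sort_key \<theta> es)"
    unfolding low_eigenvectors_def
  proof (intro conjI allI impI)
    fix i j assume ij: "i < CARD('n)" "j < CARD('n)"
    have "distinct (sort_key \<theta> es)" using es by simp
    then have "sort_key \<theta> es ! i = sort_key \<theta> es ! j \<longleftrightarrow> i = j" using ij len by (simp add: nth_eq_iff_index_eq)
    moreover have "sort_key \<theta> es ! i \<in> E" "sort_key \<theta> es ! j \<in> E"
      using ij len es(1) nth_mem[of _ "sort_key \<theta> es"] by auto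
    ultimately show "sort_key \<theta> es ! i \<bullet> sort_key \<theta> es ! j = (if i = j then 1 else 0)"
      using E(1) by (simp add: onset_def)
    show "A *v (sort_key \<theta> es ! i) = (eigvals A ! i) *\<^sub>R (sort_key \<theta> es ! i)"
      using E(3)[OF \<open>sort_key \<theta> es ! i \<in> E\<close>] ij len by (simp add: ev T_def)
  qed (simp add: len)
  moreover have "length (eigvals A) = CARD('n)" "sorted (eigvals A)" by (simp_all add: ev len)
  ultimately show ?thesis using that by blast
qed

lemma onset_set_list:
  assumes "\<forall>i<length V. \<forall>j<length V. V ! i \<bullet> V ! j = (if i = j then 1 else 0)"
  shows "onset (set V)" "distinct V" "card (set V) = length V"
proof -
  show d: "distinct V" unfolding distinct_conv_nth using assms by (metis zero_neq_one)
  show "onset (set V)" unfolding onset_def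
    using assms nth_eq_iff_index_eq[OF d] by (auto simp: in_set_conv_nth)
  show "card (set V) = length V" by (rule distinct_card[OF d])
qed

lemma outer_mult: "outer u v *v y = (v \<bullet> y) *\<^sub>R u"
  unfolding outer_def matrix_vector_mult_def vec_eq_iff
  by (simp add: inner_vec_def sum_distrib_left sum_distrib_right mult_ac)

lemma gram_mult_list: "gram V *v y = (\<Sum>v\<leftarrow>V. (v \<bullet> y) *\<^sub>R v)"
  unfolding gram_def by (induction V) (simp_all add: outer_mult matrix_vector_mult_add_rdistrib)

lemma gram_mult: "distinct V \<Longrightarrow> gram V *v y = (\<Sum>v\<in>set V. (v \<bullet> y) *\<^sub>R v)"
  unfolding gram_mult_list by (rule sum_list_distinct_conv_sum_set)

lemma onset_perp:
  assumes "onset E" "span E = UNIV" "F \<subseteq> E" "\<And>e. e \<in> F \<Longrightarrow> e \<bullet> u = 0"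
  shows "u = (\<Sum>e\<in>E - F. (e \<bullet> u) *\<^sub>R e)"
proof -
  have "u = (\<Sum>e\<in>E. (e \<bullet> u) *\<^sub>R e)" using onset_expand[OF assms(1)] assms(2) by simp
  also have "\<dots> = (\<Sum>e\<in>E - F. (e \<bullet> u) *\<^sub>R e)"
    by (rule sum.mono_neutral_right) (use assms onset_finite in auto)
  finally show ?thesis .
qed

lemma eigen_form:
  fixes A :: "real^'n::finite^'n"
  assumes E: "onset E" "\<And>e. e \<in> E \<Longrightarrow> A *v e = \<theta> e *\<^sub>R e" and u: "u \<in> span E"
  shows "u \<bullet> (A *v u) = (\<Sum>e\<in>E. \<theta> e * (e \<bullet> u)\<^sup>2)"
proof -
  have "A *v u = A *v (\<Sum>e\<in>E. (e \<bullet> u) *\<^sub>R e)" using onset_expand[OF E(1) u] by simp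
  also have "\<dots> = (\<Sum>e\<in>E. (\<theta> e * (e \<bullet> u)) *\<^sub>R e)"
    unfolding linear_sum[OF matrix_vector_mul_linear] matrix_vector_mult_scaleR
    by (intro sum.cong) (simp_all add: E(2) mult.commute)
  finally have "u \<bullet> (A *v u) = (\<Sum>e\<in>E. (e \<bullet> u) *\<^sub>R e) \<bullet> (\<Sum>e\<in>E. (\<theta> e * (e \<bullet> u)) *\<^sub>R e)"
    using onset_expand[OF E(1) u] by metis
  then show ?thesis unfolding onset_inner_sums[OF E(1)] by (simp add: power2_eq_square mult_ac)
qed

text \<open>The eigenvectors are indexed by position, so eigenvalues with multiplicity stay aligned with \<^const>\<open>eigvals\<close>.\<close>
lemma eigenbasis_indexed:
  fixes A :: "real^'n::finite^'n"
  assumes "\<And>x y. (A *v x) \<bullet> y = x \<bullet> (A *v y)"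
  obtains e where "inj_on e {..<CARD('n)}" "onset (e ` {..<CARD('n)})" "span (e ` {..<CARD('n)}) = UNIV"
    "\<And>i. i < CARD('n) \<Longrightarrow> A *v e i = (eigvals A ! i) *\<^sub>R e i"
    "\<And>i. i < CARD('n) \<Longrightarrow> i \<le> j \<Longrightarrow> j < CARD('n) \<Longrightarrow> eigvals A ! i \<le> eigvals A ! j"
proof -
  obtain E where E: "low_eigenvectors A CARD('n) E" "length (eigvals A) = CARD('n)" "sorted (eigvals A)"
    using eigvals_eigenbasis[OF assms] by blast
  have len: "length E = CARD('n)" and on: "\<forall>i<length E. \<forall>j<length E. E ! i \<bullet> E ! j = (if i = j then 1 else 0)"
    using E(1) by (auto simp: low_eigenvectors_def)
  note o = onset_set_list[OF on]
  have img: "(!) E ` {..<CARD('n)} = set E" using len by (auto simp: set_conv_nth)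
  show ?thesis
  proof (rule that[of "(!) E"])
    show "inj_on ((!) E) {..<CARD('n)}" using o(2) len by (simp add: inj_on_def nth_eq_iff_index_eq)
    show "onset ((!) E ` {..<CARD('n)})" using o(1) img by simp
    have "dim (span (set E)) = DIM(real^'n)" using onset_dim_span[OF o(1)] o(3) len by simp
    then show "span ((!) E ` {..<CARD('n)}) = UNIV" unfolding img using dim_eq_full[of "set E"] by simp
  qed (use E in \<open>auto simp: low_eigenvectors_def sorted_nth_mono\<close>)
qed

text \<open>\<open>V\<close> is some choice of eigenvectors, unrelated to the eigenbasis
  \<open>e\<close>. Because of the gap between \<open>lo\<close> and \<open>hi\<close>, its vectors
  are orthogonal to all \<open>e j\<close> with \<open>k \<le> j\<close>; by dimension
  \<open>V\<close> and the first \<open>k\<close> basis vectors span the same space. The form can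
  then be evaluated in the basis.\<close>

lemma low_eigenvectors_forms:
  fixes A :: "real^'n::finite^'n"
  assumes sym: "\<And>x y. (A *v x) \<bullet> y = x \<bullet> (A *v y)" and V: "low_eigenvectors A k V" and k: "k \<le> CARD('n)"
    and lo: "\<And>i. i < k \<Longrightarrow> eigvals A ! i \<le> lo" and hi: "\<And>i. k \<le> i \<Longrightarrow> i < CARD('n) \<Longrightarrow> hi \<le> eigvals A ! i"
    and lohi: "lo < hi"
  shows "u \<in> span (set V) \<Longrightarrow> u \<bullet> (A *v u) \<le> lo * (norm u)\<^sup>2"
    and "(\<And>v. v \<in> set V \<Longrightarrow> v \<bullet> u = 0) \<Longrightarrow> hi * (norm u)\<^sup>2 \<le> u \<bullet> (A *v u)"
proof -
  obtain e where inj: "inj_on e {..<CARD('n)}" and on: "onset (e ` {..<CARD('n)})" "span (e ` {..<CARD('n)}) = UNIV"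
    and ev: "\<And>i. i < CARD('n) \<Longrightarrow> A *v e i = (eigvals A ! i) *\<^sub>R e i"
    using eigenbasis_indexed[OF sym] by metis
  define n where "n = CARD('n)"
  define \<theta> where "\<theta> = (\<lambda>x. eigvals A ! (the_inv_into {..<n} e x))"
  have \<theta>: "\<theta> (e i) = eigvals A ! i" if "i < n" for i
    using the_inv_into_f_f[OF inj, of i] that by (simp add: \<theta>_def n_def)
  have lenV: "length V = k" and onV: "\<forall>i<length V. \<forall>j<length V. V ! i \<bullet> V ! j = (if i = j then 1 else 0)"
    and evV: "\<And>i. i < k \<Longrightarrow> A *v (V ! i) = (eigvals A ! i) *\<^sub>R (V ! i)"
    using V by (auto simp: low_eigenvectors_def)
  note o = onset_set_list[OF onV]
  define F where "F = e ` {..<k}"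
  have FE: "F \<subseteq> e ` {..<n}" using k by (auto simp: F_def n_def)
  have onF: "onset F" using onset_subset[OF on(1)] FE by (simp add: n_def)
  have EF: "e ` {..<n} - F = e ` {k..<n}"
  proof -
    have "e ` ({..<n} - {..<k}) = e ` {..<n} - e ` {..<k}"
      by (rule inj_on_image_set_diff[OF inj]) (use k in \<open>auto simp: n_def\<close>)
    moreover have "{..<n} - {..<k} = {k..<n}" by auto
    ultimately show ?thesis by (simp add: F_def)
  qed
  have VF: "set V \<subseteq> span F"
  proof
    fix v assume "v \<in> set V"
    then obtain i where i: "i < k" "v = V ! i" using lenV by (auto simp: in_set_conv_nth)
    have z: "x \<bullet> v = 0" if x: "x \<in> e ` {..<n} - F" for x
    proof -
      obtain j where j: "k \<le> j" "j < n" "x = e j" using x unfolding EF by auto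
      have "(eigvals A ! j) * (x \<bullet> v) = (A *v x) \<bullet> v" using ev j by (simp add: n_def)
      also have "\<dots> = (eigvals A ! i) * (x \<bullet> v)" using evV[OF i(1)] i by (simp add: sym)
      finally show ?thesis using lo[OF i(1)] hi[OF j(1)] j(2) lohi by (auto simp: n_def)
    qed
    have "v = (\<Sum>x\<in>e ` {..<n} - (e ` {..<n} - F). (x \<bullet> v) *\<^sub>R x)"
      by (rule onset_perp) (use on z in \<open>auto simp: n_def\<close>)
    also have "\<dots> \<in> span F" using FE by (intro span_sum span_scale span_base) auto
    finally show "v \<in> span F" .
  qed
  have "span (set V) = span F"
  proof (rule subspace_dim_equal)
    show "span (set V) \<subseteq> span F" using VF by (simp add: span_minimal)
    have "card F = k" unfolding F_def using inj k by (subst card_image) (auto intro: inj_on_subset)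
    then show "dim (span F) \<le> dim (span (set V))"
      using onset_dim_span[OF onF] onset_dim_span[OF o(1)] o(3) lenV by simp
  qed auto
  note VF = this
  have evF: "A *v x = \<theta> x *\<^sub>R x" if "x \<in> e ` {..<n}" for x using ev \<theta> that by (auto simp: n_def)
  show "u \<bullet> (A *v u) \<le> lo * (norm u)\<^sup>2" if "u \<in> span (set V)"
  proof -
    have u: "u \<in> span F" using that VF by simp
    have "u \<bullet> (A *v u) = (\<Sum>x\<in>F. \<theta> x * (x \<bullet> u)\<^sup>2)"
      by (rule eigen_form[OF onF _ u]) (use evF FE in auto)
    also have "\<dots> \<le> (\<Sum>x\<in>F. lo * (x \<bullet> u)\<^sup>2)"
      using lo \<theta> k by (intro sum_mono mult_right_mono) (auto simp: F_def n_def)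
    finally show ?thesis by (simp add: onset_parseval[OF onF u] sum_distrib_left)
  qed
  show "hi * (norm u)\<^sup>2 \<le> u \<bullet> (A *v u)" if z: "\<And>v. v \<in> set V \<Longrightarrow> v \<bullet> u = 0"
  proof -
    have zF: "x \<bullet> u = 0" if "x \<in> F" for x
    proof -
      have "x \<in> span (set V)" using that VF by (simp add: span_base)
      then have "orthogonal u x"
        by (rule orthogonal_to_span) (auto simp: orthogonal_def z inner_commute[of u])
      then show ?thesis by (simp add: orthogonal_def inner_commute)
    qed
    have "u = (\<Sum>x\<in>e ` {..<n} - F. (x \<bullet> u) *\<^sub>R x)"
      using onset_perp[OF on _ zF] FE unfolding n_def by blast
    also have "\<dots> \<in> span (e ` {k..<n})" unfolding EF by (intro span_sum span_scale span_base)
    finally have u: "u \<in> span (e ` {k..<n})" .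
    have onG: "onset (e ` {k..<n})" by (rule onset_subset[OF on(1)]) (auto simp: n_def)
    have "(\<Sum>x\<in>e ` {k..<n}. hi * (x \<bullet> u)\<^sup>2) \<le> (\<Sum>x\<in>e ` {k..<n}. \<theta> x * (x \<bullet> u)\<^sup>2)"
      using hi \<theta> by (intro sum_mono mult_right_mono) (auto simp: n_def)
    also have "\<dots> = u \<bullet> (A *v u)"
      by (rule eigen_form[OF onG _ u, symmetric]) (use evF in auto)
    finally show ?thesis by (simp add: onset_parseval[OF onG u] sum_distrib_left)
  qed
qed

text \<open>A dimension count as in the min-max principle. For \<open>i < k\<close> the eigenvectors
  from position \<open>i\<close> on span a space that meets \<open>span V\<close>; if the
  \<open>i\<close>-th eigenvalue were nonnegative, the form would be nonnegative there. Dually, the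
  first \<open>i + 1\<close> eigenvectors with \<open>k \<le> i\<close> meet the orthogonal
  complement of \<open>V\<close>. This gives the signs for a perturbed matrix from test spaces of
  the unperturbed one.\<close>

lemma eigvals_signs:
  fixes A :: "real^'n::finite^'n"
  assumes sym: "\<And>x y. (A *v x) \<bullet> y = x \<bullet> (A *v y)" and V: "onset V" "card V = k" 
    and neg: "\<And>u. u \<in> span V \<Longrightarrow> u \<noteq> 0 \<Longrightarrow> u \<bullet> (A *v u) < 0"
    and pos: "\<And>u. (\<And>v. v \<in> V \<Longrightarrow> v \<bullet> u = 0) \<Longrightarrow> u \<noteq> 0 \<Longrightarrow> 0 < u \<bullet> (A *v u)"
    and i: "i < CARD('n)"
  shows "if i < k then eigvals A ! i < 0 else 0 < eigvals A ! i"
proof -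
  obtain e where inj: "inj_on e {..<CARD('n)}" and on: "onset (e ` {..<CARD('n)})" "span (e ` {..<CARD('n)}) = UNIV"
    and ev: "\<And>i. i < CARD('n) \<Longrightarrow> A *v e i = (eigvals A ! i) *\<^sub>R e i"
    and mono: "\<And>i j. i < CARD('n) \<Longrightarrow> i \<le> j \<Longrightarrow> j < CARD('n) \<Longrightarrow> eigvals A ! i \<le> eigvals A ! j"
    using eigenbasis_indexed[OF sym] by (smt (verit))
  define n where "n = CARD('n)"
  define \<theta> where "\<theta> = (\<lambda>x. eigvals A ! (the_inv_into {..<n} e x))"
  have \<theta>: "\<theta> (e i) = eigvals A ! i" if "i < n" for i
    using the_inv_into_f_f[OF inj, of i] that by (simp add: \<theta>_def n_def)
  have evF: "A *v x = \<theta> x *\<^sub>R x" if "x \<in> e ` {..<n}" for x using ev \<theta> that by (auto simp: n_def)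
  have meet: "\<exists>u. u \<noteq> 0 \<and> u \<in> span (e ` I) \<and> u \<in> S" if I: "I \<subseteq> {..<n}" and S: "subspace S" "n < card I + dim S" for I S
  proof (rule ccontr)
    assume "\<not> ?thesis"
    then have "span (e ` I) \<inter> S \<subseteq> {0}" by auto
    then have d0: "dim (span (e ` I) \<inter> S) = 0" by (simp only: dim_eq_0)
    have "card (e ` I) = card I" using inj I by (intro card_image) (auto simp: n_def intro: inj_on_subset)
    then have "dim (span (e ` I)) = card I"
      using onset_dim_span[OF onset_subset[OF on(1)], of "e ` I"] I by (auto simp: n_def)
    then have "dim {x + y |x y. x \<in> span (e ` I) \<and> y \<in> S} = card I + dim S"
      using dim_sums_Int[OF subspace_span S(1), of "e ` I"] d0 by simp
    moreover have "dim {x + y |x y. x \<in> span (e ` I) \<and> y \<in> S} \<le> n"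
      using dim_subset_UNIV[where 'a = "real^'n"] by (simp add: n_def)
    ultimately show False using S(2) by simp
  qed
  have form: "u \<bullet> (A *v u) = (\<Sum>x\<in>e ` I. \<theta> x * (x \<bullet> u)\<^sup>2)" if "u \<in> span (e ` I)" "I \<subseteq> {..<n}" for u I
    by (rule eigen_form[OF onset_subset[OF on(1)] _ that(1)]) (use that evF in \<open>auto simp: n_def\<close>)
  show ?thesis
  proof (cases "i < k")
    case True
    have "eigvals A ! i < 0"
    proof (rule ccontr)
      assume nn: "\<not> eigvals A ! i < 0"
      have "n < card {i..<n} + dim (span V)" using V i True onset_dim_span[OF V(1)] by (simp add: n_def)
      moreover have "{i..<n} \<subseteq> {..<n}" by auto
      ultimately obtain u where u: "u \<noteq> 0" "u \<in> span (e ` {i..<n})" "u \<in> span V"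
        using meet[OF _ subspace_span] by blast
      have "0 \<le> (\<Sum>x\<in>e ` {i..<n}. \<theta> x * (x \<bullet> u)\<^sup>2)"
      proof (intro sum_nonneg mult_nonneg_nonneg)
        fix x assume "x \<in> e ` {i..<n}"
        then obtain j where "x = e j" "i \<le> j" "j < n" by auto
        then show "0 \<le> \<theta> x" using mono[of i j] \<theta>[of j] nn i by (simp add: n_def)
      qed simp
      also have "\<dots> = u \<bullet> (A *v u)" by (rule form[OF u(2), symmetric]) auto
      finally have "0 \<le> u \<bullet> (A *v u)" .
      then show False using neg[OF u(3,1)] by simp
    qed
    then show ?thesis using True by simp
  next
    case False
    have "0 < eigvals A ! i"
    proof (rule ccontr)
      assume nn: "\<not> 0 < eigvals A ! i"
      define S where "S = {u. \<forall>v\<in>span V. orthogonal v u}"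
      have S: "subspace S" unfolding S_def subspace_def by (auto simp: orthogonal_def inner_add_right)
      have "dim S + dim (span V) = n"
        using dim_subspace_orthogonal_to_vectors[of "span V" UNIV] by (simp add: S_def n_def)
      then have "n < card {..i} + dim S" using V False onset_dim_span[OF V(1)] by simp
      then obtain u where u: "u \<noteq> 0" "u \<in> span (e ` {..i})" "u \<in> S"
        using meet[OF _ S, of "{..i}"] i by (fastforce simp: n_def)
      have "(\<Sum>x\<in>e ` {..i}. \<theta> x * (x \<bullet> u)\<^sup>2) \<le> 0"
      proof (intro sum_nonpos mult_nonpos_nonneg)
        fix x assume "x \<in> e ` {..i}"
        then obtain j where "x = e j" "j \<le> i" by auto
        then show "\<theta> x \<le> 0" using mono[of j i] \<theta>[of j] nn i by (simp add: n_def)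
      qed simp
      moreover have "{..i} \<subseteq> {..<n}" using i by (auto simp: n_def)
      ultimately have "u \<bullet> (A *v u) \<le> 0" using form[OF u(2)] by simp
      moreover have "0 < u \<bullet> (A *v u)" using u by (intro pos) (auto simp: S_def orthogonal_def span_base)
      ultimately show False by simp
    qed
    then show ?thesis using False by simp
  qed
qed

section \<open>Perturbation of spectral projections\<close>

text \<open>The pair \<open>p, q\<close> spans a plane on which both operators are reduced to \<open>2 \<times> 2\<close> matrices:
  \<open>p\<close> attains the largest angle \<open>\<theta>\<close> to the range of \<open>Q\<close>, \<open>q\<close> is its partner in the kernel of \<open>Q\<^sub>0\<close>.
  The bound \<open>sin (2 \<theta>) \<le> h / \<mu>\<close> alone does not suffice; the signs give \<open>\<theta> < \<pi> / 4\<close>.\<close>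
lemma sin_two_theta:
  fixes Q Q\<^sub>0 T T\<^sub>0 :: "'a::euclidean_space \<Rightarrow> 'a"
  assumes lin: "linear Q" "linear Q\<^sub>0" "linear T" "linear T\<^sub>0"
    and Q: "\<And>x. Q (Q x) = Q x" "\<And>x y. Q x \<bullet> y = x \<bullet> Q y" "\<And>x. T (Q x) = Q (T x)"
    and Q0: "\<And>x. Q\<^sub>0 (Q\<^sub>0 x) = Q\<^sub>0 x" "\<And>x y. Q\<^sub>0 x \<bullet> y = x \<bullet> Q\<^sub>0 y" "\<And>x. T\<^sub>0 (Q\<^sub>0 x) = Q\<^sub>0 (T\<^sub>0 x)"
    and T0: "\<And>x y. T\<^sub>0 x \<bullet> y = x \<bullet> T\<^sub>0 y"
    and low: "\<And>x. Q x = x \<Longrightarrow> x \<bullet> T x \<le> - \<mu> * (norm x)\<^sup>2" and high: "\<And>x. Q x = 0 \<Longrightarrow> \<mu> * (norm x)\<^sup>2 \<le> x \<bullet> T x"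
    and low0: "\<And>x. Q\<^sub>0 x = x \<Longrightarrow> x \<noteq> 0 \<Longrightarrow> x \<bullet> T\<^sub>0 x < 0" and high0: "\<And>x. Q\<^sub>0 x = 0 \<Longrightarrow> x \<noteq> 0 \<Longrightarrow> 0 < x \<bullet> T\<^sub>0 x"
    and pert: "\<And>x y. \<bar>x \<bullet> (T\<^sub>0 y - T y)\<bar> \<le> h * norm x * norm y" and h: "0 \<le> h" "h < \<mu>"
    and u: "Q\<^sub>0 u = u"
  shows "norm (u - Q u) \<le> h / (sqrt 2 * \<mu>) * norm u"
proof (cases "u = 0")
  case True
  then show ?thesis using linear_0[OF lin(1)] by simp
next
  case False
  interpret Q: linear Q by fact
  interpret Q0: linear Q\<^sub>0 by fact
  interpret T: linear T by fact
  interpret T0: linear T\<^sub>0 by fact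
  define N where "N = {x. norm x = 1 \<and> Q\<^sub>0 x = x}"
  have contQ: "continuous_on A Q" "continuous_on A Q\<^sub>0" for A
    using lin by (auto intro!: linear_continuous_on simp: linear_conv_bounded_linear)
  have "N = sphere 0 1 \<inter> {x. Q\<^sub>0 x = x}" by (auto simp: N_def)
  moreover have "closed {x. Q\<^sub>0 x = x}" by (intro closed_Collect_eq contQ continuous_intros)
  ultimately have cN: "compact N" by (simp add: compact_Int_closed)
  have uN: "u /\<^sub>R norm u \<in> N" using False u by (simp add: N_def Q0.scaleR)
  have "continuous_on N (\<lambda>x. norm (x - Q x))" by (intro continuous_intros contQ)
  moreover have "N \<noteq> {}" using uN by blast
  ultimately obtain p where "p \<in> N" and max: "\<And>x. x \<in> N \<Longrightarrow> norm (x - Q x) \<le> norm (p - Q p)"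
    using continuous_attains_sup[OF cN] by blast
  then have p: "norm p = 1" "Q\<^sub>0 p = p" by (auto simp: N_def)
  define a b where "a = Q p" and "b = p - Q p"
  define s where "s = norm b"
  have Qb: "Q b = 0" by (simp add: b_def Q.diff Q(1))
  have Qa: "Q a = a" by (simp add: a_def Q(1))
  have ab: "a \<bullet> b = 0" "p = a + b" unfolding a_def Q(2) using Qb by (simp_all add: b_def)
  have pp: "p \<bullet> p = 1" using p by (simp add: norm_eq_1)
  have bb: "b \<bullet> b = s\<^sup>2" by (simp add: s_def power2_norm_eq_inner)
  have pb: "p \<bullet> b = s\<^sup>2" using ab bb by (simp add: inner_add_left)
  have aa: "a \<bullet> a = 1 - s\<^sup>2" using pp ab bb by (simp add: inner_add_left inner_add_right inner_commute)
  have max': "norm (x - Q x) \<le> s * norm x" if x: "Q\<^sub>0 x = x" for x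
  proof (cases "x = 0")
    case False
    then have "x /\<^sub>R norm x \<in> N" using x by (simp add: N_def Q0.scaleR)
    from max[OF this] have "norm ((x - Q x) /\<^sub>R norm x) \<le> s" by (simp add: Q.scaleR s_def b_def scaleR_diff_right)
    then show ?thesis using False by (simp add: divide_simps mult.commute)
  qed (simp add: Q.zero)
  \<comment> \<open>First-order condition at the maximizer \<open>p\<close>: moving it inside the
    range of \<open>Q\<^sub>0\<close> must not increase the distance to the range of
    \<open>Q\<close> relative to the norm. It forces \<open>Q\<^sub>0 b\<close> to be a multiple of
    \<open>p\<close>, so the plane of \<open>p\<close> and \<open>b\<close> is invariant under both
    projections.\<close>
  have orth: "w \<bullet> b = 0" if w: "Q\<^sub>0 w = w" "w \<bullet> p = 0" for w
  proof (rule quadratic_bound_zero)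
    fix t
    define v where "v = p + t *\<^sub>R w"
    have "Q\<^sub>0 v = v" using p w by (simp add: v_def Q0.add Q0.scaleR)
    from max'[OF this] have "(norm (v - Q v))\<^sup>2 \<le> s\<^sup>2 * (norm v)\<^sup>2"
      by (metis norm_ge_zero power_mono power_mult_distrib)
    moreover have "v - Q v = b + t *\<^sub>R (w - Q w)" by (simp add: v_def b_def Q.add Q.scaleR algebra_simps)
    then have "(norm (v - Q v))\<^sup>2 = b \<bullet> b + 2 * t * ((w - Q w) \<bullet> b) + t\<^sup>2 * ((w - Q w) \<bullet> (w - Q w))"
      unfolding power2_norm_eq_inner
      by (simp only:) (simp add: inner_add_left inner_add_right inner_commute[of b "w - Q w"] power2_eq_square distrib_left)
    moreover have "(w - Q w) \<bullet> b = w \<bullet> b" using Q(2)[of w b] Qb by (simp add: inner_diff_left)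
    moreover have "(norm v)\<^sup>2 = 1 + t\<^sup>2 * (w \<bullet> w)"
      unfolding power2_norm_eq_inner using w(2) pp
      by (simp add: v_def inner_add_left inner_add_right inner_commute[of p w] power2_eq_square)
    ultimately show "2 * t * (w \<bullet> b) \<le> t\<^sup>2 * (s\<^sup>2 * (w \<bullet> w) - (w - Q w) \<bullet> (w - Q w))"
      using bb by (simp add: right_diff_distrib distrib_left mult.left_commute)
  qed
  have Q0b: "Q\<^sub>0 b = s\<^sup>2 *\<^sub>R p"
  proof -
    define w where "w = Q\<^sub>0 b - s\<^sup>2 *\<^sub>R p"
    have Q0w: "Q\<^sub>0 w = w" using p by (simp add: w_def Q0.diff Q0.scaleR Q0(1))
    have "Q\<^sub>0 b \<bullet> p = s\<^sup>2" using Q0(2)[of b p] p pb by (metis inner_commute)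
    then have wp: "w \<bullet> p = 0" using pp by (simp add: w_def inner_diff_left)
    have "w \<bullet> w = Q\<^sub>0 w \<bullet> b - s\<^sup>2 * (w \<bullet> p)" unfolding Q0(2) by (simp add: w_def inner_diff_right)
    then have "w \<bullet> w = 0" using orth[OF Q0w wp] wp Q0w by simp
    then show ?thesis by (simp add: w_def)
  qed
  define c where "c = 1 - s\<^sup>2"
  have c0: "0 \<le> c" using aa inner_ge_zero[of a] by (simp add: c_def)
  \<comment> \<open>Equal to \<open>b - Q\<^sub>0 b\<close>, hence in the kernel of
    \<open>Q\<^sub>0\<close>; written in \<open>a\<close> and \<open>b\<close> so that
    \<open>T\<close>, which has no cross terms between \<open>a\<close> and \<open>b\<close>, can be
    evaluated on it. With \<open>s\<close> the sine of the angle, \<open>c\<close> is the squared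
    cosine.\<close>
  define q where "q = c *\<^sub>R b - s\<^sup>2 *\<^sub>R a"
  have Q0a: "Q\<^sub>0 a = c *\<^sub>R p"
  proof -
    have "a = p - b" using ab by simp
    then show ?thesis using p Q0b by (simp add: Q0.diff c_def scaleR_diff_left)
  qed
  have Q0q: "Q\<^sub>0 q = 0" by (simp add: q_def Q0.diff Q0.scaleR Q0a Q0b)
  have qT0p: "q \<bullet> T\<^sub>0 p = 0" using Q0(2)[of q "T\<^sub>0 p"] Q0(3)[of p] p Q0q by simp
  have T0ab: "a = c *\<^sub>R p - q" "b = s\<^sup>2 *\<^sub>R p + q"
    unfolding q_def c_def ab(2) by (simp_all add: algebra_simps)
  define X Y where "X = p \<bullet> T\<^sub>0 p" and "Y = q \<bullet> T\<^sub>0 q"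
  have pT0q: "p \<bullet> T\<^sub>0 q = 0" using qT0p T0[of p q] by (simp add: inner_commute)
  have aT0a: "a \<bullet> T\<^sub>0 a = c\<^sup>2 * X + Y" and bT0b: "b \<bullet> T\<^sub>0 b = (s\<^sup>2)\<^sup>2 * X + Y"
    by (simp_all only: T0ab) (simp_all add: T0.add T0.diff T0.scaleR inner_add_left inner_add_right inner_diff_left inner_diff_right
      qT0p pT0q X_def Y_def power2_eq_square)
  have X: "X < 0" unfolding X_def using p by (intro low0) auto
  have a_low: "a \<bullet> T\<^sub>0 a \<le> - (\<mu> - h) * (norm a)\<^sup>2"
    using low[OF Qa] pert[of a a] by (simp add: inner_diff_right power2_eq_square algebra_simps)
  have b_high: "(\<mu> - h) * (norm b)\<^sup>2 \<le> b \<bullet> T\<^sub>0 b"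
    using high[OF Qb] pert[of b b] by (simp add: inner_diff_right power2_eq_square algebra_simps)
  \<comment> \<open>This places the angle below one eighth of a full turn. The forms of
    \<open>T\<^sub>0\<close> at \<open>a\<close> and \<open>b\<close> differ only in the weights
    \<open>c\<^sup>2\<close> and \<open>(s\<^sup>2)\<^sup>2\<close> of the negative number
    \<open>X\<close>, and the form at \<open>a\<close> must not exceed zero while the form at
    \<open>b\<close> is positive.\<close>
  have "(s\<^sup>2)\<^sup>2 < c\<^sup>2 \<or> s = 0"
  proof (rule ccontr)
    assume n: "\<not> ?thesis"
    then have "c\<^sup>2 * X \<ge> (s\<^sup>2)\<^sup>2 * X" using X by (simp add: mult_right_mono_neg)
    then have "b \<bullet> T\<^sub>0 b \<le> a \<bullet> T\<^sub>0 a" by (simp add: aT0a bT0b)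
    moreover have "0 < (\<mu> - h) * (norm b)\<^sup>2" using n h by (simp add: s_def)
    moreover have "0 \<le> (\<mu> - h) * (norm a)\<^sup>2" using h by simp
    ultimately show False using a_low b_high by simp
  qed
  then have sc: "s\<^sup>2 \<le> c"
  proof
    assume "(s\<^sup>2)\<^sup>2 < c\<^sup>2"
    then show ?thesis using c0 power_less_imp_less_base by fastforce
  qed (simp add: c0)
  have aTb: "a \<bullet> T b = 0" "b \<bullet> T a = 0"
    using Q(2)[of a "T b"] Q(2)[of b "T a"] Qa Qb Q(3)[of b] Q(3)[of a] by (simp_all add: T.zero)
  \<comment> \<open>Two values of \<open>q \<bullet> T p\<close>: the spectral gap of
    \<open>T\<close> bounds it below, and since \<open>q \<bullet> T\<^sub>0 p\<close> vanishes, the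
    perturbation bounds it above by \<open>h * norm q\<close>. With
    \<open>norm q = s * sqrt c\<close> this is the bound on the sine of the double angle;
    \<open>c \<ge> 1 / 2\<close> then gives the factor \<open>sqrt 2\<close>.\<close>
  have "2 * \<mu> * (s\<^sup>2 * c) \<le> q \<bullet> T p"
  proof -
    have "s\<^sup>2 * (a \<bullet> T a) \<le> s\<^sup>2 * (- \<mu> * c)"
      using low[OF Qa] aa by (intro mult_left_mono) (auto simp: c_def power2_norm_eq_inner)
    moreover have "c * (\<mu> * s\<^sup>2) \<le> c * (b \<bullet> T b)"
      using high[OF Qb] bb c0 by (intro mult_left_mono) (auto simp: power2_norm_eq_inner)
    ultimately show ?thesis
      using aTb by (simp add: q_def ab(2) T.add inner_add_right inner_diff_left algebra_simps)
  qed
  also have "q \<bullet> T p \<le> h * norm q * norm p" using pert[of q p] qT0p by (simp add: inner_diff_right)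
  also have "norm q = s * sqrt c"
  proof -
    have "q \<bullet> q = c\<^sup>2 * s\<^sup>2 + (s\<^sup>2)\<^sup>2 * c"
      using aa bb ab(1) by (simp add: q_def c_def inner_diff_left inner_diff_right inner_commute power2_eq_square)
    also have "\<dots> = s\<^sup>2 * c * (c + s\<^sup>2)" by (simp add: power2_eq_square algebra_simps)
    also have "\<dots> = (s * sqrt c)\<^sup>2" using c0 by (simp add: c_def power_mult_distrib)
    finally show ?thesis using c0 by (simp add: norm_eq_sqrt_inner s_def)
  qed
  finally have "2 * \<mu> * (s\<^sup>2 * c) \<le> h * (s * sqrt c)" using p by simp
  note le = this
  have main: "t * (2 * \<mu> * t) \<le> t * h" if "t = s * sqrt c" for t
  proof -
    have "s\<^sup>2 * c = t\<^sup>2" using c0 that by (simp add: power_mult_distrib)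
    then have "2 * \<mu> * t\<^sup>2 \<le> h * t" using le that by simp
    then show ?thesis by (simp add: power2_eq_square mult_ac)
  qed
  have "s * (sqrt 2 * \<mu>) \<le> h"
  proof (cases "s = 0")
    case False
    have cpos: "1 / 2 \<le> c" using sc by (simp add: c_def)
    have s: "0 < s" using False by (simp add: s_def)
    have "0 < s * sqrt c" using s cpos by simp
    then have le: "2 * \<mu> * (s * sqrt c) \<le> h" using main[OF refl] mult_le_cancel_left_pos by blast
    have "sqrt (1 / 2) \<le> sqrt c" using cpos real_sqrt_le_mono by blast
    then have "2 * \<mu> * (s * sqrt (1 / 2)) \<le> 2 * \<mu> * (s * sqrt c)" using h s by (intro mult_left_mono) auto
    moreover have "2 * sqrt (1 / 2) = sqrt 2" by (simp add: real_sqrt_divide real_div_sqrt)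
    then have "2 * \<mu> * (s * sqrt (1 / 2)) = s * (sqrt 2 * \<mu>)" by (metis mult.assoc mult.commute)
    ultimately show ?thesis using le by linarith
  qed (use h in simp)
  then have "s \<le> h / (sqrt 2 * \<mu>)" using h by (simp add: pos_le_divide_eq)
  then show ?thesis using max'[OF u] by (meson mult_right_mono norm_ge_zero order_trans)
qed

section \<open>Taylor expansions\<close>

lemma dderiv_append: "dderiv (dderiv f hs) hs' = dderiv f (hs' @ hs)"
  by (induction hs') auto

lemma C_smooth_dderiv: "C_smooth m f \<Longrightarrow> length hs + n \<le> m \<Longrightarrow> C_smooth n (dderiv f hs)"
  unfolding C_smooth_def dderiv_append by auto

lemma dderiv_continuous: "C_smooth m f \<Longrightarrow> length hs \<le> m \<Longrightarrow> continuous_on UNIV (dderiv f hs)"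
  by (auto simp: C_smooth_def)

lemma dderiv_has_derivative:
  "C_smooth m f \<Longrightarrow> length hs < m \<Longrightarrow> (dderiv f hs has_derivative (\<lambda>h. dderiv f (h # hs) x)) (at x)"
  by (simp add: C_smooth_def frechet_derivative_works)

text \<open>The foremost slot is linear as a Frechet derivative. Linearity in a later slot is
  inherited: the lower tensor is linear in it at every point, and derivatives of sums and multiples
  are unique.\<close>

lemma dderiv_slot_linear:
  assumes "C_smooth m f" "length pre + length hs < m"
  shows "linear (\<lambda>h. dderiv f (pre @ h # hs) x)"
proof -
  have "linear (\<lambda>h. dderiv f (pre @ h # hs) x)" for x
    using assms(2)
  proof (induction pre arbitrary: x)
    case Nil
    then show ?case using has_derivative_linear[OF dderiv_has_derivative[OF assms(1), of hs x]] by simp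
  next
    case (Cons p pre)
    have lin: "linear (\<lambda>h. dderiv f (pre @ h # hs) x)" for x using Cons by simp
    have der: "(dderiv f (pre @ h # hs) has_derivative (\<lambda>p. dderiv f (p # pre @ h # hs) x)) (at x)" for h
      using Cons.prems by (intro dderiv_has_derivative[OF assms(1)]) simp
    show ?case
    proof (rule linearI)
      fix h k
      have eq: "dderiv f (pre @ (h + k) # hs) = (\<lambda>x. dderiv f (pre @ h # hs) x + dderiv f (pre @ k # hs) x)"
        using linear_add[OF lin] by auto
      show "dderiv f ((p # pre) @ (h + k) # hs) x = dderiv f ((p # pre) @ h # hs) x + dderiv f ((p # pre) @ k # hs) x"
        using has_derivative_unique[OF der[of "h + k"] has_derivative_add[OF der[of h] der[of k], folded eq]]
        by (auto dest: fun_cong)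
    next
      fix c h
      have eq: "dderiv f (pre @ (c *\<^sub>R h) # hs) = (\<lambda>x. c *\<^sub>R dderiv f (pre @ h # hs) x)"
        using linear_scale[OF lin] by auto
      show "dderiv f ((p # pre) @ (c *\<^sub>R h) # hs) x = c *\<^sub>R dderiv f ((p # pre) @ h # hs) x"
        using has_derivative_unique[OF der[of "c *\<^sub>R h"] has_derivative_scaleR_right[OF der[of h], of c, folded eq]]
        by (auto dest: fun_cong)
    qed
  qed
  then show ?thesis .
qed

lemma dderiv_line:
  assumes "C_smooth m f" "length hs < m"
  shows "((\<lambda>t. dderiv f hs (x + t *\<^sub>R h)) has_real_derivative dderiv f (h # hs) (x + t *\<^sub>R h)) (at t)"
proof -
  have "((\<lambda>t. x + t *\<^sub>R h) has_derivative (\<lambda>s. s *\<^sub>R h)) (at t)"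
    by (auto intro!: derivative_eq_intros)
  from has_derivative_compose[OF this dderiv_has_derivative[OF assms]]
  have "((\<lambda>t. dderiv f hs (x + t *\<^sub>R h)) has_derivative (\<lambda>s. dderiv f ((s *\<^sub>R h) # hs) (x + t *\<^sub>R h))) (at t)" .
  moreover have "dderiv f ((s *\<^sub>R h) # hs) y = dderiv f (h # hs) y * s" for s y
    using linear_scale[OF dderiv_slot_linear[OF assms(1), of "[]" hs]] assms(2) by simp
  ultimately show ?thesis by (simp add: has_field_derivative_def)
qed

declare dderiv.simps(2) [simp del]

lemma dderiv_second_difference:
  assumes "C_smooth m f" "length hs + 2 \<le> m" "0 < t"
  shows "\<exists>\<xi> \<eta>. 0 < \<xi> \<and> \<xi> < t \<and> 0 < \<eta> \<and> \<eta> < t \<and>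
    dderiv f hs (x + t *\<^sub>R a + t *\<^sub>R b) - dderiv f hs (x + t *\<^sub>R a) - dderiv f hs (x + t *\<^sub>R b) + dderiv f hs x
    = t * t * dderiv f (b # a # hs) (x + \<xi> *\<^sub>R a + \<eta> *\<^sub>R b)"
proof -
  define \<phi> where "\<phi> s = dderiv f hs ((x + t *\<^sub>R b) + s *\<^sub>R a) - dderiv f hs (x + s *\<^sub>R a)" for s
  have d: "(\<phi> has_real_derivative dderiv f (a # hs) ((x + t *\<^sub>R b) + s *\<^sub>R a) - dderiv f (a # hs) (x + s *\<^sub>R a)) (at s)" for s
    unfolding \<phi>_def using assms(2) by (intro DERIV_diff dderiv_line[OF assms(1)]) auto
  obtain \<xi> where \<xi>: "0 < \<xi>" "\<xi> < t"
    "\<phi> t - \<phi> 0 = (t - 0) * (dderiv f (a # hs) ((x + t *\<^sub>R b) + \<xi> *\<^sub>R a) - dderiv f (a # hs) (x + \<xi> *\<^sub>R a))"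
    using MVT2[OF assms(3), of \<phi> "\<lambda>s. dderiv f (a # hs) ((x + t *\<^sub>R b) + s *\<^sub>R a) - dderiv f (a # hs) (x + s *\<^sub>R a)"] d by blast
  have "((\<lambda>r. dderiv f (a # hs) ((x + \<xi> *\<^sub>R a) + r *\<^sub>R b)) has_real_derivative dderiv f (b # a # hs) ((x + \<xi> *\<^sub>R a) + r *\<^sub>R b)) (at r)" for r
    using assms(2) by (intro dderiv_line[OF assms(1)]) auto
  then obtain \<eta> where \<eta>: "0 < \<eta>" "\<eta> < t"
    "dderiv f (a # hs) ((x + \<xi> *\<^sub>R a) + t *\<^sub>R b) - dderiv f (a # hs) ((x + \<xi> *\<^sub>R a) + 0 *\<^sub>R b)
      = (t - 0) * dderiv f (b # a # hs) ((x + \<xi> *\<^sub>R a) + \<eta> *\<^sub>R b)"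
    using MVT2[OF assms(3), of "\<lambda>r. dderiv f (a # hs) ((x + \<xi> *\<^sub>R a) + r *\<^sub>R b)"
        "\<lambda>r. dderiv f (b # a # hs) ((x + \<xi> *\<^sub>R a) + r *\<^sub>R b)"] by blast
  have "\<phi> t - \<phi> 0 = t * (t * dderiv f (b # a # hs) ((x + \<xi> *\<^sub>R a) + \<eta> *\<^sub>R b))"
    using \<xi>(3) \<eta>(3) by (simp add: add_ac)
  then have "dderiv f hs (x + t *\<^sub>R a + t *\<^sub>R b) - dderiv f hs (x + t *\<^sub>R a) - dderiv f hs (x + t *\<^sub>R b) + dderiv f hs x
    = t * t * dderiv f (b # a # hs) (x + \<xi> *\<^sub>R a + \<eta> *\<^sub>R b)" by (simp add: \<phi>_def add_ac)
  then show ?thesis using \<xi>(1,2) \<eta>(1,2) by blast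
qed

text \<open>The second difference is symmetric in \<open>a\<close> and \<open>b\<close>. By two
  applications of the mean value theorem it is a mixed derivative at a nearby point, in either
  order, and continuity identifies the limits.\<close>

lemma dderiv_symmetric:
  assumes "C_smooth m f" "length hs + 2 \<le> m"
  shows "dderiv f (a # b # hs) x = dderiv f (b # a # hs) x"
proof -
  have lim: "\<exists>X. (\<lambda>n. dderiv f (b # a # hs) (X n)) \<longlonglongrightarrow> dderiv f (b # a # hs) x \<and>
      (\<forall>n. dderiv f (b # a # hs) (X n) = (dderiv f hs (x + inverse (real (Suc n)) *\<^sub>R a + inverse (real (Suc n)) *\<^sub>R b)
       - dderiv f hs (x + inverse (real (Suc n)) *\<^sub>R a) - dderiv f hs (x + inverse (real (Suc n)) *\<^sub>R b) + dderiv f hs x)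
       * (real (Suc n))\<^sup>2)" for a b
  proof -
    define t where "t n = inverse (real (Suc n))" for n
    have t: "0 < t n" for n by (simp add: t_def)
    have t0: "t \<longlonglongrightarrow> 0" unfolding t_def by (rule LIMSEQ_inverse_real_of_nat)
    have "\<forall>n. \<exists>\<xi> \<eta>. 0 < \<xi> \<and> \<xi> < t n \<and> 0 < \<eta> \<and> \<eta> < t n \<and>
      dderiv f hs (x + t n *\<^sub>R a + t n *\<^sub>R b) - dderiv f hs (x + t n *\<^sub>R a) - dderiv f hs (x + t n *\<^sub>R b) + dderiv f hs x
      = t n * t n * dderiv f (b # a # hs) (x + \<xi> *\<^sub>R a + \<eta> *\<^sub>R b)"
      using dderiv_second_difference[OF assms t] by blast
    then obtain \<xi> \<eta> where
      b: "\<And>n. 0 < \<xi> n" "\<And>n. \<xi> n < t n" "\<And>n. 0 < \<eta> n" "\<And>n. \<eta> n < t n" and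
      eq: "\<And>n. dderiv f hs (x + t n *\<^sub>R a + t n *\<^sub>R b) - dderiv f hs (x + t n *\<^sub>R a) - dderiv f hs (x + t n *\<^sub>R b) + dderiv f hs x
        = t n * t n * dderiv f (b # a # hs) (x + \<xi> n *\<^sub>R a + \<eta> n *\<^sub>R b)"
      by metis
    have "\<xi> \<longlonglongrightarrow> 0"
      by (rule tendsto_sandwich[OF _ _ tendsto_const t0]) (simp_all add: b less_imp_le)
    moreover have "\<eta> \<longlonglongrightarrow> 0"
      by (rule tendsto_sandwich[OF _ _ tendsto_const t0]) (simp_all add: b less_imp_le)
    ultimately have "(\<lambda>n. x + \<xi> n *\<^sub>R a + \<eta> n *\<^sub>R b) \<longlonglongrightarrow> x + 0 *\<^sub>R a + 0 *\<^sub>R b" by (intro tendsto_intros)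
    from continuous_on_tendsto_compose[OF dderiv_continuous[OF assms(1), of "b # a # hs"] this]
    have "(\<lambda>n. dderiv f (b # a # hs) (x + \<xi> n *\<^sub>R a + \<eta> n *\<^sub>R b)) \<longlonglongrightarrow> dderiv f (b # a # hs) x"
      using assms(2) by simp
    moreover have "dderiv f (b # a # hs) (x + \<xi> n *\<^sub>R a + \<eta> n *\<^sub>R b) =
        (dderiv f hs (x + t n *\<^sub>R a + t n *\<^sub>R b) - dderiv f hs (x + t n *\<^sub>R a) - dderiv f hs (x + t n *\<^sub>R b) + dderiv f hs x) * (real (Suc n))\<^sup>2" for n
    proof -
      have "E = D * N\<^sup>2" if "r * N = 1" "D = r * r * E" for r N D E :: real
      proof -
        have "D * N\<^sup>2 = E * (r * N)\<^sup>2" by (simp add: that(2) power2_eq_square)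
        then show ?thesis by (simp add: that(1))
      qed
      from this[OF _ eq] show ?thesis by (simp add: t_def)
    qed
    ultimately show ?thesis unfolding t_def
      by (intro exI[of _ "\<lambda>n. x + \<xi> n *\<^sub>R a + \<eta> n *\<^sub>R b"] conjI allI)
  qed
  obtain X where X: "(\<lambda>n. dderiv f (b # a # hs) (X n)) \<longlonglongrightarrow> dderiv f (b # a # hs) x"
      "\<And>n. dderiv f (b # a # hs) (X n) = (dderiv f hs (x + inverse (real (Suc n)) *\<^sub>R a + inverse (real (Suc n)) *\<^sub>R b)
       - dderiv f hs (x + inverse (real (Suc n)) *\<^sub>R a) - dderiv f hs (x + inverse (real (Suc n)) *\<^sub>R b) + dderiv f hs x)
       * (real (Suc n))\<^sup>2" using lim[of b a] by blast
  obtain Y where Y: "(\<lambda>n. dderiv f (a # b # hs) (Y n)) \<longlonglongrightarrow> dderiv f (a # b # hs) x"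
      "\<And>n. dderiv f (a # b # hs) (Y n) = (dderiv f hs (x + inverse (real (Suc n)) *\<^sub>R b + inverse (real (Suc n)) *\<^sub>R a)
       - dderiv f hs (x + inverse (real (Suc n)) *\<^sub>R b) - dderiv f hs (x + inverse (real (Suc n)) *\<^sub>R a) + dderiv f hs x)
       * (real (Suc n))\<^sup>2" using lim[of a b] by blast
  have "dderiv f (a # b # hs) (Y n) = dderiv f (b # a # hs) (X n)" for n
    unfolding X(2) Y(2) by (simp add: algebra_simps)
  then show ?thesis using LIMSEQ_unique[OF X(1)] Y(1) by simp
qed

text \<open>Ensures that the supremum in \<open>dnorm\<close> is taken over a bounded set and
  therefore is an upper bound.\<close>

lemma dderiv_bounded_units:
  fixes f :: "'a::euclidean_space \<Rightarrow> real"
  assumes "C_smooth m f" "length pre + n \<le> m"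
  shows "\<exists>B. \<forall>hs. length hs = n \<and> (\<forall>h\<in>set hs. norm h = 1) \<longrightarrow> \<bar>dderiv f (pre @ hs) x\<bar> \<le> B"
  using assms(2)
proof (induction n arbitrary: pre)
  case 0
  then show ?case by auto
next
  case (Suc n)
  have "\<exists>B. \<forall>hs. length hs = n \<and> (\<forall>h\<in>set hs. norm h = 1) \<longrightarrow> \<bar>dderiv f ((pre @ [b]) @ hs) x\<bar> \<le> B" for b
    using Suc.prems by (intro Suc.IH) simp
  then obtain B where B: "\<And>b hs. length hs = n \<Longrightarrow> (\<forall>h\<in>set hs. norm h = 1) \<Longrightarrow> \<bar>dderiv f (pre @ b # hs) x\<bar> \<le> B b"
    unfolding append.assoc append_Cons append_Nil by metis
  show ?case
  proof (intro exI[of _ "\<Sum>b\<in>Basis. B b"] allI impI)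
    fix hs :: "'a list" assume hs: "length hs = Suc n \<and> (\<forall>h\<in>set hs. norm h = 1)"
    then obtain h hs' where h: "hs = h # hs'" "length hs' = n" "\<forall>h\<in>set hs'. norm h = 1" "norm h = 1"
      by (cases hs) auto
    have lin: "linear (\<lambda>h. dderiv f (pre @ h # hs') x)"
      using Suc.prems h by (intro dderiv_slot_linear[OF assms(1)]) simp
    have "dderiv f (pre @ h # hs') x = dderiv f (pre @ (\<Sum>b\<in>Basis. (h \<bullet> b) *\<^sub>R b) # hs') x"
      by (simp add: euclidean_representation)
    also have "\<dots> = (\<Sum>b\<in>Basis. (h \<bullet> b) * dderiv f (pre @ b # hs') x)"
      using linear_sum[OF lin, of "\<lambda>b. (h \<bullet> b) *\<^sub>R b" Basis] linear_scale[OF lin] by simp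
    finally have "\<bar>dderiv f (pre @ h # hs') x\<bar> \<le> (\<Sum>b\<in>Basis. \<bar>(h \<bullet> b) * dderiv f (pre @ b # hs') x\<bar>)"
      by (simp add: sum_abs)
    also have "\<dots> \<le> (\<Sum>b\<in>Basis. 1 * B b)"
      unfolding abs_mult
      by (intro sum_mono mult_mono B) (use h Basis_le_norm[of _ h] in auto)
    finally show "\<bar>dderiv f (pre @ hs) x\<bar> \<le> (\<Sum>b\<in>Basis. B b)" by (simp add: h)
  qed
qed

lemma dderiv_le_dnorm:
  fixes f :: "'a::euclidean_space \<Rightarrow> real"
  assumes f: "C_smooth m f" "length hs \<le> m"
  shows "\<bar>dderiv f hs x\<bar> \<le> dnorm (length hs) f x * (\<Prod>h\<leftarrow>hs. norm h)"
proof -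
  have scale: "dderiv f (pre @ hs) x = (\<Prod>h\<leftarrow>hs. norm h) * dderiv f (pre @ map sgn hs) x"
    if "length pre + length hs \<le> m" for pre hs
    using that
  proof (induction hs arbitrary: pre)
    case (Cons h hs)
    have "linear (\<lambda>h. dderiv f (pre @ h # hs) x)"
      using Cons.prems by (intro dderiv_slot_linear[OF f(1)]) simp
    from linear_scale[OF this, of "norm h" "sgn h"]
    have "dderiv f (pre @ (norm h *\<^sub>R sgn h) # hs) x = norm h * dderiv f ((pre @ [sgn h]) @ hs) x" by simp
    moreover have "norm h *\<^sub>R sgn h = h" by (cases "h = 0") (auto simp: sgn_div_norm)
    ultimately have "dderiv f (pre @ h # hs) x = norm h * dderiv f ((pre @ [sgn h]) @ hs) x" by simp
    then show ?case using Cons.IH[of "pre @ [sgn h]"] Cons.prems by simp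
  qed simp
  show ?thesis
  proof (cases "0 \<in> set hs")
    case True
    then have "(\<Prod>h\<leftarrow>hs. norm h) = 0" by (auto simp: prod_list_zero_iff image_iff)
    then show ?thesis using scale[of "[]" hs] f(2) by simp
  next
    case False
    let ?U = "{us. length us = length hs \<and> (\<forall>h\<in>set us. norm h = 1)}"
    have "\<bar>dderiv f (map sgn hs) x\<bar> \<le> dnorm (length hs) f x"
      unfolding dnorm_def
    proof (rule cSUP_upper)
      show "map sgn hs \<in> ?U" using False by (auto simp: norm_sgn)
      show "bdd_above ((\<lambda>us. \<bar>dderiv f us x\<bar>) ` ?U)"
        using dderiv_bounded_units[OF f(1), of "[]" "length hs" x] f(2) by (auto simp: bdd_above_def)
    qed
    moreover have "0 \<le> (\<Prod>h\<leftarrow>hs. norm h)" by (induction hs) auto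
    ultimately show ?thesis using scale[of "[]" hs] f(2) by (simp add: abs_mult mult.commute mult_left_mono)
  qed
qed

lemma dderiv_taylor:
  assumes "C_smooth m f" "n \<le> m" "0 < n"
  shows "\<exists>t. \<bar>t\<bar> \<le> 1 \<and> f (x + h) = (\<Sum>i<n. dderiv f (replicate i h) x / fact i) + dderiv f (replicate n h) (x + t *\<^sub>R h) / fact n"
proof -
  have "\<exists>t. \<bar>t\<bar> \<le> \<bar>1\<bar> \<and> f (x + 1 *\<^sub>R h) = (\<Sum>i<n. dderiv f (replicate i h) (x + 0 *\<^sub>R h) / fact i * 1 ^ i)
      + dderiv f (replicate n h) (x + t *\<^sub>R h) / fact n * 1 ^ n"
    by (rule Maclaurin_bi_le[where diff = "\<lambda>i t. dderiv f (replicate i h) (x + t *\<^sub>R h)"])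
      (use dderiv_line[OF assms(1), of "replicate _ h" x h] assms(2) in auto)
  then show ?thesis by simp
qed

lemma taylor_remainder2:
  assumes "C_smooth 2 g" "\<And>y. \<bar>dderiv g [h, h] y\<bar> \<le> B"
  shows "\<bar>g (x + h) - g x - dderiv g [h] x\<bar> \<le> B / 2"
proof -
  obtain t where "g (x + h) = (\<Sum>i<2. dderiv g (replicate i h) x / fact i) + dderiv g (replicate 2 h) (x + t *\<^sub>R h) / fact 2"
    using dderiv_taylor[OF assms(1), of 2 x h] by auto
  then show ?thesis using assms(2)[of "x + t *\<^sub>R h"] by (simp add: numeral_2_eq_2)
qed

lemma second_difference_bound:
  assumes "C_smooth 2 g" "\<And>y. \<bar>dderiv g [h, h] y\<bar> \<le> B"
  shows "\<bar>g (x + h) + g (x - h) - 2 * g x\<bar> \<le> B"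
proof -
  have lin: "linear (\<lambda>h. dderiv g [h] x)" using dderiv_slot_linear[OF assms(1), of "[]" "[]"] by simp
  have lin1: "linear (\<lambda>k. dderiv g [k, h] y)" for h y using dderiv_slot_linear[OF assms(1), of "[]" "[h]"] by simp
  have lin2: "linear (\<lambda>k. dderiv g [h, k] y)" for h y using dderiv_slot_linear[OF assms(1), of "[h]" "[]"] by simp
  have "dderiv g [- h, - h] y = dderiv g [h, h] y" for y
    using linear_neg[OF lin1[of "- h" y], of h] linear_neg[OF lin2[of h y], of h] by simp
  then have "\<bar>g (x + - h) - g x - dderiv g [- h] x\<bar> \<le> B / 2"
    using assms by (intro taylor_remainder2) simp_all
  moreover have "\<bar>g (x + h) - g x - dderiv g [h] x\<bar> \<le> B / 2" by (rule taylor_remainder2[OF assms])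
  moreover have "dderiv g [- h] x = - dderiv g [h] x" "g (x + - h) = g (x - h)"
    using linear_neg[OF lin, of h] by simp_all
  ultimately show ?thesis by linarith
qed

text \<open>The odd terms cancel between \<open>h\<close> and \<open>- h\<close>, so the remainder
  is of fourth order: two terms of size \<open>B / 24\<close>.\<close>

lemma even_taylor4:
  assumes f: "C_smooth 4 f" and B: "\<And>y. \<bar>dderiv f [h, h, h, h] y\<bar> \<le> B"
  shows "\<bar>f (x + h) + f (x - h) - 2 * f x - dderiv f [h, h] x\<bar> \<le> B / 12"
proof -
  have neg: "dderiv f (pre @ (- k) # hs) y = - dderiv f (pre @ k # hs) y" if "length pre + length hs < 4" for pre hs k y
    by (rule linear_neg[OF dderiv_slot_linear[OF f that]])
  have n1: "dderiv f [- h] y = - dderiv f [h] y" for y using neg[of "[]" "[]"] by simp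
  have n2: "dderiv f [- h, - h] y = dderiv f [h, h] y" for y
    using neg[of "[]" "[- h]"] neg[of "[h]" "[]"] by simp
  have n3: "dderiv f [- h, - h, - h] y = - dderiv f [h, h, h] y" for y
    using neg[of "[]" "[- h, - h]"] neg[of "[h]" "[- h]"] neg[of "[h, h]" "[]"] by simp
  have n4: "dderiv f [- h, - h, - h, - h] y = dderiv f [h, h, h, h] y" for y
    using neg[of "[]" "[- h, - h, - h]"] neg[of "[h]" "[- h, - h]"] neg[of "[h, h]" "[- h]"] neg[of "[h, h, h]" "[]"] by simp
  obtain t where t: "f (x + h) = (\<Sum>i<4. dderiv f (replicate i h) x / fact i) + dderiv f (replicate 4 h) (x + t *\<^sub>R h) / fact 4"
    using dderiv_taylor[OF f, of 4 x h] by auto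
  obtain s where s: "f (x + - h) = (\<Sum>i<4. dderiv f (replicate i (- h)) x / fact i) + dderiv f (replicate 4 (- h)) (x + s *\<^sub>R - h) / fact 4"
    using dderiv_taylor[OF f, of 4 x "- h"] by auto
  have 4: "(4::nat) = Suc (Suc (Suc (Suc 0)))" by simp
  have "f (x + h) + f (x - h) - 2 * f x - dderiv f [h, h] x
    = (dderiv f [h, h, h, h] (x + t *\<^sub>R h) + dderiv f [h, h, h, h] (x + s *\<^sub>R - h)) / 24"
    using t s by (simp add: 4 n1 n2 n3 n4 fact_numeral)
  moreover have "\<bar>(P + Q) / 24\<bar> \<le> B / 12" if "\<bar>P\<bar> \<le> B" "\<bar>Q\<bar> \<le> B" for P Q
    using that by (simp add: abs_le_iff)
  ultimately show ?thesis using B by metis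
qed

lemma hess_form:
  fixes f :: "real^'n::finite \<Rightarrow> real"
  assumes "C_smooth m f" "2 \<le> m"
  shows "v \<bullet> (hess f x *v w) = dderiv f [v, w] x"
proof -
  have lin1: "linear (\<lambda>k. dderiv f [k, h] x)" for h using dderiv_slot_linear[OF assms(1), of "[]" "[h]"] assms(2) by simp
  have lin2: "linear (\<lambda>k. dderiv f [h, k] x)" for h using dderiv_slot_linear[OF assms(1), of "[h]" "[]"] assms(2) by simp
  have "dderiv f [v, w] x = dderiv f [\<Sum>i\<in>UNIV. (v $ i) *\<^sub>R axis i 1, w] x"
    using basis_expansion[of v] by (simp add: scalar_mult_eq_scaleR)
  also have "\<dots> = (\<Sum>i\<in>UNIV. v $ i * dderiv f [axis i 1, w] x)"
    by (simp add: linear_sum[OF lin1] linear_scale[OF lin1])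
  also have "\<dots> = (\<Sum>i\<in>UNIV. v $ i * dderiv f [axis i 1, \<Sum>j\<in>UNIV. (w $ j) *\<^sub>R axis j 1] x)"
    using basis_expansion[of w] by (simp add: scalar_mult_eq_scaleR)
  also have "\<dots> = (\<Sum>i\<in>UNIV. v $ i * (\<Sum>j\<in>UNIV. w $ j * dderiv f [axis i 1, axis j 1] x))"
    by (simp add: linear_sum[OF lin2] linear_scale[OF lin2])
  finally show ?thesis by (simp add: inner_vec_def matrix_vector_mult_def hess_def mult.commute)
qed

section \<open>Densities on finite products\<close>

lemma PiM_density:
  fixes M :: "'i \<Rightarrow> 'b measure"
  assumes fin: "finite I" and M: "\<And>i. sigma_finite_measure (M i)"
    and h: "\<And>i. h i \<in> borel_measurable (M i)" and sf: "\<And>i. sigma_finite_measure (density (M i) (h i))"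
  shows "density (PiM I M) (\<lambda>x. \<Prod>i\<in>I. h i (x i)) = PiM I (\<lambda>i. density (M i) (h i))"
proof (rule product_sigma_finite.PiM_eqI)
  interpret P: product_sigma_finite M using M by (simp add: product_sigma_finite_def)
  show "product_sigma_finite (\<lambda>i. density (M i) (h i))" using sf by (simp add: product_sigma_finite_def)
  show "finite I" by fact
  show "sets (density (PiM I M) (\<lambda>x. \<Prod>i\<in>I. h i (x i))) = sets (PiM I (\<lambda>i. density (M i) (h i)))"
    by (simp cong: sets_PiM_cong)
  fix A assume "\<And>i. i \<in> I \<Longrightarrow> A i \<in> sets (density (M i) (h i))"
  then have A: "A i \<in> sets (M i)" if "i \<in> I" for i using that by simp
  have AM: "Pi\<^sub>E I A \<in> sets (PiM I M)" using fin A by (intro sets_PiM_I_finite) auto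
  have hm: "(\<lambda>x. \<Prod>i\<in>I. h i (x i)) \<in> borel_measurable (PiM I M)"
  proof (intro borel_measurable_prod_ennreal)
    fix i assume "i \<in> I"
    from measurable_compose[OF measurable_component_singleton[OF this], of "h i" M, OF h]
    show "(\<lambda>x. h i (x i)) \<in> borel_measurable (PiM I M)" .
  qed
  have "emeasure (density (PiM I M) (\<lambda>x. \<Prod>i\<in>I. h i (x i))) (Pi\<^sub>E I A)
      = (\<integral>\<^sup>+x. (\<Prod>i\<in>I. h i (x i)) * indicator (Pi\<^sub>E I A) x \<partial>PiM I M)"
    by (rule emeasure_density[OF hm AM])
  also have "\<dots> = (\<integral>\<^sup>+x. (\<Prod>i\<in>I. h i (x i) * indicator (A i) (x i)) \<partial>PiM I M)"
    by (intro nn_integral_cong)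
      (auto simp: space_PiM prod.distrib indicator_def fin PiE_def Pi_def prod_zero_iff if_distrib)
  also have "\<dots> = (\<Prod>i\<in>I. \<integral>\<^sup>+x. h i x * indicator (A i) x \<partial>M i)"
    using fin A h by (intro P.product_nn_integral_prod) auto
  also have "\<dots> = (\<Prod>i\<in>I. emeasure (density (M i) (h i)) (A i))"
    using A h by (intro prod.cong refl emeasure_density[symmetric]) auto
  finally show "emeasure (density (PiM I M) (\<lambda>x. \<Prod>i\<in>I. h i (x i))) (Pi\<^sub>E I A) = (\<Prod>i\<in>I. emeasure (density (M i) (h i)) (A i))" .
qed

section \<open>Moments of the standard Gaussian\<close>

abbreviation "std_normal \<equiv> density lborel (\<lambda>x. ennreal (std_normal_density x))"

lemma prob_space_std_normal: "prob_space std_normal"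
  by (rule prob_space_normal_density) simp

lemma sum_basis_vec: "(\<Sum>b\<in>Basis. F b *\<^sub>R b) = ((\<chi> i. F (axis i 1)) :: real^'n::finite)"
proof -
  have "(\<Sum>b\<in>Basis. F b *\<^sub>R b) = (\<Sum>i\<in>UNIV. F (axis i 1) *\<^sub>R (axis i 1 :: real^'n))"
    by (rule sum.reindex_bij_witness[of _ "\<lambda>i. axis i 1" "\<lambda>b. THE i. b = axis i 1"])
      (auto simp: Basis_vec_def axis_eq_axis)
  also have "\<dots> = (\<chi> i. F (axis i 1))"
    using basis_expansion[of "\<chi> i. F (axis i 1)"] by (simp add: scalar_mult_eq_scaleR)
  finally show ?thesis .
qed

lemma prod_basis_vec: "(\<Prod>b\<in>(Basis :: (real^'n::finite) set). F b) = (\<Prod>i\<in>UNIV. F (axis i 1))"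
  by (rule prod.reindex_bij_witness[of _ "\<lambda>i. axis i 1" "\<lambda>b. THE i. b = axis i 1"])
    (auto simp: Basis_vec_def axis_eq_axis)

lemma sets_std_gaussian [simp, measurable_cong]: "sets std_gaussian = sets borel"
  by (simp add: std_gaussian_def)

lemma space_std_gaussian [simp]: "space std_gaussian = UNIV"
  by (simp add: std_gaussian_def)

text \<open>Exhibits the coordinates as independent standard normal variables, from which the law of
  every linear functional follows.\<close>

lemma std_gaussian_eq_PiM:
  "(std_gaussian :: (real^'n::finite) measure) = distr (PiM Basis (\<lambda>_. std_normal)) borel (\<lambda>F. \<Sum>b\<in>Basis. F b *\<^sub>R b)"
proof -
  let ?T = "\<lambda>F. \<Sum>b\<in>(Basis :: (real^'n) set). F b *\<^sub>R b"
  have T: "?T \<in> PiM Basis (\<lambda>_. lborel) \<rightarrow>\<^sub>M borel" by measurable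
  have "std_gaussian = density (distr (PiM Basis (\<lambda>_. lborel)) borel ?T) (\<lambda>z. ennreal (\<Prod>i\<in>UNIV. std_normal_density (z $ i)))"
    unfolding std_gaussian_def by (subst lborel_eq) simp
  also have "\<dots> = distr (density (PiM Basis (\<lambda>_. lborel)) (\<lambda>F. ennreal (\<Prod>i\<in>UNIV. std_normal_density (?T F $ i)))) borel ?T"
    by (rule density_distr[OF _ T]) measurable
  also have "(\<lambda>F. ennreal (\<Prod>i\<in>UNIV. std_normal_density (?T F $ i))) = (\<lambda>F. \<Prod>b\<in>(Basis :: (real^'n) set). ennreal (std_normal_density (F b)))"
    by (simp add: sum_basis_vec prod_basis_vec prod_ennreal)
  also have "density (PiM Basis (\<lambda>_. lborel)) \<dots> = PiM Basis (\<lambda>_. std_normal)"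
    by (intro PiM_density prob_space_imp_sigma_finite prob_space_std_normal sigma_finite_lborel) auto
  finally show ?thesis .
qed

lemma prob_space_std_gaussian: "prob_space (std_gaussian :: (real^'n::finite) measure)"
  unfolding std_gaussian_eq_PiM
  by (intro prob_space.prob_space_distr prob_space_PiM prob_space_std_normal) measurable

lemma std_gaussian_inner_distributed:
  fixes p :: "real^'n::finite"
  assumes "p \<noteq> 0"
  shows "distributed std_gaussian lborel (\<lambda>z. z \<bullet> p) (normal_density 0 (norm p))"
proof -
  let ?N = "PiM (Basis :: (real^'n) set) (\<lambda>_. std_normal)"
  interpret N: prob_space ?N by (intro prob_space_PiM prob_space_std_normal)
  \<comment> \<open>Coordinates with coefficient zero are removed, since the sum rule for
    independent normal variables asks for positive deviations.\<close>
  define I where "I = {b\<in>Basis. p \<bullet> b \<noteq> 0}"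
  have I: "finite I" "I \<noteq> {}" "I \<subseteq> Basis"
    using assms euclidean_all_zero_iff[of p] by (auto simp: I_def)
  have ind: "N.indep_vars (\<lambda>_. borel) (\<lambda>b F. (p \<bullet> b) * F b) I"
  proof -
    have "N.indep_vars (\<lambda>_. std_normal) (\<lambda>b F. F b) I"
    proof (rule N.indep_vars_subset[OF _ I(3)], subst N.indep_vars_iff_distr_eq_PiM')
      have "distr ?N (PiM Basis (\<lambda>_. std_normal)) (\<lambda>x. \<lambda>i\<in>Basis. x i) = distr ?N ?N (\<lambda>x. x)"
        by (intro distr_cong) (auto simp: space_PiM)
      also have "\<dots> = ?N" by simp
      also have "\<dots> = PiM Basis (\<lambda>i. distr ?N std_normal (\<lambda>F. F i))"
        by (intro PiM_cong refl distr_PiM_component[symmetric] prob_space_std_normal)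
      finally show "distr ?N (PiM Basis (\<lambda>_. std_normal)) (\<lambda>x. \<lambda>i\<in>Basis. x i) = PiM Basis (\<lambda>i. distr ?N std_normal (\<lambda>F. F i))" .
    qed auto
    from N.indep_vars_compose2[OF this, of "\<lambda>b x. (p \<bullet> b) * x" "\<lambda>_. borel"] show ?thesis by simp
  qed
  have "distributed ?N lborel (\<lambda>F. (p \<bullet> b) * F b) (normal_density 0 \<bar>p \<bullet> b\<bar>)" if b: "b \<in> I" for b
  proof -
    have "distr ?N lborel (\<lambda>F. F b) = std_normal"
      using distr_PiM_component[of Basis "\<lambda>_. std_normal" b] prob_space_std_normal b I
      by (auto cong: distr_cong)
    then have "distributed ?N lborel (\<lambda>F. F b) std_normal_density"
      using b I by (auto simp: distributed_def)
    from N.normal_density_affine[OF this _, of "p \<bullet> b" 0] b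
    show ?thesis by (simp add: I_def)
  qed
  from N.sum_indep_normal[OF I(1,2) ind _ this]
  have "distributed ?N lborel (\<lambda>F. \<Sum>b\<in>I. (p \<bullet> b) * F b) (normal_density 0 (sqrt (\<Sum>b\<in>I. \<bar>p \<bullet> b\<bar>\<^sup>2)))"
    by (simp add: I_def)
  moreover have "(\<Sum>b\<in>I. (p \<bullet> b) * F b) = (\<Sum>b\<in>Basis. F b *\<^sub>R b) \<bullet> p" for F
    unfolding inner_sum_left by (intro sum.mono_neutral_cong_left) (auto simp: I_def inner_commute)
  moreover have "(\<Sum>b\<in>I. \<bar>p \<bullet> b\<bar>\<^sup>2) = (norm p)\<^sup>2"
    unfolding power2_norm_eq_inner euclidean_inner[of p p]
    by (intro sum.mono_neutral_cong_left) (auto simp: I_def power2_eq_square)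
  ultimately have d: "distributed ?N lborel (\<lambda>F. (\<Sum>b\<in>Basis. F b *\<^sub>R b) \<bullet> p) (normal_density 0 (norm p))" by simp
  show ?thesis
    unfolding std_gaussian_eq_PiM distributed_def
  proof (intro conjI)
    have T: "(\<lambda>F. \<Sum>b\<in>(Basis :: (real^'n) set). F b *\<^sub>R b) \<in> ?N \<rightarrow>\<^sub>M borel" by measurable
    show "distr (distr ?N borel (\<lambda>F. \<Sum>b\<in>Basis. F b *\<^sub>R b)) lborel (\<lambda>z. z \<bullet> p) = density lborel (\<lambda>x. ennreal (normal_density 0 (norm p) x))"
      using d by (subst distr_distr[OF _ T]) (auto simp: distributed_def comp_def)
  qed auto
qed

lemma std_gaussian_moment_integrable: "integrable std_gaussian (\<lambda>z. \<bar>z \<bullet> p\<bar> ^ m)" for p :: "real^'n::finite"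
proof (cases "p = 0")
  case True
  interpret prob_space "std_gaussian :: (real^'n) measure" by (rule prob_space_std_gaussian)
  show ?thesis using True by (cases m) auto
next
  case False
  have "integrable lborel (\<lambda>x. normal_density 0 (norm p) x * \<bar>x\<bar> ^ m)"
    using integrable_normal_moment_abs[of "norm p" 0 m] False by simp
  then show ?thesis
    by (subst (asm) distributed_integrable[OF std_gaussian_inner_distributed[OF False]]) auto
qed

lemma std_gaussian_moment_even:
  fixes p :: "real^'n::finite"
  shows "(\<integral>z. (z \<bullet> p) ^ (2 * k) \<partial>std_gaussian) = fact (2 * k) / (2 ^ k * fact k) * norm p ^ (2 * k)"
proof (cases "p = 0")
  case True
  interpret prob_space "std_gaussian :: (real^'n) measure" by (rule prob_space_std_gaussian)
  show ?thesis using True prob_space by (cases k) auto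
next
  case False
  have "(\<integral>z. (z \<bullet> p) ^ (2 * k) \<partial>std_gaussian) = (\<integral>x. normal_density 0 (norm p) x * x ^ (2 * k) \<partial>lborel)"
    by (rule distributed_integral[OF std_gaussian_inner_distributed[OF False], symmetric]) auto
  also have "\<dots> = fact (2 * k) / ((2 / (norm p)\<^sup>2)^k * fact k)"
    using integral_normal_moment_even[of "norm p" 0 k] False by simp
  also have "(2 / (norm p)\<^sup>2)^k = 2 ^ k / norm p ^ (2 * k)" by (simp add: power_divide power_mult)
  finally show ?thesis by simp
qed

lemma std_gaussian_norm_integrable: "integrable std_gaussian (\<lambda>z::real^'n::finite. norm z ^ m)"
proof (rule Bochner_Integration.integrable_bound)
  let ?B = "Basis :: (real^'n) set"
  show "integrable std_gaussian (\<lambda>z. real (card ?B) ^ m * (\<Sum>b\<in>?B. \<bar>z \<bullet> b\<bar> ^ m))"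
    by (intro integrable_mult_right Bochner_Integration.integrable_sum std_gaussian_moment_integrable)
  show "AE z in std_gaussian. norm (norm z ^ m) \<le> norm (real (card ?B) ^ m * (\<Sum>b\<in>?B. \<bar>z \<bullet> b\<bar> ^ m))"
  proof (rule AE_I2)
    fix z :: "real^'n"
    \<comment> \<open>The norm is at most the dimension times the largest coordinate, and a power of
      the largest coordinate is at most the sum of all such powers.\<close>
    define s where "s = Max ((\<lambda>b. \<bar>z \<bullet> b\<bar>) ` ?B)"
    have "s \<in> (\<lambda>b. \<bar>z \<bullet> b\<bar>) ` ?B" unfolding s_def by (rule Max_in) auto
    then obtain b where b: "b \<in> ?B" "s = \<bar>z \<bullet> b\<bar>" by auto
    have "norm z \<le> (\<Sum>b\<in>?B. \<bar>z \<bullet> b\<bar>)" by (rule norm_le_l1)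
    also have "\<dots> \<le> real (card ?B) * s" by (intro sum_bounded_above) (auto simp: s_def)
    finally have "norm z ^ m \<le> (real (card ?B) * s) ^ m" by (rule power_mono) simp
    also have "\<dots> = real (card ?B) ^ m * s ^ m" by (simp add: power_mult_distrib)
    also have "\<dots> \<le> real (card ?B) ^ m * (\<Sum>b\<in>?B. \<bar>z \<bullet> b\<bar> ^ m)"
      unfolding b(2) by (intro mult_left_mono member_le_sum b) auto
    finally show "norm (norm z ^ m) \<le> norm (real (card ?B) ^ m * (\<Sum>b\<in>?B. \<bar>z \<bullet> b\<bar> ^ m))"
      by (simp add: sum_nonneg abs_mult)
  qed
qed auto

lemma std_gaussian_poly_integrable: "integrable std_gaussian (\<lambda>z::real^'n::finite. (1 + norm z) ^ m)"
proof -
  have "(\<lambda>z::real^'n. (1 + norm z) ^ m) = (\<lambda>z. \<Sum>k\<le>m. of_nat (m choose k) * norm z ^ (m - k))"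
    by (simp add: binomial_ring)
  then show ?thesis by (auto intro!: Bochner_Integration.integrable_sum integrable_mult_right std_gaussian_norm_integrable)
qed

lemma std_gaussian_integrable_poly_bound:
  fixes \<phi> :: "real^'n::finite \<Rightarrow> real"
  assumes "\<phi> \<in> borel_measurable borel" "\<And>z. \<bar>\<phi> z\<bar> \<le> K * (1 + norm z) ^ m"
  shows "integrable std_gaussian \<phi>"
proof (rule Bochner_Integration.integrable_bound)
  show "integrable std_gaussian (\<lambda>z::real^'n. K * (1 + norm z) ^ m)"
    by (intro integrable_mult_right std_gaussian_poly_integrable)
  show "AE z in std_gaussian. norm (\<phi> z) \<le> norm (K * (1 + norm z) ^ m)"
    using assms(2) by (intro AE_I2) (metis abs_ge_self order_trans real_norm_def)
qed (use assms in simp)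

lemma std_gaussian_covariance:
  fixes p q :: "real^'n::finite"
  shows "(\<integral>z. (z \<bullet> p) * (z \<bullet> q) \<partial>std_gaussian) = p \<bullet> q"
proof -
  have i: "integrable std_gaussian (\<lambda>z. (z \<bullet> p)\<^sup>2)" for p :: "real^'n"
    using std_gaussian_moment_integrable[of p 2] by simp
  have m: "(\<integral>z. (z \<bullet> p)\<^sup>2 \<partial>std_gaussian) = (norm p)\<^sup>2" for p :: "real^'n"
    using std_gaussian_moment_even[of p 1] by (simp add: power2_eq_square)
  have "(\<integral>z. (z \<bullet> p) * (z \<bullet> q) \<partial>std_gaussian) = (\<integral>z. 1 / 4 * (z \<bullet> (p + q))\<^sup>2 - 1 / 4 * (z \<bullet> (p - q))\<^sup>2 \<partial>std_gaussian)"
    by (intro Bochner_Integration.integral_cong) (auto simp: inner_add_right inner_diff_right power2_eq_square algebra_simps)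
  also have "\<dots> = 1 / 4 * (norm (p + q))\<^sup>2 - 1 / 4 * (norm (p - q))\<^sup>2"
    using i m by (subst Bochner_Integration.integral_diff) auto
  also have "\<dots> = p \<bullet> q"
    by (simp add: power2_norm_eq_inner inner_add_left inner_add_right inner_diff_left inner_diff_right inner_commute field_simps)
  finally show ?thesis .
qed

lemma std_gaussian_norm2: "(\<integral>z. (norm (z :: real^'n::finite))\<^sup>2 \<partial>std_gaussian) = real CARD('n)"
proof -
  have "(\<integral>z. (norm (z :: real^'n))\<^sup>2 \<partial>std_gaussian) = (\<integral>z. (\<Sum>b\<in>(Basis::(real^'n) set). (z \<bullet> b) * (z \<bullet> b)) \<partial>std_gaussian)"
    by (intro Bochner_Integration.integral_cong refl) (simp add: power2_norm_eq_inner euclidean_inner[symmetric])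
  also have "\<dots> = (\<Sum>b\<in>(Basis::(real^'n) set). \<integral>z. (z \<bullet> b) * (z \<bullet> b) \<partial>std_gaussian)"
    using std_gaussian_moment_integrable[of _ 2, where 'n = 'n]
    by (intro Bochner_Integration.integral_sum) (simp add: power2_eq_square)
  also have "\<dots> = real CARD('n)" by (simp add: std_gaussian_covariance inner_Basis)
  finally show ?thesis .
qed

text \<open>Polarization of fourth powers yields Wick's formula, whose extra term
  \<open>2 * (p \<bullet> q)\<^sup>2\<close> is dropped. This lower bound is the source of the noise
  gain: it holds however \<open>p\<close> and \<open>q\<close> lie relative to each other.\<close>

lemma std_gaussian_fourth:
  fixes p q :: "real^'n::finite"
  shows "(norm p)\<^sup>2 * (norm q)\<^sup>2 \<le> (\<integral>z. ((z \<bullet> p) * (z \<bullet> q))\<^sup>2 \<partial>std_gaussian)"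
proof -
  have i: "integrable std_gaussian (\<lambda>z. (z \<bullet> p) ^ 4)" for p :: "real^'n"
    using std_gaussian_moment_integrable[of p 4] by simp
  have m: "(\<integral>z. (z \<bullet> p) ^ 4 \<partial>std_gaussian) = 3 * (norm p) ^ 4" for p :: "real^'n"
    using std_gaussian_moment_even[of p 2] by (simp add: fact_numeral)
  have n4: "norm x ^ 4 = (x \<bullet> x)\<^sup>2" for x :: "real^'n"
    by (metis (no_types) numeral_Bit0 power2_norm_eq_inner power_add power2_eq_square)
  have "(\<integral>z. ((z \<bullet> p) * (z \<bullet> q))\<^sup>2 \<partial>std_gaussian)
      = (\<integral>z. 1 / 12 * (z \<bullet> (p + q)) ^ 4 + 1 / 12 * (z \<bullet> (p - q)) ^ 4 - 1 / 6 * (z \<bullet> p) ^ 4 - 1 / 6 * (z \<bullet> q) ^ 4 \<partial>std_gaussian)"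
    by (intro Bochner_Integration.integral_cong)
      (auto simp: inner_add_right inner_diff_right power2_eq_square power4_eq_xxxx algebra_simps)
  also have "\<dots> = 1 / 12 * (3 * norm (p + q) ^ 4) + 1 / 12 * (3 * norm (p - q) ^ 4) - 1 / 6 * (3 * norm p ^ 4) - 1 / 6 * (3 * norm q ^ 4)"
    using i m by simp
  also have "\<dots> = (p \<bullet> p) * (q \<bullet> q) + 2 * (p \<bullet> q)\<^sup>2"
    unfolding n4 by (simp add: inner_add_left inner_add_right inner_diff_left inner_diff_right inner_commute[of q p] power2_eq_square algebra_simps)
  finally show ?thesis by (simp add: power2_norm_eq_inner)
qed

lemma std_gaussian_reflect:
  fixes \<phi> :: "real^'n::finite \<Rightarrow> real"
  assumes [measurable]: "\<phi> \<in> borel_measurable borel"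
  shows "(\<integral>z. \<phi> (- z) \<partial>std_gaussian) = (\<integral>z. \<phi> z \<partial>std_gaussian)"
proof -
  let ?d = "\<lambda>z::real^'n. \<Prod>i\<in>UNIV. std_normal_density (z $ i)"
  have d: "?d (- z) = ?d z" for z by (simp add: std_normal_density_def)
  have nn: "0 \<le> ?d z" for z by (intro prod_nonneg) simp
  have "(\<integral>z. \<phi> z \<partial>std_gaussian) = (\<integral>z. ?d z * \<phi> z \<partial>lborel)"
    unfolding std_gaussian_def by (subst integral_density) (auto simp: nn)
  also have "\<dots> = (\<integral>z. ?d z * \<phi> z \<partial>density (distr lborel borel (\<lambda>x. 0 + (-1) *\<^sub>R x)) (\<lambda>_. \<bar>-1::real\<bar> ^ DIM(real^'n)))"
    using lborel_affine[of "-1" "0::real^'n"] by simp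
  also have "\<dots> = (\<integral>z. ?d (- z) * \<phi> (- z) \<partial>lborel)"
    by (simp add: density_1 integral_distr)
  also have "\<dots> = (\<integral>z. \<phi> (- z) \<partial>std_gaussian)"
    unfolding std_gaussian_def d by (subst integral_density) (auto simp: nn)
  finally show ?thesis by simp
qed

section \<open>Spectral projections as matrices and their perturbation\<close>

lemma onset_projection:
  assumes "onset (set V)" "distinct V"
  shows "gram V *v (gram V *v x) = gram V *v x" "(gram V *v x) \<bullet> y = x \<bullet> (gram V *v y)"
    "gram V *v x = x \<longleftrightarrow> x \<in> span (set V)" "gram V *v x = 0 \<longleftrightarrow> (\<forall>v\<in>set V. v \<bullet> x = 0)"
    "gram V *v x \<in> span (set V)"
proof -
  note g = gram_mult[OF assms(2)]
  show sp: "gram V *v x \<in> span (set V)" for x unfolding g by (intro span_sum span_scale span_base)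
  have id: "gram V *v x = x" if "x \<in> span (set V)" for x
    unfolding g by (rule onset_expand[OF assms(1) that, symmetric])
  show "gram V *v (gram V *v x) = gram V *v x" by (rule id[OF sp])
  show "gram V *v x = x \<longleftrightarrow> x \<in> span (set V)" using id sp by metis
  show "(gram V *v x) \<bullet> y = x \<bullet> (gram V *v y)"
    unfolding g by (simp add: inner_sum_left inner_sum_right inner_commute mult.commute)
  show "gram V *v x = 0 \<longleftrightarrow> (\<forall>v\<in>set V. v \<bullet> x = 0)"
  proof
    assume z: "gram V *v x = 0"
    show "\<forall>v\<in>set V. v \<bullet> x = 0"
      using onset_coeff[OF assms(1), of _ "\<lambda>v. v \<bullet> x"] z unfolding g by (metis inner_zero_right)
  qed (simp add: g)
qed

lemma gram_commute:
  fixes A :: "real^'n::finite^'n"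
  assumes sym: "\<And>x y. (A *v x) \<bullet> y = x \<bullet> (A *v y)" and V: "onset (set V)" "distinct V"
    and ev: "\<And>v. v \<in> set V \<Longrightarrow> A *v v = \<theta> v *\<^sub>R v"
  shows "A *v (gram V *v x) = gram V *v (A *v x)"
proof -
  have "A *v (gram V *v x) = (\<Sum>v\<in>set V. (v \<bullet> x) *\<^sub>R (A *v v))"
    unfolding gram_mult[OF V(2)] linear_sum[OF matrix_vector_mul_linear] matrix_vector_mult_scaleR ..
  also have "\<dots> = (\<Sum>v\<in>set V. (v \<bullet> (A *v x)) *\<^sub>R v)"
    using ev by (intro sum.cong refl) (simp flip: sym)
  finally show ?thesis unfolding gram_mult[OF V(2)] .
qed

lemma low_eigenvectors_eigen:
  assumes "low_eigenvectors A k V"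
  obtains \<theta> where "\<And>v. v \<in> set V \<Longrightarrow> A *v v = \<theta> v *\<^sub>R v"
proof -
  have "\<forall>v\<in>set V. \<exists>t. A *v v = t *\<^sub>R v"
    using assms by (auto simp: low_eigenvectors_def in_set_conv_nth)
  then show ?thesis using that by metis
qed

lemma low_eigenvectors_onset:
  assumes "low_eigenvectors A k V"
  shows "onset (set V)" "distinct V" "card (set V) = k" "length V = k"
  using assms onset_set_list[of V] by (auto simp: low_eigenvectors_def)

text \<open>\<open>sin_two_theta\<close> compares the ranges of the two projections and, applied to
  the negated operators, their kernels. Splitting \<open>x\<close> by the projection to
  \<open>V\<^sub>0\<close>, the difference of the projections sends it to \<open>a - b\<close> with
  \<open>a\<close> in the range and \<open>b\<close> in the kernel of \<open>gram V\<close>. By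
  Pythagoras the two bounds combine without a further factor.\<close>

lemma gram_perturbation:
  fixes A A\<^sub>0 :: "real^'n::finite^'n"
  assumes sym: "\<And>x y. (A *v x) \<bullet> y = x \<bullet> (A *v y)" and sym0: "\<And>x y. (A\<^sub>0 *v x) \<bullet> y = x \<bullet> (A\<^sub>0 *v y)"
    and V: "low_eigenvectors A k V" and V0: "low_eigenvectors A\<^sub>0 k V\<^sub>0" and k: "k \<le> CARD('n)"
    and gap: "\<And>i. i < CARD('n) \<Longrightarrow> if i < k then eigvals A ! i < - \<mu> else \<mu> < eigvals A ! i"
    and pert: "\<And>x y. \<bar>x \<bullet> (A\<^sub>0 *v y - A *v y)\<bar> \<le> h * norm x * norm y" and h: "0 \<le> h" "h < \<mu>"
  shows "mat_norm (gram V - gram V\<^sub>0) \<le> h / (sqrt 2 * \<mu>)"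
proof -
  note o = low_eigenvectors_onset[OF V] and o0 = low_eigenvectors_onset[OF V0]
  note P = onset_projection[OF o(1,2)] and P0 = onset_projection[OF o0(1,2)]
  have low: "u \<bullet> (A *v u) \<le> - \<mu> * (norm u)\<^sup>2" if "gram V *v u = u" for u
    using low_eigenvectors_forms(1)[OF sym V k, of "- \<mu>" \<mu> u] gap k h that P(3) by (force simp: less_imp_le)
  have high: "\<mu> * (norm u)\<^sup>2 \<le> u \<bullet> (A *v u)" if "gram V *v u = 0" for u
    using low_eigenvectors_forms(2)[OF sym V k, of "- \<mu>" \<mu> u] gap k h that P(4) by (force simp: less_imp_le)
  have pert2: "\<bar>u \<bullet> (A\<^sub>0 *v u) - u \<bullet> (A *v u)\<bar> \<le> h * (norm u)\<^sup>2" for u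
    using pert[of u u] by (simp add: inner_diff_right power2_eq_square mult.assoc)
  have signs: "if i < k then eigvals A\<^sub>0 ! i < 0 else 0 < eigvals A\<^sub>0 ! i" if "i < CARD('n)" for i
  proof (rule eigvals_signs[OF sym0 o(1,3) _ _ that])
    fix u assume u: "u \<in> span (set V)" "u \<noteq> 0"
    have "\<mu> * (norm u)\<^sup>2 - h * (norm u)\<^sup>2 > 0" using h u by simp
    moreover have "u \<bullet> (A *v u) \<le> - \<mu> * (norm u)\<^sup>2" using low u P(3) by blast
    ultimately show "u \<bullet> (A\<^sub>0 *v u) < 0" using pert2[of u] by linarith
  next
    fix u assume u: "\<And>v. v \<in> set V \<Longrightarrow> v \<bullet> u = 0" "u \<noteq> 0"
    have "\<mu> * (norm u)\<^sup>2 - h * (norm u)\<^sup>2 > 0" using h u by simp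
    moreover have "\<mu> * (norm u)\<^sup>2 \<le> u \<bullet> (A *v u)" using high u P(4) by blast
    ultimately show "0 < u \<bullet> (A\<^sub>0 *v u)" using pert2[of u] by linarith
  qed
  \<comment> \<open>The signs of the eigenvalues of \<open>A\<^sub>0\<close> are known but no gap of
    definite size; their least modulus provides the strict separation that
    \<open>low_eigenvectors_forms\<close> asks for.\<close>
  define \<nu> where "\<nu> = Min ((\<lambda>i. \<bar>eigvals A\<^sub>0 ! i\<bar>) ` {..<CARD('n)})"
  have \<nu>: "0 < \<nu>" unfolding \<nu>_def
  proof (subst Min_gr_iff)
    show "(\<lambda>i. \<bar>eigvals A\<^sub>0 ! i\<bar>) ` {..<CARD('n)} \<noteq> {}" using zero_less_card_finite[where 'a='n] by blast
    show "\<forall>a\<in>(\<lambda>i. \<bar>eigvals A\<^sub>0 ! i\<bar>) ` {..<CARD('n)}. 0 < a" using signs by (metis (no_types, lifting) imageE lessThan_iff less_irrefl zero_less_abs_iff)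
  qed simp
  have \<nu>le: "\<nu> \<le> \<bar>eigvals A\<^sub>0 ! i\<bar>" if "i < CARD('n)" for i unfolding \<nu>_def using that by (intro Min_le) auto
  have "eigvals A\<^sub>0 ! i \<le> - \<nu>" if "i < k" for i using \<nu>le[of i] signs[of i] that k by simp
  moreover have "\<nu> \<le> eigvals A\<^sub>0 ! i" if "k \<le> i" "i < CARD('n)" for i using \<nu>le[of i] signs[of i] that by simp
  ultimately have forms0: "u \<in> span (set V\<^sub>0) \<Longrightarrow> u \<bullet> (A\<^sub>0 *v u) \<le> - \<nu> * (norm u)\<^sup>2"
      "(\<And>v. v \<in> set V\<^sub>0 \<Longrightarrow> v \<bullet> u = 0) \<Longrightarrow> \<nu> * (norm u)\<^sup>2 \<le> u \<bullet> (A\<^sub>0 *v u)" for u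
    using low_eigenvectors_forms[OF sym0 V0 k, of "- \<nu>" \<nu> u] \<nu> by auto
  have low0: "u \<bullet> (A\<^sub>0 *v u) < 0" if "gram V\<^sub>0 *v u = u" "u \<noteq> 0" for u
  proof -
    have "0 < \<nu> * (norm u)\<^sup>2" using \<nu> that by simp
    then show ?thesis using forms0(1)[of u] that P0(3) by simp
  qed
  have high0: "0 < u \<bullet> (A\<^sub>0 *v u)" if "gram V\<^sub>0 *v u = 0" "u \<noteq> 0" for u
  proof -
    have "0 < \<nu> * (norm u)\<^sup>2" using \<nu> that by simp
    then show ?thesis using forms0(2)[of u] that P0(4) by simp
  qed
  obtain \<theta> where \<theta>: "\<And>v. v \<in> set V \<Longrightarrow> A *v v = \<theta> v *\<^sub>R v" using low_eigenvectors_eigen[OF V] by blast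
  obtain \<theta>0 where \<theta>0: "\<And>v. v \<in> set V\<^sub>0 \<Longrightarrow> A\<^sub>0 *v v = \<theta>0 v *\<^sub>R v" using low_eigenvectors_eigen[OF V0] by blast
  note com = gram_commute[OF sym o(1,2) \<theta>] and com0 = gram_commute[OF sym0 o0(1,2) \<theta>0]
  have neg: "W *v - y = - (W *v y)" for W :: "real^'n^'n" and y by (rule linear_neg[OF matrix_vector_mul_linear])
  let ?s = "h / (sqrt 2 * \<mu>)"
  have s0: "0 \<le> ?s" using h by simp
  have side1: "norm (u - gram V *v u) \<le> ?s * norm u" if "gram V\<^sub>0 *v u = u" for u
    by (rule sin_two_theta[where T="\<lambda>x. A *v x" and T\<^sub>0="\<lambda>x. A\<^sub>0 *v x" and Q\<^sub>0="\<lambda>x. gram V\<^sub>0 *v x"])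
      (use P P0 com com0 low high low0 high0 pert h that sym0 in \<open>auto simp: matrix_vector_mul_linear\<close>)
  have side2: "norm (u - (u - gram V *v u)) \<le> ?s * norm u" if "gram V\<^sub>0 *v u = 0" for u
  proof (rule sin_two_theta[where T="\<lambda>x. - (A *v x)" and T\<^sub>0="\<lambda>x. - (A\<^sub>0 *v x)" and Q="\<lambda>x. x - gram V *v x" and Q\<^sub>0="\<lambda>x. x - gram V\<^sub>0 *v x"])
    show "\<bar>x \<bullet> (- (A\<^sub>0 *v y) - - (A *v y))\<bar> \<le> h * norm x * norm y" for x y
      using pert[of x y] by (simp add: inner_diff_right abs_minus_commute)
    show "x \<bullet> - (A *v x) \<le> - \<mu> * (norm x)\<^sup>2" if "x - gram V *v x = x" for x using high[of x] that by simp
    show "\<mu> * (norm x)\<^sup>2 \<le> x \<bullet> - (A *v x)" if "x - gram V *v x = 0" for x using low[of x] that by simp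
    show "x \<bullet> - (A\<^sub>0 *v x) < 0" if "x - gram V\<^sub>0 *v x = x" "x \<noteq> 0" for x using high0[of x] that by simp
    show "0 < x \<bullet> - (A\<^sub>0 *v x)" if "x - gram V\<^sub>0 *v x = 0" "x \<noteq> 0" for x using low0[of x] that by simp
    show "- (A *v (x - gram V *v x)) = - (A *v x) - gram V *v - (A *v x)" for x
      by (simp add: matrix_vector_mult_diff_distrib neg com)
    show "- (A\<^sub>0 *v (x - gram V\<^sub>0 *v x)) = - (A\<^sub>0 *v x) - gram V\<^sub>0 *v - (A\<^sub>0 *v x)" for x
      by (simp add: matrix_vector_mult_diff_distrib neg com0)
    show "- (A\<^sub>0 *v x) \<bullet> y = x \<bullet> - (A\<^sub>0 *v y)" for x y by (simp add: sym0)
  qed (use P(1,2) P0(1,2) h that in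
      \<open>auto simp: matrix_vector_mul_linear matrix_vector_mult_diff_distrib inner_diff_left inner_diff_right linear_compose_sub linear_compose_neg linear_id[unfolded id_def]\<close>)
  show ?thesis unfolding mat_norm_def
  proof (rule onorm_le)
    fix x
    define y where "y = gram V\<^sub>0 *v x"
    define w where "w = x - y"
    have y: "gram V\<^sub>0 *v y = y" and w: "gram V\<^sub>0 *v w = 0" by (simp_all add: y_def w_def P0(1) matrix_vector_mult_diff_distrib)
    have yw: "y \<bullet> w = 0" using P0(2)[of y w] y w by simp
    have "x = y + w" by (simp add: w_def)
    then have nx: "(norm x)\<^sup>2 = (norm y)\<^sup>2 + (norm w)\<^sup>2"
      using yw by (simp add: power2_norm_eq_inner inner_add_left inner_add_right inner_commute)
    define a where "a = gram V *v w"
    define b where "b = y - gram V *v y"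
    have a_le: "norm a \<le> ?s * norm w" using side2[OF w] unfolding a_def diff_diff_eq2 add_diff_cancel_left' .
    have b_le: "norm b \<le> ?s * norm y" using side1[OF y] unfolding b_def .
    have "a \<bullet> b = 0" unfolding a_def b_def P(2) by (simp add: P(1) matrix_vector_mult_diff_distrib)
    then have "(norm (a - b))\<^sup>2 = (norm a)\<^sup>2 + (norm b)\<^sup>2"
      by (simp add: power2_norm_eq_inner inner_diff_left inner_diff_right inner_commute)
    also have "\<dots> \<le> (?s * norm w)\<^sup>2 + (?s * norm y)\<^sup>2"
      using a_le b_le by (intro add_mono power_mono) auto
    also have "\<dots> = (?s * norm x)\<^sup>2" unfolding power_mult_distrib nx by (simp add: distrib_left)
    finally have "norm (a - b) \<le> ?s * norm x" by (rule power2_le_imp_le[OF _ mult_nonneg_nonneg[OF s0 norm_ge_zero]])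
    moreover have "(gram V - gram V\<^sub>0) *v (y + w) = a - b"
      unfolding matrix_vector_mult_diff_rdistrib matrix_vector_right_distrib y w by (simp add: a_def b_def)
    ultimately show "norm ((gram V - gram V\<^sub>0) *v x) \<le> ?s * norm x" using \<open>x = y + w\<close> by metis
  qed
qed

section \<open>Differentiation under the Gaussian expectation\<close>

lemma quadratic_growth:
  fixes g :: "'a::euclidean_space \<Rightarrow> real"
  assumes g: "C_smooth 2 g" and B: "\<And>h y. \<bar>dderiv g [h, h] y\<bar> \<le> B * (norm h)\<^sup>2"
  shows "\<exists>K\<ge>0. \<forall>y. \<bar>g y\<bar> \<le> K * (1 + norm y)\<^sup>2"
proof -
  have "linear (\<lambda>h. dderiv g [h] 0)" using dderiv_slot_linear[OF g, of "[]" "[]"] by simp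
  then obtain K1 where K1: "0 < K1" "\<And>h. \<bar>dderiv g [h] 0\<bar> \<le> norm h * K1"
    using bounded_linear.pos_bounded[of "\<lambda>h. dderiv g [h] 0"] by (auto simp: linear_conv_bounded_linear)
  show ?thesis
  proof (intro exI[of _ "\<bar>g 0\<bar> + K1 + \<bar>B\<bar>"] conjI allI)
    fix y
    have "\<bar>g (0 + y) - g 0 - dderiv g [y] 0\<bar> \<le> B * (norm y)\<^sup>2 / 2" by (rule taylor_remainder2[OF g B])
    then have r: "\<bar>g y - g 0 - dderiv g [y] 0\<bar> \<le> B * (norm y)\<^sup>2 / 2" by simp
    have "\<bar>g y\<bar> = \<bar>(g 0 + dderiv g [y] 0) + (g y - g 0 - dderiv g [y] 0)\<bar>" by simp
    also have "\<dots> \<le> \<bar>g 0\<bar> + norm y * K1 + B * (norm y)\<^sup>2 / 2"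
      by (intro order_trans[OF abs_triangle_ineq] add_mono order_refl r K1(2))
    also have "\<dots> \<le> \<bar>g 0\<bar> * (1 + norm y)\<^sup>2 + K1 * (1 + norm y)\<^sup>2 + \<bar>B\<bar> * (1 + norm y)\<^sup>2"
    proof (intro add_mono)
      have 1: "1 \<le> (1 + norm y)\<^sup>2" by (simp add: power2_eq_square algebra_simps)
      show "\<bar>g 0\<bar> \<le> \<bar>g 0\<bar> * (1 + norm y)\<^sup>2" using mult_left_mono[OF 1, of "\<bar>g 0\<bar>"] by simp
      have "norm y \<le> (1 + norm y)\<^sup>2" by (simp add: power2_eq_square algebra_simps)
      from mult_left_mono[OF this, of K1] show "norm y * K1 \<le> K1 * (1 + norm y)\<^sup>2" using K1 by (simp add: mult.commute)
      have "B * (norm y)\<^sup>2 / 2 \<le> \<bar>B\<bar> * (norm y)\<^sup>2"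
        using mult_right_mono[OF abs_ge_self, of "(norm y)\<^sup>2" B] mult_nonneg_nonneg[of "\<bar>B\<bar>" "(norm y)\<^sup>2"] by (simp del: mult_nonneg_nonneg)
      also have "\<dots> \<le> \<bar>B\<bar> * (1 + norm y)\<^sup>2" by (intro mult_left_mono power_mono) auto
      finally show "B * (norm y)\<^sup>2 / 2 \<le> \<bar>B\<bar> * (1 + norm y)\<^sup>2" .
    qed
    finally show "\<bar>g y\<bar> \<le> (\<bar>g 0\<bar> + K1 + \<bar>B\<bar>) * (1 + norm y)\<^sup>2" by (simp add: algebra_simps)
  qed (use K1 in simp)
qed

lemma integrable_quadratic_growth:
  fixes g :: "real^'n::finite \<Rightarrow> real"
  assumes g: "continuous_on UNIV g" and K: "0 \<le> K" "\<And>y. \<bar>g y\<bar> \<le> K * (1 + norm y)\<^sup>2"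
  shows "integrable std_gaussian (\<lambda>z. g (x + l *\<^sub>R z))"
proof (rule std_gaussian_integrable_poly_bound)
  show "(\<lambda>z. g (x + l *\<^sub>R z)) \<in> borel_measurable borel"
    by (intro borel_measurable_continuous_onI continuous_on_compose2[OF g] continuous_intros) auto
  fix z
  have "1 + norm (x + l *\<^sub>R z) \<le> (1 + norm x + \<bar>l\<bar>) * (1 + norm z)"
  proof -
    have "(1 + norm x + \<bar>l\<bar>) * (1 + norm z) = 1 + norm x + \<bar>l\<bar> + norm z + norm x * norm z + \<bar>l\<bar> * norm z"
      by (simp add: algebra_simps)
    moreover have "norm (x + l *\<^sub>R z) \<le> norm x + \<bar>l\<bar> * norm z" using norm_triangle_ineq[of x "l *\<^sub>R z"] by simp
    moreover have "0 \<le> norm x * norm z" "0 \<le> \<bar>l\<bar>" "0 \<le> norm z" by auto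
    ultimately show ?thesis by linarith
  qed
  then have "(1 + norm (x + l *\<^sub>R z))\<^sup>2 \<le> ((1 + norm x + \<bar>l\<bar>) * (1 + norm z))\<^sup>2" by (intro power_mono) auto
  then have "K * (1 + norm (x + l *\<^sub>R z))\<^sup>2 \<le> K * ((1 + norm x + \<bar>l\<bar>)\<^sup>2 * (1 + norm z)\<^sup>2)"
    using K by (intro mult_left_mono) (auto simp: power_mult_distrib)
  then show "\<bar>g (x + l *\<^sub>R z)\<bar> \<le> (K * (1 + norm x + \<bar>l\<bar>)\<^sup>2) * (1 + norm z)\<^sup>2"
    using K(2)[of "x + l *\<^sub>R z"] by (simp add: mult.assoc)
qed

text \<open>The Taylor remainder is bounded by \<open>B * (norm h)\<^sup>2 / 2\<close> uniformly in
  the base point, so it can be integrated and yields the Frechet derivative directly. Integrability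
  of the derivative comes from writing it through two values of \<open>g\<close> and this
  remainder.\<close>

lemma smooth_dderiv:
  fixes g :: "real^'n::finite \<Rightarrow> real"
  assumes g: "C_smooth 2 g" and B: "\<And>h y. \<bar>dderiv g [h, h] y\<bar> \<le> B * (norm h)\<^sup>2"
  shows "dderiv (smooth g l) [h] = smooth (dderiv g [h]) l"
proof
  fix y
  obtain K where K: "0 \<le> K" "\<And>y. \<bar>g y\<bar> \<le> K * (1 + norm y)\<^sup>2" using quadratic_growth[OF g B] by blast
  have cont: "continuous_on UNIV g" using dderiv_continuous[OF g, of "[]"] by simp
  have conth: "continuous_on UNIV (dderiv g [h])" for h using dderiv_continuous[OF g, of "[h]"] by simp
  have intg: "integrable std_gaussian (\<lambda>z. g (y + l *\<^sub>R z))" for y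
    by (rule integrable_quadratic_growth[OF cont K])
  have B0: "0 \<le> B"
  proof -
    have "0 \<le> B * (norm (axis undefined 1 :: real^'n))\<^sup>2" by (rule order_trans[OF abs_ge_zero B])
    then show ?thesis by simp
  qed
  have tay: "\<bar>g (y + h) - g y - dderiv g [h] y\<bar> \<le> B * (norm h)\<^sup>2 / 2" for y h
    by (rule taylor_remainder2[OF g B])
  have intd: "integrable std_gaussian (\<lambda>z. dderiv g [h] (y + l *\<^sub>R z))" for h
  proof (rule integrable_quadratic_growth[OF conth])
    fix y
    have "(1 + norm (y + h))\<^sup>2 \<le> ((1 + norm h) * (1 + norm y))\<^sup>2"
    proof (intro power_mono)
      have "(1 + norm h) * (1 + norm y) = 1 + norm h + norm y + norm h * norm y" by (simp add: algebra_simps)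
      moreover have "0 \<le> norm h * norm y" by simp
      ultimately show "1 + norm (y + h) \<le> (1 + norm h) * (1 + norm y)" using norm_triangle_ineq[of y h] by linarith
    qed simp
    then have "K * (1 + norm (y + h))\<^sup>2 \<le> K * ((1 + norm h)\<^sup>2 * (1 + norm y)\<^sup>2)"
      using K by (intro mult_left_mono) (auto simp: power_mult_distrib)
    then have 1: "\<bar>g (y + h)\<bar> \<le> K * (1 + norm h)\<^sup>2 * (1 + norm y)\<^sup>2" using K(2)[of "y + h"] by (simp add: mult.assoc)
    have "B * (norm h)\<^sup>2 / 2 * 1 \<le> B * (norm h)\<^sup>2 / 2 * (1 + norm y)\<^sup>2"
      using B0 by (intro mult_left_mono) (auto simp: power2_eq_square algebra_simps)
    then have 2: "\<bar>- (g (y + h) - g y - dderiv g [h] y)\<bar> \<le> B * (norm h)\<^sup>2 / 2 * (1 + norm y)\<^sup>2"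
      unfolding abs_minus_cancel using tay[of y h] by linarith
    have 3: "\<bar>- g y\<bar> \<le> K * (1 + norm y)\<^sup>2" using K(2)[of y] by simp
    have "\<bar>dderiv g [h] y\<bar> = \<bar>(g (y + h) + - g y) + - (g (y + h) - g y - dderiv g [h] y)\<bar>" by simp
    also have "\<dots> \<le> K * (1 + norm h)\<^sup>2 * (1 + norm y)\<^sup>2 + K * (1 + norm y)\<^sup>2 + B * (norm h)\<^sup>2 / 2 * (1 + norm y)\<^sup>2"
      by (intro order_trans[OF abs_triangle_ineq] add_mono 1 2 3)
    finally show "\<bar>dderiv g [h] y\<bar> \<le> (K * (1 + norm h)\<^sup>2 + K + B * (norm h)\<^sup>2 / 2) * (1 + norm y)\<^sup>2"
      by (simp add: distrib_right)
  qed (use K B0 in auto)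
  have lin: "linear (\<lambda>h. dderiv g [h] y)" for y using dderiv_slot_linear[OF g, of "[]" "[]"] by simp
  have "(smooth g l has_derivative (\<lambda>h. smooth (dderiv g [h]) l y)) (at y)"
    unfolding has_derivative_at
  proof
    show "bounded_linear (\<lambda>h. smooth (dderiv g [h]) l y)"
      unfolding linear_conv_bounded_linear[symmetric] smooth_def
      by (rule linearI) (simp_all add: linear_add[OF lin] linear_scale[OF lin] intd)
    show "(\<lambda>h. norm (smooth g l (y + h) - smooth g l y - smooth (dderiv g [h]) l y) / norm h) \<midarrow>0\<rightarrow> 0"
    proof (rule Lim_null_comparison)
      interpret prob_space "std_gaussian :: (real^'n) measure" by (rule prob_space_std_gaussian)
      have "\<bar>smooth g l (y + h) - smooth g l y - smooth (dderiv g [h]) l y\<bar> \<le> B * (norm h)\<^sup>2 / 2" for h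
      proof -
        have i3: "integrable std_gaussian (\<lambda>z. g ((y + l *\<^sub>R z) + h))"
          using intg[of "y + h"] by (simp add: add.assoc add.commute[of h])
        have "smooth g l (y + h) = (\<integral>z. g ((y + l *\<^sub>R z) + h) \<partial>std_gaussian)"
          by (simp add: smooth_def add.assoc add.commute[of h])
        then have eq: "smooth g l (y + h) - smooth g l y - smooth (dderiv g [h]) l y
          = (\<integral>z. g ((y + l *\<^sub>R z) + h) - g (y + l *\<^sub>R z) - dderiv g [h] (y + l *\<^sub>R z) \<partial>std_gaussian)"
          using i3 intg[of y] intd[of h] by (simp add: smooth_def)
        have "\<bar>\<integral>z. g ((y + l *\<^sub>R z) + h) - g (y + l *\<^sub>R z) - dderiv g [h] (y + l *\<^sub>R z) \<partial>std_gaussian\<bar>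
          \<le> (\<integral>z. \<bar>g ((y + l *\<^sub>R z) + h) - g (y + l *\<^sub>R z) - dderiv g [h] (y + l *\<^sub>R z)\<bar> \<partial>std_gaussian)"
          by (rule integral_abs_bound)
        also have "\<dots> \<le> (\<integral>z. B * (norm h)\<^sup>2 / 2 \<partial>(std_gaussian :: (real^'n) measure))"
        proof (rule integral_mono)
          show "integrable std_gaussian (\<lambda>z. \<bar>g ((y + l *\<^sub>R z) + h) - g (y + l *\<^sub>R z) - dderiv g [h] (y + l *\<^sub>R z)\<bar>)"
            by (rule integrable_abs, rule Bochner_Integration.integrable_diff,
              rule Bochner_Integration.integrable_diff, rule i3, rule intg, rule intd)
          show "\<bar>g ((y + l *\<^sub>R z) + h) - g (y + l *\<^sub>R z) - dderiv g [h] (y + l *\<^sub>R z)\<bar> \<le> B * (norm h)\<^sup>2 / 2" for z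
            by (rule tay)
        qed simp
        also have "\<dots> = B * (norm h)\<^sup>2 / 2" using prob_space by simp
        finally show ?thesis unfolding eq .
      qed
      then show "\<forall>\<^sub>F h in at 0. norm (norm (smooth g l (y + h) - smooth g l y - smooth (dderiv g [h]) l y) / norm h) \<le> B / 2 * norm h"
        unfolding eventually_at by (intro exI[of _ 1]) (auto simp: divide_le_eq power2_eq_square mult.assoc)
      show "((\<lambda>h. B / 2 * norm h) \<longlongrightarrow> 0) (at (0::real^'n))"
        by (auto intro!: tendsto_eq_intros)
    qed
  qed
  from frechet_derivative_at[OF this] show "dderiv (smooth g l) [h] y = smooth (dderiv g [h]) l y"
    by (simp add: dderiv.simps fun_eq_iff)
qed

section \<open>The Hessian of the smoothed function\<close>

locale smooth_fun =
  fixes f :: "real^'n::finite \<Rightarrow> real" and M :: real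
  assumes f: "C_smooth 6 f" and M: "\<And>i y. i \<in> {2..6} \<Longrightarrow> dnorm i f y \<le> M"
begin

lemma dderiv_le: assumes "2 \<le> length hs" "length hs \<le> 6" shows "\<bar>dderiv f hs y\<bar> \<le> M * (\<Prod>h\<leftarrow>hs. norm h)"
proof -
  have "0 \<le> (\<Prod>h\<leftarrow>hs. norm h)" by (induction hs) auto
  then have "dnorm (length hs) f y * (\<Prod>h\<leftarrow>hs. norm h) \<le> M * (\<Prod>h\<leftarrow>hs. norm h)"
    using M[of "length hs" y] assms by (intro mult_right_mono) auto
  with dderiv_le_dnorm[OF f assms(2), of y] show ?thesis by simp
qed

lemma hess_symmetric: "(hess f x *v a) \<bullet> b = a \<bullet> (hess f x *v b)"
  using hess_form[OF f, of b x a] hess_form[OF f, of a x b] dderiv_symmetric[OF f, of "[]" a b x]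
  by (simp add: inner_commute)

lemma C2: "length hs \<le> 4 \<Longrightarrow> C_smooth 2 (dderiv f hs)"
  by (rule C_smooth_dderiv[OF f]) simp

lemma dderiv_smooth2: "dderiv (smooth f l) [a, b] = smooth (dderiv f [a, b]) l"
proof -
  have "dderiv (smooth f l) [b] = smooth (dderiv f [b]) l"
    using dderiv_le[of "[h, h]" for h] C2[of "[]"] by (intro smooth_dderiv[where B=M]) (auto simp: power2_eq_square)
  moreover have "dderiv (smooth (dderiv f [b]) l) [a] = smooth (dderiv (dderiv f [b]) [a]) l"
  proof (rule smooth_dderiv[where B="M * norm b"])
    show "\<bar>dderiv (dderiv f [b]) [h, h] y\<bar> \<le> M * norm b * (norm h)\<^sup>2" for h y
      using dderiv_le[of "[h, h, b]" y] unfolding dderiv_append by (simp add: power2_eq_square mult_ac)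
  qed (simp add: C2)
  moreover have "dderiv (smooth f l) [a, b] = dderiv (dderiv (smooth f l) [b]) [a]"
    "dderiv f [a, b] = dderiv (dderiv f [b]) [a]" by (simp_all add: dderiv_append)
  ultimately show ?thesis by simp
qed

lemma dderiv2_integrable: "integrable std_gaussian (\<lambda>z. dderiv f [a, b] (x + l *\<^sub>R z))"
proof (rule integrable_quadratic_growth)
  have M0: "0 \<le> M * (norm a * norm b)" by (rule order_trans[OF abs_ge_zero dderiv_le[of "[a, b]" 0, simplified]])
  then show "0 \<le> M * (norm a * norm b)" .
  show "\<bar>dderiv f [a, b] y\<bar> \<le> M * (norm a * norm b) * (1 + norm y)\<^sup>2" for y
  proof -
    have "M * (norm a * norm b) * 1 \<le> M * (norm a * norm b) * (1 + norm y)\<^sup>2"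
      using M0 by (intro mult_left_mono) (auto simp: power2_eq_square algebra_simps)
    then show ?thesis using dderiv_le[of "[a, b]" y] by simp
  qed
qed (use dderiv_continuous[OF f, of "[a, b]"] in simp)

lemma hess_smooth_form: "v \<bullet> (hess (smooth f l) x *v w) = smooth (dderiv f [v, w]) l x"
proof -
  have lin1: "linear (\<lambda>k. dderiv f [k, h] x)" for h x using dderiv_slot_linear[OF f, of "[]" "[h]"] by simp
  have lin2: "linear (\<lambda>k. dderiv f [h, k] x)" for h x using dderiv_slot_linear[OF f, of "[h]" "[]"] by simp
  have "dderiv f [v, w] y = (\<Sum>i\<in>UNIV. v $ i * (\<Sum>j\<in>UNIV. w $ j * dderiv f [axis i 1, axis j 1] y))" for y
    using hess_form[OF f, of v y w] by (simp add: inner_vec_def matrix_vector_mult_def hess_def mult.commute)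
  then have "smooth (dderiv f [v, w]) l x = (\<Sum>i\<in>UNIV. v $ i * (\<Sum>j\<in>UNIV. w $ j * smooth (dderiv f [axis i 1, axis j 1]) l x))"
    by (simp add: smooth_def dderiv2_integrable Bochner_Integration.integrable_sum)
  then show ?thesis by (simp add: inner_vec_def matrix_vector_mult_def hess_def dderiv_smooth2 mult.commute)
qed

lemma hess_smooth_symmetric: "(hess (smooth f l) x *v a) \<bullet> b = a \<bullet> (hess (smooth f l) x *v b)"
  using hess_smooth_form[of b l x a] hess_smooth_form[of a l x b] dderiv_symmetric[OF f, of "[]" a b]
  by (simp add: inner_commute smooth_def)

text \<open>Averaging the samples \<open>z\<close> and \<open>- z\<close> cancels the first-order
  term and turns the difference into half the mean of a second difference of \<open>g\<close>.
  Second derivatives of \<open>g\<close> are fourth derivatives of \<open>f\<close>, bounded through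
  \<open>M\<close>, and the mean of \<open>(norm z)\<^sup>2\<close> is the dimension.\<close>

lemma hess_smooth_perturbation:
  "\<bar>v \<bullet> (hess (smooth f l) x *v w - hess f x *v w)\<bar> \<le> M * l\<^sup>2 * real CARD('n) / 2 * norm v * norm w"
proof -
  interpret prob_space "std_gaussian :: (real^'n) measure" by (rule prob_space_std_gaussian)
  define g where "g = dderiv f [v, w]"
  have gm: "(\<lambda>z. g (x + l *\<^sub>R z)) \<in> borel_measurable borel"
    unfolding g_def by (intro borel_measurable_continuous_onI continuous_on_compose2[OF dderiv_continuous[OF f]] continuous_intros) auto
  have ig: "integrable std_gaussian (\<lambda>z. g (x + l *\<^sub>R z))" for l unfolding g_def by (rule dderiv2_integrable)
  have refl: "(\<integral>z. g (x - l *\<^sub>R z) \<partial>std_gaussian) = (\<integral>z. g (x + l *\<^sub>R z) \<partial>std_gaussian)"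
    using std_gaussian_reflect[OF gm] by simp
  have igm: "integrable std_gaussian (\<lambda>z. g (x - l *\<^sub>R z))" using ig[of "- l"] by simp
  have eq: "2 * (smooth g l x - g x) = (\<integral>z. g (x + l *\<^sub>R z) + g (x - l *\<^sub>R z) - 2 * g x \<partial>std_gaussian)"
    using ig igm refl prob_space by (simp add: smooth_def)
  have "\<bar>\<integral>z. g (x + l *\<^sub>R z) + g (x - l *\<^sub>R z) - 2 * g x \<partial>std_gaussian\<bar> \<le> (\<integral>z. \<bar>g (x + l *\<^sub>R z) + g (x - l *\<^sub>R z) - 2 * g x\<bar> \<partial>std_gaussian)" by (rule integral_abs_bound)
  also have "\<dots> \<le> (\<integral>z. (M * l\<^sup>2 * norm v * norm w) * (norm z)\<^sup>2 \<partial>(std_gaussian :: (real^'n) measure))"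
  proof (rule integral_mono)
    show "integrable std_gaussian (\<lambda>z. (M * l\<^sup>2 * norm v * norm w) * (norm (z::real^'n))\<^sup>2)"
      by (intro integrable_mult_right std_gaussian_norm_integrable)
    fix z :: "real^'n"
    have "\<bar>g (x + l *\<^sub>R z) + g (x - l *\<^sub>R z) - 2 * g x\<bar> \<le> M * (norm (l *\<^sub>R z))\<^sup>2 * norm v * norm w"
    proof (rule second_difference_bound)
      show "C_smooth 2 g" unfolding g_def by (rule C2) simp
      show "\<bar>dderiv g [l *\<^sub>R z, l *\<^sub>R z] y\<bar> \<le> M * (norm (l *\<^sub>R z))\<^sup>2 * norm v * norm w" for y
        using dderiv_le[of "[l *\<^sub>R z, l *\<^sub>R z, v, w]" y] unfolding g_def dderiv_append
        by (simp add: power2_eq_square mult_ac)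
    qed
    then show "\<bar>g (x + l *\<^sub>R z) + g (x - l *\<^sub>R z) - 2 * g x\<bar> \<le> M * l\<^sup>2 * norm v * norm w * (norm z)\<^sup>2"
      by (simp add: power_mult_distrib mult_ac)
  qed (use ig igm in auto)
  also have "\<dots> = M * l\<^sup>2 * norm v * norm w * real CARD('n)" by (simp add: std_gaussian_norm2)
  finally have "2 * \<bar>smooth g l x - g x\<bar> \<le> M * l\<^sup>2 * norm v * norm w * real CARD('n)"
    unfolding eq[symmetric] by (simp only: abs_mult abs_numeral)
  then show ?thesis using hess_smooth_form[of v l x w] hess_form[OF f, of v x w]
    by (simp add: g_def inner_diff_right mult_ac)
qed

end

section \<open>Pathwise estimates for a normalized step and the difference estimator\<close>

text \<open>As \<xi> is tangential, normalization divides \<open>a\<close> by exactly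
  \<open>1 + q\<close>, a second-order correction proportional to \<open>a\<close> up to higher
  order. By Cauchy-Schwarz \<open>S\<^sup>2\<close> is at most \<open>a u * X\<^sup>2\<close>; this
  is why the squared increment is small where \<open>a\<close> is small. Of the second-order gain
  only one direction \<open>e\<close> is kept, which suffices for leaving
  \<open>a = 0\<close>.\<close>

lemma normalized_step:
  fixes u \<xi> :: "'a::euclidean_space" and \<alpha> :: real
  assumes En: "onset En" and u: "norm u = 1" "u \<bullet> \<xi> = 0"
    and \<alpha>: "0 < \<alpha>" and X: "norm \<xi> \<le> X"
  defines "a \<equiv> \<lambda>y. \<Sum>e\<in>En. (e \<bullet> y)\<^sup>2"
  defines "S \<equiv> \<Sum>e\<in>En. (e \<bullet> u) * (e \<bullet> \<xi>)" and "u' \<equiv> sgn (u - \<alpha> *\<^sub>R \<xi>)"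
  shows "norm u' = 1" "0 \<le> a u" "a u \<le> 1"
    and "e \<in> En \<Longrightarrow> a u - 2 * \<alpha> * S + \<alpha>\<^sup>2 * (e \<bullet> \<xi>)\<^sup>2 - \<alpha>\<^sup>2 * X\<^sup>2 * a u - 2 * \<alpha> ^ 3 * X ^ 3 - \<alpha> ^ 4 * X ^ 4 \<le> a u'"
    and "(a u' - a u)\<^sup>2 \<le> 12 * \<alpha>\<^sup>2 * X\<^sup>2 * a u + 6 * \<alpha> ^ 4 * X ^ 4"
proof -
  define w where "w = u - \<alpha> *\<^sub>R \<xi>"
  define N where "N = a \<xi>"
  define q where "q = \<alpha>\<^sup>2 * (norm \<xi>)\<^sup>2"
  have fin: "finite En" by (rule onset_finite[OF En])
  have w2: "(norm w)\<^sup>2 = 1 + q"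
    using u unfolding q_def power2_norm_eq_inner w_def
    by (simp add: inner_diff_left inner_diff_right inner_commute[of \<xi> u] norm_eq_1 power2_eq_square)
  have q0: "0 \<le> q" by (simp add: q_def)
  have wpos: "0 < norm w" using w2 q0 by (cases "w = 0") auto
  then show "norm u' = 1" by (simp add: u'_def norm_sgn flip: w_def)
  show a0: "0 \<le> a u" unfolding a_def by (intro sum_nonneg) auto
  show a1: "a u \<le> 1" using onset_bessel[OF En, of u] u by (simp add: a_def)
  have N0: "0 \<le> N" unfolding N_def a_def by (intro sum_nonneg) auto
  have NX: "N \<le> (norm \<xi>)\<^sup>2" using onset_bessel[OF En, of \<xi>] by (simp add: a_def N_def)
  have X0: "0 \<le> X" by (rule order_trans[OF norm_ge_zero X])
  have X2: "(norm \<xi>)\<^sup>2 \<le> X\<^sup>2" using X by (intro power_mono) auto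
  have S2: "S\<^sup>2 \<le> a u * X\<^sup>2"
  proof -
    have "S\<^sup>2 \<le> (\<Sum>e\<in>En. (e \<bullet> u)\<^sup>2) * (\<Sum>e\<in>En. (e \<bullet> \<xi>)\<^sup>2)"
      unfolding S_def by (rule Cauchy_Schwarz_ineq_sum)
    also have "\<dots> \<le> a u * X\<^sup>2"
      using NX X2 N0 a0 unfolding N_def a_def by (intro mult_left_mono) auto
    finally show ?thesis .
  qed
  have S1: "\<bar>S\<bar> \<le> X"
  proof -
    have "a u * X\<^sup>2 \<le> 1 * X\<^sup>2" using a1 by (intro mult_right_mono) auto
    then have "\<bar>S\<bar>\<^sup>2 \<le> X\<^sup>2" using S2 by simp
    then show ?thesis by (rule power2_le_imp_le[OF _ X0])
  qed
  have aw: "a w = a u - 2 * \<alpha> * S + \<alpha>\<^sup>2 * N"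
    by (simp add: a_def S_def N_def w_def inner_diff_right power2_diff sum.distrib sum_subtractf sum_distrib_left power_mult_distrib mult_ac)
  have aw0: "0 \<le> a w" unfolding a_def by (intro sum_nonneg) auto
  have au': "a u' = a w / (1 + q)"
  proof -
    have "a u' = (\<Sum>e\<in>En. (e \<bullet> w)\<^sup>2 / (norm w)\<^sup>2)"
      unfolding a_def u'_def w_def[symmetric] sgn_div_norm
      by (intro sum.cong refl) (simp add: power_mult_distrib power_divide power_inverse divide_inverse)
    then show ?thesis by (simp add: a_def w2 sum_divide_distrib)
  qed
  have qX: "q \<le> \<alpha>\<^sup>2 * X\<^sup>2" unfolding q_def using X2 by (intro mult_left_mono) auto
  have lower: "a w - q * a w \<le> a u'"
  proof -
    have "(a w - q * a w) * (1 + q) = a w - q\<^sup>2 * a w" by (simp add: algebra_simps power2_eq_square)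
    also have "\<dots> \<le> a w" using aw0 by simp
    finally show ?thesis unfolding au' using q0 by (simp add: le_divide_eq)
  qed
  have aw_le: "a w \<le> a u + 2 * \<alpha> * X + \<alpha>\<^sup>2 * X\<^sup>2"
  proof -
    have "2 * \<alpha> * (- S) \<le> 2 * \<alpha> * X" using S1 \<alpha> by (intro mult_left_mono) auto
    moreover have "\<alpha>\<^sup>2 * N \<le> \<alpha>\<^sup>2 * X\<^sup>2" using NX X2 by (intro mult_left_mono) auto
    ultimately show ?thesis unfolding aw by linarith
  qed
  have qaw: "q * a w \<le> \<alpha>\<^sup>2 * X\<^sup>2 * (a u + 2 * \<alpha> * X + \<alpha>\<^sup>2 * X\<^sup>2)"
    using qX aw_le q0 aw0 by (intro mult_mono) auto
  show "a u - 2 * \<alpha> * S + \<alpha>\<^sup>2 * (e \<bullet> \<xi>)\<^sup>2 - \<alpha>\<^sup>2 * X\<^sup>2 * a u - 2 * \<alpha> ^ 3 * X ^ 3 - \<alpha> ^ 4 * X ^ 4 \<le> a u'" if "e \<in> En"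
  proof -
    have "(e \<bullet> \<xi>)\<^sup>2 \<le> N" unfolding N_def a_def by (rule member_le_sum[OF that]) (auto simp: fin)
    then have "\<alpha>\<^sup>2 * (e \<bullet> \<xi>)\<^sup>2 \<le> \<alpha>\<^sup>2 * N" by (intro mult_left_mono) auto
    moreover have "\<alpha>\<^sup>2 * X\<^sup>2 * (a u + 2 * \<alpha> * X + \<alpha>\<^sup>2 * X\<^sup>2) = \<alpha>\<^sup>2 * X\<^sup>2 * a u + 2 * \<alpha> ^ 3 * X ^ 3 + \<alpha> ^ 4 * X ^ 4"
      by (simp add: distrib_left power2_eq_square power3_eq_cube power4_eq_xxxx mult_ac)
    ultimately show ?thesis using lower qaw unfolding aw by linarith
  qed
  have d: "a u' - a u = (- q * a u - 2 * \<alpha> * S + \<alpha>\<^sup>2 * N) / (1 + q)"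
    unfolding au' aw using q0 by (simp add: field_simps)
  have "(a u' - a u)\<^sup>2 \<le> (- q * a u - 2 * \<alpha> * S + \<alpha>\<^sup>2 * N)\<^sup>2"
  proof -
    have "1 \<le> (1 + q)\<^sup>2" "1 + q \<noteq> 0" using q0 by auto
    then show ?thesis unfolding d power_divide
      using divide_left_mono[of 1 "(1 + q)\<^sup>2" "(- q * a u - 2 * \<alpha> * S + \<alpha>\<^sup>2 * N)\<^sup>2"] by simp
  qed
  also have "\<dots> \<le> 3 * ((q * a u)\<^sup>2 + (2 * \<alpha> * S)\<^sup>2 + (\<alpha>\<^sup>2 * N)\<^sup>2)"
  proof -
    have "(- p - r + t)\<^sup>2 \<le> 3 * (p\<^sup>2 + r\<^sup>2 + t\<^sup>2)" for p r t :: real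
    proof -
      have "3 * (p\<^sup>2 + r\<^sup>2 + t\<^sup>2) - (- p - r + t)\<^sup>2 = (p - r)\<^sup>2 + (p + t)\<^sup>2 + (r + t)\<^sup>2"
        by (simp add: power2_eq_square algebra_simps)
      then show ?thesis by (metis diff_ge_0_iff_ge add_nonneg_nonneg zero_le_power2)
    qed
    from this[of "q * a u" "2 * \<alpha> * S" "\<alpha>\<^sup>2 * N"] show ?thesis by simp
  qed
  also have "\<dots> \<le> 3 * (\<alpha> ^ 4 * X ^ 4 + 4 * \<alpha>\<^sup>2 * (a u * X\<^sup>2) + \<alpha> ^ 4 * X ^ 4)"
  proof (intro mult_left_mono add_mono)
    have sq: "(\<alpha>\<^sup>2 * X\<^sup>2)\<^sup>2 = \<alpha> ^ 4 * X ^ 4" by (simp add: power_mult_distrib flip: power_mult)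
    have "q * a u \<le> \<alpha>\<^sup>2 * X\<^sup>2 * 1" using qX a0 a1 q0 by (intro mult_mono) auto
    then have "(q * a u)\<^sup>2 \<le> (\<alpha>\<^sup>2 * X\<^sup>2)\<^sup>2" using q0 a0 by (intro power_mono) auto
    then show "(q * a u)\<^sup>2 \<le> \<alpha> ^ 4 * X ^ 4" unfolding sq .
    have "\<alpha>\<^sup>2 * N \<le> \<alpha>\<^sup>2 * X\<^sup>2" using NX X2 by (intro mult_left_mono) auto
    then have "(\<alpha>\<^sup>2 * N)\<^sup>2 \<le> (\<alpha>\<^sup>2 * X\<^sup>2)\<^sup>2" using N0 by (intro power_mono) auto
    then show "(\<alpha>\<^sup>2 * N)\<^sup>2 \<le> \<alpha> ^ 4 * X ^ 4" unfolding sq .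
    show "(2 * \<alpha> * S)\<^sup>2 \<le> 4 * \<alpha>\<^sup>2 * (a u * X\<^sup>2)"
      using mult_left_mono[OF S2, of "4 * \<alpha>\<^sup>2"] by (simp add: power_mult_distrib)
  qed simp
  finally show "(a u' - a u)\<^sup>2 \<le> 12 * \<alpha>\<^sup>2 * X\<^sup>2 * a u + 6 * \<alpha> ^ 4 * X ^ 4" by (simp add: algebra_simps)
qed

context smooth_fun
begin

definition H_coeff :: "real^'n \<Rightarrow> real^'n \<Rightarrow> real^'n \<Rightarrow> real \<Rightarrow> real" where
  "H_coeff x u z l = (f (x + l *\<^sub>R u + l *\<^sub>R z) - f (x + l *\<^sub>R u - l *\<^sub>R z)
     - (f (x - l *\<^sub>R u + l *\<^sub>R z) - f (x - l *\<^sub>R u - l *\<^sub>R z))) / (2 * l) / (2 * l)"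

lemma H_est_eq: "H_est f u x z l = H_coeff x u z l *\<^sub>R z"
  unfolding H_est_def F_est_def H_coeff_def scaleR_diff_left[symmetric] scaleR_scaleR diff_divide_distrib[symmetric]
  by (simp only: divide_inverse mult.commute)

lemma hess_norm_le: "norm (hess f x *v u) \<le> M * norm u"
proof (cases "hess f x *v u = 0")
  case True
  \<comment> \<open>Any unit vector shows that \<open>M\<close> is nonnegative;
    \<open>undefined\<close> just names some index.\<close>
  have "0 \<le> M * norm (axis undefined 1 :: real^'n)"
    using dderiv_le[of "[axis undefined 1, axis undefined 1]" x] by simp
  then show ?thesis using True by simp
next
  case False
  have "norm (hess f x *v u) * norm (hess f x *v u) = dderiv f [hess f x *v u, u] x"
    using hess_form[OF f, of "hess f x *v u" x u] by (simp add: power2_norm_eq_inner flip: power2_eq_square)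
  also have "\<dots> \<le> norm (hess f x *v u) * (M * norm u)"
    using dderiv_le[of "[hess f x *v u, u]" x] by (simp add: mult_ac)
  finally show ?thesis using False by simp
qed

lemma M_nonneg: "0 \<le> M"
  using order_trans[OF norm_ge_zero hess_norm_le[of 0 "axis undefined 1 :: real^'n"]] by simp

text \<open>The four-point difference is the symmetric second difference in direction
  \<open>u + z\<close> minus the one in direction \<open>u - z\<close>. Polarization of the Hessian
  form leaves the mixed term, and the remainders of \<open>even_taylor4\<close> are of order
  \<open>l\<^sup>4\<close> before the division by \<open>4 * l\<^sup>2\<close>. Both directions have
  norm at most \<open>1 + norm z\<close>.\<close>

lemma H_coeff_expand:
  assumes u: "norm u = 1" and l: "0 < l"
  shows "\<bar>H_coeff x u z l - z \<bullet> (hess f x *v u)\<bar> \<le> M * l\<^sup>2 * (1 + norm z) ^ 4"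
proof -
  have T: "\<bar>f (x + l *\<^sub>R p) + f (x - l *\<^sub>R p) - 2 * f x - l\<^sup>2 * dderiv f [p, p] x\<bar> \<le> M * l ^ 4 * (1 + norm z) ^ 4 / 12"
    if p: "norm p \<le> 1 + norm z" for p
  proof -
    have lin1: "linear (\<lambda>k. dderiv f [k, h] x)" for h using dderiv_slot_linear[OF f, of "[]" "[h]"] by simp
    have lin2: "linear (\<lambda>k. dderiv f [h, k] x)" for h using dderiv_slot_linear[OF f, of "[h]" "[]"] by simp
    have sc: "dderiv f [l *\<^sub>R p, l *\<^sub>R p] x = l\<^sup>2 * dderiv f [p, p] x"
      using linear_scale[OF lin1, of l p] linear_scale[OF lin2, of _ l p] by (simp add: power2_eq_square)
    have "C_smooth 4 f" using C_smooth_dderiv[OF f, of "[]" 4] by simp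
    moreover have "\<bar>dderiv f [l *\<^sub>R p, l *\<^sub>R p, l *\<^sub>R p, l *\<^sub>R p] y\<bar> \<le> M * l ^ 4 * (1 + norm z) ^ 4" for y
    proof -
      have "\<bar>dderiv f [l *\<^sub>R p, l *\<^sub>R p, l *\<^sub>R p, l *\<^sub>R p] y\<bar> \<le> M * (l * norm p) ^ 4"
        using dderiv_le[of "[l *\<^sub>R p, l *\<^sub>R p, l *\<^sub>R p, l *\<^sub>R p]" y] l by (simp add: power4_eq_xxxx mult_ac)
      also have "\<dots> \<le> M * (l * (1 + norm z)) ^ 4"
        using p l M_nonneg by (intro mult_left_mono power_mono) auto
      finally show ?thesis by (simp add: power_mult_distrib mult_ac)
    qed
    ultimately show ?thesis unfolding sc[symmetric] by (rule even_taylor4)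
  qed
  define R where "R p = f (x + l *\<^sub>R p) + f (x - l *\<^sub>R p) - 2 * f x - l\<^sup>2 * dderiv f [p, p] x" for p
  have polar: "dderiv f [u + z, u + z] x - dderiv f [u - z, u - z] x = 4 * (z \<bullet> (hess f x *v u))"
    using hess_symmetric[of x u z] hess_form[OF f, of "u + z" x "u + z"] hess_form[OF f, of "u - z" x "u - z"]
    by (simp add: matrix_vector_right_distrib matrix_vector_mult_diff_distrib inner_add_left inner_diff_left
        inner_add_right inner_diff_right inner_commute)
  have "H_coeff x u z l = ((f (x + l *\<^sub>R (u + z)) + f (x - l *\<^sub>R (u + z))) - (f (x + l *\<^sub>R (u - z)) + f (x - l *\<^sub>R (u - z)))) / (4 * l\<^sup>2)"
    using l by (simp add: H_coeff_def scaleR_add_right scaleR_diff_right algebra_simps power2_eq_square diff_divide_distrib add_divide_distrib)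
  also have "\<dots> = z \<bullet> (hess f x *v u) + (R (u + z) - R (u - z)) / (4 * l\<^sup>2)"
  proof -
    have "(f (x + l *\<^sub>R (u + z)) + f (x - l *\<^sub>R (u + z))) - (f (x + l *\<^sub>R (u - z)) + f (x - l *\<^sub>R (u - z)))
      = l\<^sup>2 * (4 * (z \<bullet> (hess f x *v u))) + (R (u + z) - R (u - z))"
      unfolding polar[symmetric] R_def by (simp add: right_diff_distrib)
    then show ?thesis using l by (simp add: add_divide_distrib)
  qed
  finally have "\<bar>H_coeff x u z l - z \<bullet> (hess f x *v u)\<bar> = \<bar>R (u + z) - R (u - z)\<bar> / (4 * l\<^sup>2)"
    using l by (simp add: abs_divide)
  also have "\<dots> \<le> (M * l ^ 4 * (1 + norm z) ^ 4 / 12 + M * l ^ 4 * (1 + norm z) ^ 4 / 12) / (4 * l\<^sup>2)"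
  proof (intro divide_right_mono order_trans[OF abs_triangle_ineq4] add_mono)
    have "norm (u + z) \<le> 1 + norm z" "norm (u - z) \<le> 1 + norm z"
      using norm_triangle_ineq[of u z] norm_triangle_ineq4[of u z] u by auto
    from T[OF this(1)] T[OF this(2)]
    show "\<bar>R (u + z)\<bar> \<le> M * l ^ 4 * (1 + norm z) ^ 4 / 12" "\<bar>R (u - z)\<bar> \<le> M * l ^ 4 * (1 + norm z) ^ 4 / 12"
      unfolding R_def .
  qed simp
  also have "\<dots> = M * l\<^sup>2 * (1 + norm z) ^ 4 / 24" using l by (simp add: power2_eq_square power4_eq_xxxx)
  also have "\<dots> \<le> M * l\<^sup>2 * (1 + norm z) ^ 4" using M_nonneg by simp
  finally show ?thesis .
qed

lemma continuous_f: "continuous_on UNIV f"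
  using dderiv_continuous[OF f, of "[]"] by simp

lemma borel_measurable_H_coeff [measurable]:
  assumes [measurable]: "u \<in> borel_measurable N" "z \<in> borel_measurable N"
  shows "(\<lambda>\<omega>. H_coeff x (u \<omega>) (z \<omega>) l) \<in> borel_measurable N"
proof -
  have [measurable]: "f \<in> borel_measurable borel" by (rule borel_measurable_continuous_onI[OF continuous_f])
  show ?thesis unfolding H_coeff_def by measurable
qed

end

lemma borel_measurable_matrix_vector_mult [measurable]:
  fixes G :: "'w \<Rightarrow> real^'n::finite^'m::finite"
  assumes [measurable]: "G \<in> borel_measurable N" "y \<in> borel_measurable N"
  shows "(\<lambda>\<omega>. G \<omega> *v y \<omega>) \<in> borel_measurable N"
proof -
  have nth: "(\<lambda>v. v $ i) \<in> borel_measurable borel" for i :: "'k::finite" and v :: "'c::real_normed_vector ^ 'k"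
    by (intro borel_measurable_continuous_onI continuous_intros)
  have [measurable]: "(\<lambda>\<omega>. G \<omega> $ i) \<in> borel_measurable N" for i
    using measurable_compose[OF assms(1) nth] .
  have [measurable]: "(\<lambda>\<omega>. G \<omega> $ i $ j) \<in> borel_measurable N" for i j
    using measurable_compose[OF _ nth, of "\<lambda>\<omega>. G \<omega> $ i"] by simp
  have [measurable]: "(\<lambda>\<omega>. y \<omega> $ j) \<in> borel_measurable N" for j
    using measurable_compose[OF assms(2) nth] .
  show ?thesis
  proof (rule borel_measurable_euclidean_space[THEN iffD2], rule ballI)
    fix b :: "real^'m" assume "b \<in> Basis"
    then obtain i where b: "b = axis i 1" by (auto simp: Basis_vec_def)
    have "(\<lambda>\<omega>. (G \<omega> *v y \<omega>) \<bullet> b) = (\<lambda>\<omega>. \<Sum>j\<in>UNIV. G \<omega> $ i $ j * y \<omega> $ j)"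
      by (simp add: b inner_axis matrix_vector_mult_def)
    then show "(\<lambda>\<omega>. (G \<omega> *v y \<omega>) \<bullet> b) \<in> borel_measurable N" by simp
  qed
qed

section \<open>One step of the search\<close>

text \<open>\<open>hess_lower\<close> keeps all Hessian eigenvalues at distance \<mu> from zero. So
  \<open>hess f x *v u\<close> never vanishes on the sphere and the sampling noise degenerates at no
  iterate, in particular at no eigenvector.\<close>

locale search_params = smooth_fun f M for f :: "real^'n::finite \<Rightarrow> real" and M +
  fixes x :: "real^'n" and \<mu> :: real and \<alpha> l :: "nat \<Rightarrow> real" and L :: real
  assumes \<mu>: "0 < \<mu>" and hess_lower: "\<mu> * norm u \<le> norm (hess f x *v u)"
    and \<alpha>: "0 < \<alpha> n" and l: "0 < l n" "l n \<le> L * sqrt (\<alpha> n)" and L: "0 < L"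
begin

definition search_step :: "real^'n^'n \<Rightarrow> nat \<Rightarrow> real^'n \<Rightarrow> real^'n \<Rightarrow> real^'n" where
  "search_step G n u z = sgn (u - \<alpha> n *\<^sub>R ((mat 1 - outer u u - G) *v H_est f u x z (l n)))"

text \<open>The constants of one step: \<open>c1\<close> bounds the scalar factor of the estimator
  against \<open>(1 + norm z) ^ 4\<close>, \<open>X\<close> collects the bias, and \<open>C\<close>
  dominates both the errors proportional to \<open>a\<close> in the mean and the two parts of the
  variance. The moments 10, 15 and 20 belong to the powers 2, 3 and 4 of a step bounded by
  \<open>c1 * (1 + norm z) ^ 5\<close>.\<close>

definition K :: "nat \<Rightarrow> real" where "K m = (\<integral>z. (1 + norm (z :: real^'n)) ^ m \<partial>std_gaussian)"
definition c1 :: real where "c1 = M * (1 + L\<^sup>2)"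
definition X :: real where "X = M * L\<^sup>2 * K 5"
definition C :: real where
  "C = max (\<mu>\<^sup>2 / 2 + 8 * X\<^sup>2 / \<mu>\<^sup>2 + c1\<^sup>2 * K 10) (max (12 * c1\<^sup>2 * K 10) (6 * c1 ^ 4 * K 20))"

text \<open>From this time on, the contributions to the mean of higher order than
  \<open>\<alpha>\<^sup>2\<close> use up at most \<open>\<mu>\<^sup>2 / 8\<close> of the noise
  gain.\<close>

definition small_from :: "nat \<Rightarrow> bool" where
  "small_from n\<^sub>0 \<longleftrightarrow> (\<forall>n\<ge>n\<^sub>0. \<alpha> n \<le> 1 \<and>
     (\<alpha> n)\<^sup>2 * (M\<^sup>2 * L ^ 4 * K 10) + 2 * \<alpha> n * (c1 ^ 3 * K 15) + (\<alpha> n)\<^sup>2 * (c1 ^ 4 * K 20) \<le> \<mu>\<^sup>2 / 8)"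

lemma K_nonneg: "0 \<le> K m"
  unfolding K_def by (intro Bochner_Integration.integral_nonneg) auto

lemma small_from_exists:
  assumes "summable (\<lambda>n. (\<alpha> n)\<^sup>2)"
  shows "\<exists>n\<^sub>0. small_from n\<^sub>0"
proof -
  have "(\<lambda>n. (\<alpha> n)\<^sup>2) \<longlonglongrightarrow> 0" by (rule summable_LIMSEQ_zero[OF assms])
  then have "(\<lambda>n. sqrt ((\<alpha> n)\<^sup>2)) \<longlonglongrightarrow> sqrt 0" by (rule tendsto_real_sqrt)
  then have a: "\<alpha> \<longlonglongrightarrow> 0" using \<alpha> by (simp add: less_imp_le)
  have "(\<lambda>n. (\<alpha> n)\<^sup>2 * (M\<^sup>2 * L ^ 4 * K 10) + 2 * \<alpha> n * (c1 ^ 3 * K 15) + (\<alpha> n)\<^sup>2 * (c1 ^ 4 * K 20)) \<longlonglongrightarrow>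
     0\<^sup>2 * (M\<^sup>2 * L ^ 4 * K 10) + 2 * 0 * (c1 ^ 3 * K 15) + 0\<^sup>2 * (c1 ^ 4 * K 20)"
    by (intro tendsto_intros a)
  then have "\<forall>\<^sub>F n in sequentially. (\<alpha> n)\<^sup>2 * (M\<^sup>2 * L ^ 4 * K 10) + 2 * \<alpha> n * (c1 ^ 3 * K 15) + (\<alpha> n)\<^sup>2 * (c1 ^ 4 * K 20) < \<mu>\<^sup>2 / 8"
    using \<mu> by (intro order_tendstoD(2)) auto
  moreover have "\<forall>\<^sub>F n in sequentially. \<alpha> n < 1" using a by (intro order_tendstoD(2)) auto
  ultimately have "\<forall>\<^sub>F n in sequentially. \<alpha> n \<le> 1 \<and>
     (\<alpha> n)\<^sup>2 * (M\<^sup>2 * L ^ 4 * K 10) + 2 * \<alpha> n * (c1 ^ 3 * K 15) + (\<alpha> n)\<^sup>2 * (c1 ^ 4 * K 20) \<le> \<mu>\<^sup>2 / 8"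
    by eventually_elim auto
  then show ?thesis by (simp add: small_from_def eventually_sequentially)
qed

lemma search_step_eq:
  "search_step G n u z = sgn (u - \<alpha> n *\<^sub>R (H_coeff x u z (l n) *\<^sub>R (z - (u \<bullet> z) *\<^sub>R u - G *v z)))"
  by (simp add: search_step_def H_est_eq matrix_vector_mult_scaleR matrix_vector_mult_diff_rdistrib outer_mult)

lemma search_step_measurable [measurable]:
  assumes [measurable]: "G \<in> borel_measurable N" "u \<in> borel_measurable N" "z \<in> borel_measurable N"
  shows "(\<lambda>\<omega>. search_step (G \<omega>) n (u \<omega>) (z \<omega>)) \<in> borel_measurable N"
  unfolding search_step_eq sgn_div_norm by measurable

lemma search_step_in:
  assumes ws: "onset (set ws)" "distinct ws" and u: "norm u = 1" "\<forall>w\<in>set ws. w \<bullet> u = 0"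
  shows "norm (search_step (gram ws) n u z) = 1" "\<forall>w\<in>set ws. w \<bullet> search_step (gram ws) n u z = 0"
proof -
  note P = onset_projection[OF ws]
  define \<xi> where "\<xi> = H_coeff x u z (l n) *\<^sub>R (z - (u \<bullet> z) *\<^sub>R u - gram ws *v z)"
  have step: "search_step (gram ws) n u z = sgn (u - \<alpha> n *\<^sub>R \<xi>)" by (simp add: search_step_eq \<xi>_def)
  have "u \<bullet> (gram ws *v z) = 0" using P(2)[of u z] P(4)[of u] u by simp
  then have "u \<bullet> \<xi> = 0" using u by (simp add: \<xi>_def inner_diff_right norm_eq_1)
  then show "norm (search_step (gram ws) n u z) = 1"
    unfolding step by (intro normalized_step(1)[of "{}" u \<xi> "\<alpha> n" "norm \<xi>"]) (auto simp: onset_def u \<alpha>)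
  show "\<forall>w\<in>set ws. w \<bullet> search_step (gram ws) n u z = 0"
  proof
    fix w assume w: "w \<in> set ws"
    have "gram ws *v w = w" using w P(3) by (simp add: span_base)
    then have "w \<bullet> (gram ws *v z) = w \<bullet> z" using P(2)[of w z] by simp
    then show "w \<bullet> search_step (gram ws) n u z = 0"
      using u w by (simp add: step \<xi>_def sgn_div_norm inner_diff_right)
  qed
qed

text \<open>Origin of the constants: \<open>2 * \<mu>\<close> is the factor 2 of the first-order
  term of \<open>a\<close> times the drift bound, in which gaps \<open>\<mu> / 2\<close> below and
  above zero add up. The noise contributes \<open>\<mu>\<^sup>2 / 2\<close>; one share of
  \<open>\<mu>\<^sup>2 / 8\<close> pays for the bias and another for the higher-order terms, leaving
  \<open>\<mu>\<^sup>2 / 4\<close>. A single negative direction \<open>e\<^sub>0\<close> serves as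
  the way out.\<close>

lemma gap_chain_search:
  assumes ws: "onset (set ws)" "distinct ws"
    and E: "onset E" "span E = {y. \<forall>w\<in>set ws. w \<bullet> y = 0}"
    and ev: "\<And>e y. e \<in> E \<Longrightarrow> (\<forall>w\<in>set ws. w \<bullet> y = 0) \<Longrightarrow> e \<bullet> (hess f x *v y) = \<theta> e * (e \<bullet> y)"
    and gap: "\<And>e. e \<in> E \<Longrightarrow> \<mu> / 2 \<le> \<bar>\<theta> e\<bar>" and e0: "e\<^sub>0 \<in> E" "\<theta> e\<^sub>0 < 0"
    and small: "small_from n\<^sub>0"
  shows "gap_chain std_gaussian (search_step (gram ws)) {u. norm u = 1 \<and> (\<forall>w\<in>set ws. w \<bullet> u = 0)}
    (\<lambda>u. \<Sum>e\<in>{e\<in>E. \<theta> e < 0}. (e \<bullet> u)\<^sup>2) \<alpha> (2 * \<mu>) (\<mu>\<^sup>2 / 4) C n\<^sub>0"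
proof -
  interpret \<gamma>: prob_space "std_gaussian :: (real^'n) measure" by (rule prob_space_std_gaussian)
  define En where "En = {e\<in>E. \<theta> e < 0}"
  define a where "a = (\<lambda>u. \<Sum>e\<in>En. (e \<bullet> u)\<^sup>2)"
  define G where "G = gram ws"
  define S where "S = {u. norm u = 1 \<and> (\<forall>w\<in>set ws. w \<bullet> u = 0)}"
  note P = onset_projection[OF ws, folded G_def]
  have onEn: "onset En" by (rule onset_subset[OF E(1)]) (auto simp: En_def)
  have e0n: "e\<^sub>0 \<in> En" using e0 by (simp add: En_def)
  have EW: "\<forall>w\<in>set ws. w \<bullet> e = 0" if "e \<in> E" for e using span_base[OF that] E(2) by auto
  have GE: "G *v e = 0" if "e \<in> E" for e using EW[OF that] P(4) by blast
  have a_sum: "(\<Sum>e\<in>En. (e \<bullet> y)\<^sup>2) = a y" for y by (simp add: a_def)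
  have a_meas: "a \<in> borel_measurable borel" unfolding a_def by measurable
  define \<xi> where "\<xi> n u z = H_coeff x u z (l n) *\<^sub>R (z - (u \<bullet> z) *\<^sub>R u - G *v z)" for n u z
  have step: "search_step G n u z = sgn (u - \<alpha> n *\<^sub>R \<xi> n u z)" for n u z by (simp add: search_step_eq \<xi>_def)
  have Gu: "G *v u = 0" if "u \<in> S" for u using that P(4) by (simp add: S_def)
  have u\<xi>: "u \<bullet> \<xi> n u z = 0" if u: "u \<in> S" for n u z
  proof -
    have "u \<bullet> (G *v z) = 0" using P(2)[of u z] Gu[OF u] by simp
    then show ?thesis using u by (simp add: \<xi>_def inner_diff_right S_def norm_eq_1)
  qed
  have step_in: "search_step G n u z \<in> S" if "u \<in> S" for n u z
    using search_step_in[OF ws] that by (simp add: S_def G_def)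
  interpret ms: markov_steps std_gaussian "search_step G" S
  proof unfold_locales
    show "(\<lambda>p. search_step G n (fst p) (snd p)) \<in> borel \<Otimes>\<^sub>M std_gaussian \<rightarrow>\<^sub>M borel" for n by measurable
  qed (rule step_in)
  show ?thesis
    unfolding En_def[symmetric] a_def[symmetric] G_def[symmetric] S_def[symmetric]
  proof unfold_locales
    show "a \<in> borel_measurable borel" by (rule a_meas)
    show "0 \<le> a u" for u by (simp add: a_def sum_nonneg)
    then show "0 \<le> a u \<and> a u \<le> 1" if "u \<in> S" for u
      using onset_bessel[OF onEn, of u] that by (simp add: a_def S_def)
    show "0 < \<mu>\<^sup>2 / 4" "0 < 2 * \<mu>" "0 < \<alpha> n" for n using \<mu> \<alpha> by auto
    have "0 \<le> 12 * c1\<^sup>2 * K 10" using K_nonneg by simp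
    then show "0 \<le> C" by (simp add: C_def)
  next
    fix u n assume u: "u \<in> S" and n: "n\<^sub>0 \<le> n"
    define \<beta> where "\<beta> = \<alpha> n"
    define A where "A = hess f x"
    define \<zeta> where "\<zeta> z = H_coeff x u z (l n)" for z
    define err where "err z = \<zeta> z - z \<bullet> (A *v u)" for z
    \<comment> \<open>A bound for the random step that depends on the sample only; its powers
      integrate to the moments \<open>K\<close>.\<close>
    define Y where "Y z = c1 * (1 + norm z) ^ 5" for z :: "real^'n"
    have nu: "norm u = 1" and uu: "u \<bullet> u = 1" using u by (simp_all add: S_def norm_eq_1)
    have \<beta>: "0 < \<beta>" "\<beta> \<le> 1" using \<alpha> small n by (auto simp: \<beta>_def small_from_def)
    have smallb: "\<beta>\<^sup>2 * (M\<^sup>2 * L ^ 4 * K 10) + 2 * \<beta> * (c1 ^ 3 * K 15) + \<beta>\<^sup>2 * (c1 ^ 4 * K 20) \<le> \<mu>\<^sup>2 / 8"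
      using small n by (auto simp: \<beta>_def small_from_def)
    \<comment> \<open>Makes the bias \<open>err\<close> of order \<alpha>, so that after
      multiplication by the step size it competes with the noise gain at the same order.\<close>
    have l2: "(l n)\<^sup>2 \<le> L\<^sup>2 * \<beta>"
    proof -
      have "(l n)\<^sup>2 \<le> (L * sqrt (\<alpha> n))\<^sup>2" using l[of n] by (intro power_mono) auto
      then show ?thesis using \<alpha>[of n] by (simp add: power_mult_distrib \<beta>_def)
    qed
    have M0: "0 \<le> M" by (rule M_nonneg)
    have err1: "\<bar>err z\<bar> \<le> M * (l n)\<^sup>2 * (1 + norm z) ^ 4" for z
      unfolding err_def \<zeta>_def A_def by (rule H_coeff_expand[OF nu l(1)])
    have err2: "\<bar>err z\<bar> \<le> (M * L\<^sup>2 * \<beta>) * (1 + norm z) ^ 4" for z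
    proof -
      have "M * (l n)\<^sup>2 * (1 + norm z) ^ 4 \<le> M * (L\<^sup>2 * \<beta>) * (1 + norm z) ^ 4"
        using l2 M0 by (intro mult_right_mono mult_left_mono) auto
      then show ?thesis using err1[of z] by (simp add: mult.assoc)
    qed
    have z1: "norm z \<le> (1 + norm z) ^ 4" "norm z \<le> 1 + norm z" for z :: "real^'n"
    proof -
      have "(1 + norm z) ^ 1 \<le> (1 + norm z) ^ 4" by (rule power_increasing) auto
      then show "norm z \<le> (1 + norm z) ^ 4" by simp
    qed simp
    have Au: "norm (A *v u) \<le> M" using hess_norm_le[of x u] nu by (simp add: A_def)
    have zAu: "\<bar>z \<bullet> (A *v u)\<bar> \<le> M * norm z" for z
    proof -
      have "\<bar>z \<bullet> (A *v u)\<bar> \<le> norm z * norm (A *v u)" by (rule Cauchy_Schwarz_ineq2)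
      also have "\<dots> \<le> norm z * M" using Au by (intro mult_left_mono) auto
      finally show ?thesis by (simp add: mult.commute)
    qed
    have \<zeta>_bound: "\<bar>\<zeta> z\<bar> \<le> c1 * (1 + norm z) ^ 4" for z
    proof -
      have "\<bar>\<zeta> z\<bar> \<le> \<bar>z \<bullet> (A *v u)\<bar> + \<bar>err z\<bar>" by (simp add: err_def)
      also have "\<dots> \<le> M * (1 + norm z) ^ 4 + (M * L\<^sup>2 * 1) * (1 + norm z) ^ 4"
      proof (intro add_mono)
        show "\<bar>z \<bullet> (A *v u)\<bar> \<le> M * (1 + norm z) ^ 4"
          using mult_left_mono[OF z1(1)[of z] M0] zAu[of z] by linarith
        have "M * L\<^sup>2 * \<beta> * (1 + norm z) ^ 4 \<le> M * L\<^sup>2 * 1 * (1 + norm z) ^ 4"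
          using \<beta> M0 by (intro mult_right_mono mult_left_mono) auto
        then show "\<bar>err z\<bar> \<le> (M * L\<^sup>2 * 1) * (1 + norm z) ^ 4" using err2[of z] by linarith
      qed
      also have "\<dots> = c1 * (1 + norm z) ^ 4" by (simp add: c1_def algebra_simps)
      finally show ?thesis .
    qed
    have c10: "0 \<le> c1" using M0 by (simp add: c1_def)
    have Y: "norm (\<xi> n u z) \<le> Y z" for z
    proof -
      define p where "p = z - (u \<bullet> z) *\<^sub>R u - G *v z"
      have "p \<bullet> u = 0"
        using P(2)[of z u] Gu[OF u] uu by (simp add: p_def inner_diff_left inner_diff_right inner_commute)
      moreover have "p \<bullet> (G *v z) = 0"
        unfolding P(2)[symmetric] by (simp add: p_def matrix_vector_mult_diff_distrib matrix_vector_mult_scaleR P(1) Gu[OF u])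
      ultimately have "p \<bullet> p = p \<bullet> z" by (subst (2) p_def) (simp add: inner_diff_right)
      then have "norm p * norm p \<le> norm p * norm z"
        using norm_cauchy_schwarz[of p z] by (simp add: power2_norm_eq_inner flip: power2_eq_square)
      then have "norm p \<le> norm z" by (cases "norm p = 0") auto
      then have "norm (\<xi> n u z) \<le> \<bar>\<zeta> z\<bar> * norm z"
        by (simp add: \<xi>_def \<zeta>_def p_def[symmetric] mult_left_mono)
      also have "\<dots> \<le> (c1 * (1 + norm z) ^ 4) * (1 + norm z)"
        using \<zeta>_bound[of z] z1(2)[of z] c10 by (intro mult_mono) auto
      finally show ?thesis by (simp add: Y_def power_Suc2[symmetric] mult.assoc eval_nat_numeral)
    qed
    note ns = normalized_step[OF onEn nu u\<xi>[OF u] \<alpha>[of n] Y, unfolded a_sum, folded step, folded \<beta>_def]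
    have \<zeta>_meas [measurable]: "\<zeta> \<in> borel_measurable borel" unfolding \<zeta>_def by measurable
    have err_meas [measurable]: "err \<in> borel_measurable borel" unfolding err_def by measurable
    have a0: "0 \<le> a u" and a1: "a u \<le> 1" using ns(2,3) by auto
    have step_meas: "(\<lambda>z. a (search_step G n u z)) \<in> borel_measurable borel"
      by (rule measurable_compose[OF _ a_meas]) measurable
    have a_step: "0 \<le> a (search_step G n u z)" "a (search_step G n u z) \<le> 1" for z
      using step_in[OF u, of n z] onset_bessel[OF onEn, of "search_step G n u z"]
      by (auto simp: a_def S_def sum_nonneg)
    have int_step: "integrable std_gaussian (\<lambda>z. a (search_step G n u z))"
      by (rule \<gamma>.integrable_const_bound[where B=1]) (use a_step step_meas in auto)
    have YK: "integrable std_gaussian (\<lambda>z. Y z ^ m)" "(\<integral>z. Y z ^ m \<partial>std_gaussian) = c1 ^ m * K (5 * m)" for m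
      unfolding Y_def power_mult_distrib power_mult[symmetric] K_def
      by (auto intro!: integrable_mult_right std_gaussian_poly_integrable)
    have e\<xi>: "e \<bullet> \<xi> n u z = \<zeta> z * (z \<bullet> (e - (u \<bullet> e) *\<^sub>R u))" if "e \<in> E" for e z
    proof -
      have "e \<bullet> (G *v z) = 0" using GE[OF that] P(2)[of e z] by simp
      then have "e \<bullet> \<xi> n u z = \<zeta> z * (e \<bullet> z - (u \<bullet> z) * (e \<bullet> u))"
        by (simp add: \<xi>_def \<zeta>_def inner_diff_right)
      also have "\<dots> = \<zeta> z * (z \<bullet> (e - (u \<bullet> e) *\<^sub>R u))"
        unfolding inner_diff_right inner_scaleR_right inner_commute[of e z] inner_commute[of e u] inner_commute[of u z]
        by (simp only: mult.commute)
      finally show ?thesis .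
    qed
    \<comment> \<open>\<open>Q\<close> is the projection of \<open>u\<close> to the negative
      eigenvectors and \<open>r\<close> its part tangential to the sphere, half the spherical
      gradient of \<open>a\<close>. All first-order terms reduce to the one product
      \<open>\<zeta> z * (z \<bullet> r)\<close>, and \<open>r\<close> has squared length
      \<open>a * (1 - a)\<close>.\<close>
    define Q where "Q = (\<Sum>e\<in>En. (e \<bullet> u) *\<^sub>R e)"
    define r where "r = Q - a u *\<^sub>R u"
    have QQ: "Q \<bullet> Q = a u" unfolding Q_def onset_inner_sums[OF onEn] a_def by (simp add: power2_eq_square)
    have Qu: "Q \<bullet> u = a u" unfolding Q_def inner_sum_left a_def by (simp add: power2_eq_square)
    have rr: "r \<bullet> r = a u * (1 - a u)"
      by (simp add: r_def inner_diff_left inner_diff_right QQ Qu uu inner_commute[of u Q] algebra_simps)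
    have nr: "norm r \<le> sqrt (a u)"
    proof -
      have "a u * (1 - a u) \<le> a u * 1" using a0 by (intro mult_left_mono) auto
      then show ?thesis unfolding norm_eq_sqrt_inner rr by simp
    qed
    have S_eq: "(\<Sum>e\<in>En. (e \<bullet> u) * (e \<bullet> \<xi> n u z)) = \<zeta> z * (z \<bullet> r)" for z
    proof -
      have "(\<Sum>e\<in>En. (e \<bullet> u) * (e \<bullet> \<xi> n u z)) = (\<Sum>e\<in>En. \<zeta> z * ((e \<bullet> u) * (z \<bullet> e) - (e \<bullet> u)\<^sup>2 * (z \<bullet> u)))"
        by (intro sum.cong refl) (simp add: e\<xi> En_def inner_diff_right inner_commute[of u] power2_eq_square algebra_simps)
      also have "\<dots> = \<zeta> z * (z \<bullet> r)"
        by (simp add: r_def Q_def a_def inner_diff_right inner_sum_right sum_subtractf sum_distrib_left[symmetric] sum_distrib_right[symmetric])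
      finally show ?thesis .
    qed
    have zr: "\<bar>z \<bullet> r\<bar> \<le> norm z * sqrt (a u)" for z
      using Cauchy_Schwarz_ineq2[of z r] mult_left_mono[OF nr norm_ge_zero[of z]] by linarith
    \<comment> \<open>Splitting \<open>u\<close> into its negative and positive parts with energies
      \<open>b\<close> and \<open>d\<close>, the drift is \<open>(1 - a) * b - a * d\<close>. Each
      of the two terms contributes half of the bound.\<close>
    have drift: "(A *v u) \<bullet> r \<le> - \<mu> * (a u * (1 - a u))"
    proof -
      have uW: "u \<in> span E" "\<forall>w\<in>set ws. w \<bullet> u = 0" using u E(2) by (auto simp: S_def)
      define b where "b = (\<Sum>e\<in>En. \<theta> e * (e \<bullet> u)\<^sup>2)"
      define d where "d = (\<Sum>e\<in>E - En. \<theta> e * (e \<bullet> u)\<^sup>2)"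
      have fin: "finite E" by (rule onset_finite[OF E(1)])
      have EnE: "En \<subseteq> E" by (auto simp: En_def)
      have AQ: "(A *v u) \<bullet> Q = b"
        unfolding Q_def inner_sum_right b_def A_def
        by (intro sum.cong refl) (simp add: En_def inner_commute[of "hess f x *v u"] ev[OF _ uW(2)] power2_eq_square)
      have "(A *v u) \<bullet> u = (A *v u) \<bullet> (\<Sum>e\<in>E. (e \<bullet> u) *\<^sub>R e)"
        using onset_expand[OF E(1) uW(1)] by simp
      also have "\<dots> = (\<Sum>e\<in>E. \<theta> e * (e \<bullet> u)\<^sup>2)"
        unfolding inner_sum_right A_def
        by (intro sum.cong refl) (simp add: inner_commute[of "hess f x *v u"] ev[OF _ uW(2)] power2_eq_square)
      also have "\<dots> = b + d"
        using sum.subset_diff[OF EnE fin, of "\<lambda>e. \<theta> e * (e \<bullet> u)\<^sup>2"] by (simp add: b_def d_def)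
      finally have Auu: "(A *v u) \<bullet> u = b + d" .
      have one: "(\<Sum>e\<in>E - En. (e \<bullet> u)\<^sup>2) = 1 - a u"
        using onset_parseval[OF E(1) uW(1)] nu sum.subset_diff[OF EnE fin, of "\<lambda>e. (e \<bullet> u)\<^sup>2"]
        by (simp add: a_sum)
      have "b \<le> (\<Sum>e\<in>En. - (\<mu> / 2) * (e \<bullet> u)\<^sup>2)"
        unfolding b_def using gap by (intro sum_mono mult_right_mono) (fastforce simp: En_def)+
      then have b: "b \<le> - (\<mu> / 2) * a u" by (simp add: a_def sum_distrib_left)
      have "(\<Sum>e\<in>E - En. (\<mu> / 2) * (e \<bullet> u)\<^sup>2) \<le> d"
        unfolding d_def using gap by (intro sum_mono mult_right_mono) (fastforce simp: En_def)+
      then have d: "(\<mu> / 2) * (1 - a u) \<le> d" unfolding sum_distrib_left[symmetric] one .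
      have "(A *v u) \<bullet> r = (1 - a u) * b - a u * d" by (simp add: r_def inner_diff_right AQ Auu algebra_simps)
      also have "\<dots> \<le> (1 - a u) * (- (\<mu> / 2) * a u) - a u * ((\<mu> / 2) * (1 - a u))"
        using b d a0 a1 by (intro diff_mono mult_left_mono) auto
      finally show ?thesis by (simp add: algebra_simps)
    qed
    have zb: "\<bar>z \<bullet> q\<bar> \<le> (1 + norm z) * norm q" for z q :: "real^'n"
      by (rule order_trans[OF Cauchy_Schwarz_ineq2 mult_right_mono[OF z1(2) norm_ge_zero]])
    have zr': "\<bar>z \<bullet> r\<bar> \<le> (1 + norm z) * sqrt (a u)" for z
      by (rule order_trans[OF zr mult_right_mono[OF z1(2)]]) (simp add: a0)
    have ints: "integrable std_gaussian (\<lambda>z. \<zeta> z * (z \<bullet> r))"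
    proof (rule std_gaussian_integrable_poly_bound[where m=5])
      fix z
      have "\<bar>\<zeta> z * (z \<bullet> r)\<bar> \<le> (c1 * (1 + norm z) ^ 4) * ((1 + norm z) * norm r)"
        unfolding abs_mult by (intro mult_mono \<zeta>_bound zb) (use c10 in auto)
      then show "\<bar>\<zeta> z * (z \<bullet> r)\<bar> \<le> (c1 * norm r) * (1 + norm z) ^ 5" by (simp add: eval_nat_numeral mult_ac)
    qed measurable
    have inte: "integrable std_gaussian (\<lambda>z. err z * (z \<bullet> r))"
    proof (rule std_gaussian_integrable_poly_bound[where m=5])
      fix z
      have "\<bar>err z * (z \<bullet> r)\<bar> \<le> ((M * L\<^sup>2 * \<beta>) * (1 + norm z) ^ 4) * ((1 + norm z) * norm r)"
        unfolding abs_mult by (intro mult_mono err2 zb) (use M0 \<beta> in auto)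
      then show "\<bar>err z * (z \<bullet> r)\<bar> \<le> (M * L\<^sup>2 * \<beta> * norm r) * (1 + norm z) ^ 5" by (simp add: eval_nat_numeral mult_ac)
    qed measurable
    have intc: "integrable std_gaussian (\<lambda>z. (z \<bullet> p) * (z \<bullet> q))" for p q :: "real^'n"
    proof (rule std_gaussian_integrable_poly_bound[where m=2])
      fix z
      have "\<bar>(z \<bullet> p) * (z \<bullet> q)\<bar> \<le> ((1 + norm z) * norm p) * ((1 + norm z) * norm q)"
        unfolding abs_mult by (intro mult_mono zb) auto
      then show "\<bar>(z \<bullet> p) * (z \<bullet> q)\<bar> \<le> (norm p * norm q) * (1 + norm z)\<^sup>2" by (simp add: power2_eq_square mult_ac)
    qed measurable
    have ES: "(\<integral>z. \<zeta> z * (z \<bullet> r) \<partial>std_gaussian) \<le> - \<mu> * (a u * (1 - a u)) + \<beta> * X * sqrt (a u)"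
    proof -
      have "(\<integral>z. \<zeta> z * (z \<bullet> r) \<partial>std_gaussian) = (\<integral>z. (z \<bullet> (A *v u)) * (z \<bullet> r) + err z * (z \<bullet> r) \<partial>std_gaussian)"
        by (intro Bochner_Integration.integral_cong) (auto simp: err_def algebra_simps)
      also have "\<dots> = (A *v u) \<bullet> r + (\<integral>z. err z * (z \<bullet> r) \<partial>std_gaussian)"
        using intc inte by (simp add: std_gaussian_covariance)
      also have "(\<integral>z. err z * (z \<bullet> r) \<partial>std_gaussian) \<le> (\<integral>z. (M * L\<^sup>2 * \<beta> * sqrt (a u)) * (1 + norm (z :: real^'n)) ^ 5 \<partial>std_gaussian)"
      proof (rule integral_mono[OF inte])
        show "integrable std_gaussian (\<lambda>z. (M * L\<^sup>2 * \<beta> * sqrt (a u)) * (1 + norm (z :: real^'n)) ^ 5)"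
          by (intro integrable_mult_right std_gaussian_poly_integrable)
        fix z
        have "\<bar>err z * (z \<bullet> r)\<bar> \<le> ((M * L\<^sup>2 * \<beta>) * (1 + norm z) ^ 4) * ((1 + norm z) * sqrt (a u))"
          unfolding abs_mult by (intro mult_mono err2 zr') (use M0 \<beta> a0 in auto)
        also have "\<dots> = (M * L\<^sup>2 * \<beta> * sqrt (a u)) * (1 + norm z) ^ 5" by (simp add: eval_nat_numeral mult_ac)
        finally show "err z * (z \<bullet> r) \<le> (M * L\<^sup>2 * \<beta> * sqrt (a u)) * (1 + norm z) ^ 5" by (rule order_trans[OF abs_ge_self])
      qed
      also have "\<dots> = \<beta> * X * sqrt (a u)" by (simp add: X_def K_def)
      finally show ?thesis using drift by linarith
    qed
    \<comment> \<open>The tangential part of \<open>e\<^sub>0\<close>: the component of the step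
      along \<open>e\<^sub>0\<close> is \<open>\<zeta> z * (z \<bullet> p)\<close>. Its squared
      length is at least \<open>1 - a\<close>, because
      \<open>(e\<^sub>0 \<bullet> u)\<^sup>2\<close> is one of the summands of
      \<open>a\<close>.\<close>
    define p where "p = e\<^sub>0 - (u \<bullet> e\<^sub>0) *\<^sub>R u"
    have ne0: "e\<^sub>0 \<bullet> e\<^sub>0 = 1" using E(1) e0 by (simp add: onset_def)
    have pp: "p \<bullet> p = 1 - (e\<^sub>0 \<bullet> u)\<^sup>2"
      by (simp add: p_def inner_diff_left inner_diff_right ne0 uu inner_commute[of u "e\<^sub>0"] power2_eq_square)
    have np: "norm p \<le> 1" unfolding norm_eq_sqrt_inner pp by simp
    \<comment> \<open>\<open>std_gaussian_fourth\<close> for \<open>A *v u\<close> and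
      \<open>p\<close> gives \<open>\<mu>\<^sup>2 * (1 - a)\<close>. Half of it is given up to
      replace the exact product by the estimator, using that \<open>(s + e)\<^sup>2\<close> is at
      least \<open>s\<^sup>2 / 2 - e\<^sup>2\<close>.\<close>
    have EN: "\<mu>\<^sup>2 / 2 * (1 - a u) - \<beta>\<^sup>2 * (M\<^sup>2 * L ^ 4 * K 10) \<le> (\<integral>z. (e\<^sub>0 \<bullet> \<xi> n u z)\<^sup>2 \<partial>std_gaussian)"
      and intN: "integrable std_gaussian (\<lambda>z. (e\<^sub>0 \<bullet> \<xi> n u z)\<^sup>2)"
    proof -
      have eq: "(e\<^sub>0 \<bullet> \<xi> n u z)\<^sup>2 = (\<zeta> z * (z \<bullet> p))\<^sup>2" for z using e\<xi>[OF e0(1)] by (simp add: p_def)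
      have err_sum: "z \<bullet> (A *v u) + err z = \<zeta> z" for z by (simp add: err_def)
      have zp: "\<bar>z \<bullet> p\<bar> \<le> 1 + norm z" for z
        using Cauchy_Schwarz_ineq2[of z p] mult_left_mono[OF np norm_ge_zero[of z]] by linarith
      have int2: "integrable std_gaussian (\<lambda>z. ((z \<bullet> (A *v u)) * (z \<bullet> p))\<^sup>2)"
      proof (rule std_gaussian_integrable_poly_bound[where m=4])
        fix z
        have "\<bar>(z \<bullet> (A *v u)) * (z \<bullet> p)\<bar> \<le> (M * (1 + norm z)) * (1 + norm z)"
          unfolding abs_mult
          by (intro mult_mono zp order_trans[OF zAu mult_left_mono[OF z1(2) M0]]) (use M0 in auto)
        then have "\<bar>(z \<bullet> (A *v u)) * (z \<bullet> p)\<bar>\<^sup>2 \<le> ((M * (1 + norm z)) * (1 + norm z))\<^sup>2" by (intro power_mono) auto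
        also have "\<dots> = M\<^sup>2 * (1 + norm z) ^ 4" by (simp add: eval_nat_numeral mult_ac)
        finally show "\<bar>((z \<bullet> (A *v u)) * (z \<bullet> p))\<^sup>2\<bar> \<le> M\<^sup>2 * (1 + norm z) ^ 4" by simp
      qed measurable
      have e2: "\<bar>(err z * (z \<bullet> p))\<^sup>2\<bar> \<le> (\<beta>\<^sup>2 * (M\<^sup>2 * L ^ 4)) * (1 + norm z) ^ 10" for z
      proof -
        have "\<bar>err z * (z \<bullet> p)\<bar> \<le> ((M * L\<^sup>2 * \<beta>) * (1 + norm z) ^ 4) * (1 + norm z)"
          unfolding abs_mult by (intro mult_mono err2 zp) (use M0 \<beta> in auto)
        then have "\<bar>err z * (z \<bullet> p)\<bar>\<^sup>2 \<le> ((M * L\<^sup>2 * \<beta>) * (1 + norm z) ^ 4 * (1 + norm z))\<^sup>2" by (intro power_mono) auto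
        also have "\<dots> = (\<beta>\<^sup>2 * (M\<^sup>2 * L ^ 4)) * (1 + norm z) ^ 10"
          by (simp add: eval_nat_numeral mult_ac)
        finally show ?thesis by simp
      qed
      have int3: "integrable std_gaussian (\<lambda>z. (err z * (z \<bullet> p))\<^sup>2)"
        by (rule std_gaussian_integrable_poly_bound[OF _ e2]) measurable
      show int4: "integrable std_gaussian (\<lambda>z. (e\<^sub>0 \<bullet> \<xi> n u z)\<^sup>2)"
        unfolding eq
      proof (rule std_gaussian_integrable_poly_bound[where m=10])
        fix z
        have "\<bar>\<zeta> z * (z \<bullet> p)\<bar> \<le> (c1 * (1 + norm z) ^ 4) * (1 + norm z)"
          unfolding abs_mult by (intro mult_mono \<zeta>_bound zp) (use c10 in auto)
        then have "\<bar>\<zeta> z * (z \<bullet> p)\<bar>\<^sup>2 \<le> ((c1 * (1 + norm z) ^ 4) * (1 + norm z))\<^sup>2" by (intro power_mono) auto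
        also have "\<dots> = c1\<^sup>2 * (1 + norm z) ^ 10" by (simp add: eval_nat_numeral mult_ac)
        finally show "\<bar>(\<zeta> z * (z \<bullet> p))\<^sup>2\<bar> \<le> c1\<^sup>2 * (1 + norm z) ^ 10" by simp
      qed measurable
      have "(e\<^sub>0 \<bullet> u)\<^sup>2 \<le> a u" unfolding a_def by (rule member_le_sum[OF e0n]) (auto simp: onset_finite[OF onEn])
      then have p1: "1 - a u \<le> (norm p)\<^sup>2" by (simp add: power2_norm_eq_inner pp)
      have "\<mu>\<^sup>2 \<le> (norm (A *v u))\<^sup>2" using hess_lower[of u] nu \<mu> by (intro power_mono) (auto simp: A_def)
      then have "\<mu>\<^sup>2 * (1 - a u) \<le> (norm (A *v u))\<^sup>2 * (norm p)\<^sup>2" using p1 a1 by (intro mult_mono) auto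
      also have "\<dots> \<le> (\<integral>z. ((z \<bullet> (A *v u)) * (z \<bullet> p))\<^sup>2 \<partial>std_gaussian)" by (rule std_gaussian_fourth)
      finally have m1: "\<mu>\<^sup>2 * (1 - a u) \<le> (\<integral>z. ((z \<bullet> (A *v u)) * (z \<bullet> p))\<^sup>2 \<partial>std_gaussian)" .
      have "(\<integral>z. (err z * (z \<bullet> p))\<^sup>2 \<partial>std_gaussian) \<le> (\<integral>z. (\<beta>\<^sup>2 * (M\<^sup>2 * L ^ 4)) * (1 + norm (z :: real^'n)) ^ 10 \<partial>std_gaussian)"
        by (rule integral_mono[OF int3 integrable_mult_right[OF std_gaussian_poly_integrable] order_trans[OF abs_ge_self e2]])
      then have m2: "(\<integral>z. (err z * (z \<bullet> p))\<^sup>2 \<partial>std_gaussian) \<le> \<beta>\<^sup>2 * (M\<^sup>2 * L ^ 4 * K 10)" by (simp add: K_def mult.assoc)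
      have "(\<integral>z. 1 / 2 * ((z \<bullet> (A *v u)) * (z \<bullet> p))\<^sup>2 - (err z * (z \<bullet> p))\<^sup>2 \<partial>std_gaussian) \<le> (\<integral>z. (e\<^sub>0 \<bullet> \<xi> n u z)\<^sup>2 \<partial>std_gaussian)"
      proof (intro integral_mono int4 Bochner_Integration.integrable_diff integrable_mult_right int2 int3)
        fix z
        have "1 / 2 * (s * q)\<^sup>2 - (e * q)\<^sup>2 \<le> ((s + e) * q)\<^sup>2" for s e q :: real
        proof -
          have "((s + e) * q)\<^sup>2 - (1 / 2 * (s * q)\<^sup>2 - (e * q)\<^sup>2) = 1 / 2 * ((s + 2 * e) * q)\<^sup>2"
            by (simp add: power2_eq_square algebra_simps)
          moreover have "0 \<le> 1 / 2 * ((s + 2 * e) * q)\<^sup>2" by simp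
          ultimately show ?thesis by linarith
        qed
        from this[of "z \<bullet> (A *v u)" "z \<bullet> p" "err z"]
        show "1 / 2 * ((z \<bullet> (A *v u)) * (z \<bullet> p))\<^sup>2 - (err z * (z \<bullet> p))\<^sup>2 \<le> (e\<^sub>0 \<bullet> \<xi> n u z)\<^sup>2"
          unfolding eq err_sum .
      qed
      also have "(\<integral>z. 1 / 2 * ((z \<bullet> (A *v u)) * (z \<bullet> p))\<^sup>2 - (err z * (z \<bullet> p))\<^sup>2 \<partial>std_gaussian)
        = 1 / 2 * (\<integral>z. ((z \<bullet> (A *v u)) * (z \<bullet> p))\<^sup>2 \<partial>std_gaussian) - (\<integral>z. (err z * (z \<bullet> p))\<^sup>2 \<partial>std_gaussian)"
        using int2 int3 by simp
      finally show "\<mu>\<^sup>2 / 2 * (1 - a u) - \<beta>\<^sup>2 * (M\<^sup>2 * L ^ 4 * K 10) \<le> (\<integral>z. (e\<^sub>0 \<bullet> \<xi> n u z)\<^sup>2 \<partial>std_gaussian)"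
        using m1 m2 by linarith
    qed
    define I where "I z = a u - 2 * \<beta> * (\<zeta> z * (z \<bullet> r)) + \<beta>\<^sup>2 * (e\<^sub>0 \<bullet> \<xi> n u z)\<^sup>2 - \<beta>\<^sup>2 * a u * Y z ^ 2 - 2 * \<beta> ^ 3 * Y z ^ 3 - \<beta> ^ 4 * Y z ^ 4" for z
    have intI: "integrable std_gaussian I"
      unfolding I_def[abs_def] using ints intN YK(1) by auto
    have EI: "(\<integral>z. I z \<partial>std_gaussian) = a u - 2 * \<beta> * (\<integral>z. \<zeta> z * (z \<bullet> r) \<partial>std_gaussian) + \<beta>\<^sup>2 * (\<integral>z. (e\<^sub>0 \<bullet> \<xi> n u z)\<^sup>2 \<partial>std_gaussian)
       - \<beta>\<^sup>2 * a u * (c1\<^sup>2 * K 10) - 2 * \<beta> ^ 3 * (c1 ^ 3 * K 15) - \<beta> ^ 4 * (c1 ^ 4 * K 20)"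
      unfolding I_def using ints intN YK(1) YK(2)[of 2] YK(2)[of 3] YK(2)[of 4] \<gamma>.prob_space by simp
    have "(\<integral>z. I z \<partial>std_gaussian) \<le> (\<integral>z. a (search_step G n u z) \<partial>std_gaussian)"
      by (rule integral_mono[OF intI int_step]) (use ns(4)[OF e0n] in \<open>simp add: I_def S_eq mult_ac\<close>)
    moreover have "2 * \<mu> * \<beta> * (a u * (1 - a u)) + \<mu>\<^sup>2 / 4 * \<beta>\<^sup>2 - C * \<beta>\<^sup>2 * a u \<le> (\<integral>z. I z \<partial>std_gaussian) - a u"
    proof -
      have t1: "2 * \<beta> * (\<integral>z. \<zeta> z * (z \<bullet> r) \<partial>std_gaussian) \<le> 2 * \<beta> * (- \<mu> * (a u * (1 - a u)) + \<beta> * X * sqrt (a u))"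
        using ES \<beta> by (intro mult_left_mono) auto
      have t2: "\<beta>\<^sup>2 * (\<mu>\<^sup>2 / 2 * (1 - a u) - \<beta>\<^sup>2 * (M\<^sup>2 * L ^ 4 * K 10)) \<le> \<beta>\<^sup>2 * (\<integral>z. (e\<^sub>0 \<bullet> \<xi> n u z)\<^sup>2 \<partial>std_gaussian)"
        using EN by (intro mult_left_mono) auto
      \<comment> \<open>The inequality of arithmetic and geometric means, weighted so that the part
        without \<open>a\<close> is exactly \<open>\<mu>\<^sup>2 / 8\<close>; the part with
        \<open>a\<close> is absorbed by \<open>C\<close>.\<close>
      have am: "2 * X * sqrt (a u) \<le> \<mu>\<^sup>2 / 8 + 8 * X\<^sup>2 / \<mu>\<^sup>2 * a u"
      proof -
        have nn: "0 \<le> 8 / \<mu>\<^sup>2 * (X * sqrt (a u) - \<mu>\<^sup>2 / 8)\<^sup>2" by simp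
        have "8 / m * (X * t - m / 8)\<^sup>2 = 8 * X\<^sup>2 / m * t\<^sup>2 - 2 * X * t + m / 8" if "0 < m" for m t :: real
          using that by (simp add: field_simps power2_eq_square)
        from this[of "\<mu>\<^sup>2" "sqrt (a u)"] have "8 / \<mu>\<^sup>2 * (X * sqrt (a u) - \<mu>\<^sup>2 / 8)\<^sup>2 = 8 * X\<^sup>2 / \<mu>\<^sup>2 * a u - 2 * X * sqrt (a u) + \<mu>\<^sup>2 / 8"
          using \<mu> a0 by simp
        with nn show ?thesis by linarith
      qed
      have t3: "\<beta>\<^sup>2 * (2 * X * sqrt (a u)) \<le> \<beta>\<^sup>2 * (\<mu>\<^sup>2 / 8 + 8 * X\<^sup>2 / \<mu>\<^sup>2 * a u)"
        using am by (intro mult_left_mono) auto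
      have t4: "\<beta>\<^sup>2 * (\<beta>\<^sup>2 * (M\<^sup>2 * L ^ 4 * K 10) + 2 * \<beta> * (c1 ^ 3 * K 15) + \<beta>\<^sup>2 * (c1 ^ 4 * K 20)) \<le> \<beta>\<^sup>2 * (\<mu>\<^sup>2 / 8)"
        using smallb by (intro mult_left_mono) auto
      have t5: "(\<mu>\<^sup>2 / 2 + 8 * X\<^sup>2 / \<mu>\<^sup>2 + c1\<^sup>2 * K 10) * (\<beta>\<^sup>2 * a u) \<le> C * (\<beta>\<^sup>2 * a u)"
        using a0 by (intro mult_right_mono) (auto simp: C_def)
      have b3: "\<beta> ^ 3 = \<beta>\<^sup>2 * \<beta>" "\<beta> ^ 4 = \<beta>\<^sup>2 * \<beta>\<^sup>2" by (simp_all add: eval_nat_numeral)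
      have e1: "2 * \<beta> * (- \<mu> * (a u * (1 - a u)) + \<beta> * X * sqrt (a u)) = - (2 * \<mu> * \<beta> * (a u * (1 - a u))) + \<beta>\<^sup>2 * (2 * X * sqrt (a u))"
        by (simp add: power2_eq_square algebra_simps)
      have e2: "\<beta>\<^sup>2 * (\<mu>\<^sup>2 / 2 * (1 - a u) - \<beta>\<^sup>2 * (M\<^sup>2 * L ^ 4 * K 10)) = 1 / 2 * (\<mu>\<^sup>2 * \<beta>\<^sup>2) - 1 / 2 * (\<mu>\<^sup>2 * (\<beta>\<^sup>2 * a u)) - \<beta>\<^sup>2 * (\<beta>\<^sup>2 * (M\<^sup>2 * L ^ 4 * K 10))"
        by (simp add: field_simps)
      have e3: "\<beta>\<^sup>2 * (\<mu>\<^sup>2 / 8 + 8 * X\<^sup>2 / \<mu>\<^sup>2 * a u) = 1 / 8 * (\<mu>\<^sup>2 * \<beta>\<^sup>2) + 8 * X\<^sup>2 / \<mu>\<^sup>2 * (\<beta>\<^sup>2 * a u)" by (simp add: algebra_simps)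
      have e4: "\<beta>\<^sup>2 * (\<beta>\<^sup>2 * (M\<^sup>2 * L ^ 4 * K 10) + 2 * \<beta> * (c1 ^ 3 * K 15) + \<beta>\<^sup>2 * (c1 ^ 4 * K 20))
        = \<beta>\<^sup>2 * (\<beta>\<^sup>2 * (M\<^sup>2 * L ^ 4 * K 10)) + 2 * \<beta> ^ 3 * (c1 ^ 3 * K 15) + \<beta> ^ 4 * (c1 ^ 4 * K 20)"
        unfolding b3 by (simp only: distrib_left mult_ac)
      have e5: "(\<mu>\<^sup>2 / 2 + 8 * X\<^sup>2 / \<mu>\<^sup>2 + c1\<^sup>2 * K 10) * (\<beta>\<^sup>2 * a u) = 1 / 2 * (\<mu>\<^sup>2 * (\<beta>\<^sup>2 * a u)) + 8 * X\<^sup>2 / \<mu>\<^sup>2 * (\<beta>\<^sup>2 * a u) + \<beta>\<^sup>2 * a u * (c1\<^sup>2 * K 10)"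
        by (simp add: algebra_simps)
      have e6: "C * \<beta>\<^sup>2 * a u = C * (\<beta>\<^sup>2 * a u)" "\<beta>\<^sup>2 * (\<mu>\<^sup>2 / 8) = 1 / 8 * (\<mu>\<^sup>2 * \<beta>\<^sup>2)"
        "\<mu>\<^sup>2 / 4 * \<beta>\<^sup>2 = 1 / 4 * (\<mu>\<^sup>2 * \<beta>\<^sup>2)" by simp_all
      show ?thesis
        using t1 t2 t3 t4 t5 unfolding EI e1 e2 e3 e4 e5 e6 by linarith
    qed
    ultimately have "2 * \<mu> * \<beta> * (a u * (1 - a u)) + \<mu>\<^sup>2 / 4 * \<beta>\<^sup>2 - C * \<beta>\<^sup>2 * a u \<le> (\<integral>z. a (search_step G n u z) \<partial>std_gaussian) - a u"
      by linarith
    then show "2 * \<mu> * \<alpha> n * (a u * (1 - a u)) + \<mu>\<^sup>2 / 4 * (\<alpha> n)\<^sup>2 - C * (\<alpha> n)\<^sup>2 * a u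
        \<le> markov_steps.opr std_gaussian (search_step G) n a u - a u"
      by (simp add: ms.opr_def \<beta>_def)
    have "(\<integral>z. (a (search_step G n u z) - a u)\<^sup>2 \<partial>std_gaussian) \<le> (\<integral>z. 12 * \<beta>\<^sup>2 * a u * Y z ^ 2 + 6 * \<beta> ^ 4 * Y z ^ 4 \<partial>std_gaussian)"
    proof (rule integral_mono)
      show "integrable std_gaussian (\<lambda>z. (a (search_step G n u z) - a u)\<^sup>2)"
      proof (rule \<gamma>.integrable_const_bound[where B=1])
        have "norm ((a (search_step G n u z) - a u)\<^sup>2) \<le> 1" for z
        proof -
          have "\<bar>a (search_step G n u z) - a u\<bar> \<le> 1" using a_step[of z] a0 a1 by (simp add: abs_le_iff)
          then show ?thesis by (simp add: abs_square_le_1)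
        qed
        then show "AE z in std_gaussian. norm ((a (search_step G n u z) - a u)\<^sup>2) \<le> 1" by simp
      qed (use step_meas in simp)
      show "integrable std_gaussian (\<lambda>z. 12 * \<beta>\<^sup>2 * a u * Y z ^ 2 + 6 * \<beta> ^ 4 * Y z ^ 4)" using YK(1) by auto
      show "(a (search_step G n u z) - a u)\<^sup>2 \<le> 12 * \<beta>\<^sup>2 * a u * Y z ^ 2 + 6 * \<beta> ^ 4 * Y z ^ 4" for z
        using ns(5)[of z] by (simp add: mult_ac)
    qed
    also have "\<dots> = \<beta>\<^sup>2 * a u * (12 * c1\<^sup>2 * K 10) + \<beta> ^ 4 * (6 * c1 ^ 4 * K 20)"
      using YK(1) YK(2)[of 2] YK(2)[of 4] by simp
    also have "\<dots> \<le> \<beta>\<^sup>2 * a u * C + \<beta> ^ 4 * C"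
      using a0 by (intro add_mono mult_left_mono) (auto simp: C_def)
    also have "\<dots> = C * (\<alpha> n)\<^sup>2 * (a u + (\<alpha> n)\<^sup>2)" by (simp add: \<beta>_def eval_nat_numeral algebra_simps)
    finally show "(\<integral>z. (a (search_step G n u z) - a u)\<^sup>2 \<partial>std_gaussian) \<le> C * (\<alpha> n)\<^sup>2 * (a u + (\<alpha> n)\<^sup>2)" .
  qed
qed

end

section \<open>Orthonormality and measurability of the search output\<close>

lemma search_iter_cong:
  "(\<And>i. i < n \<Longrightarrow> s i = s' i) \<Longrightarrow> search_iter f x \<alpha> l s ws v n = search_iter f x \<alpha> l s' ws v n"
  by (induction n) auto

lemma search_output_cong:
  "(\<And>i n. i < j \<Longrightarrow> s i n = s' i n) \<Longrightarrow> search_output f x \<alpha> l s v N j = search_output f x \<alpha> l s' v N j"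
proof (induction j)
  case (Suc j)
  then have "s j = s' j" "search_output f x \<alpha> l s v N j = search_output f x \<alpha> l s' v N j" by auto
  then show ?case by simp
qed simp

lemma length_search_output [simp]: "length (search_output f x \<alpha> l s v N j) = j"
  by (induction j) (auto simp: Let_def)

lemma gram_append: "gram (ws @ [w]) = gram ws + outer w w"
  by (simp add: gram_def)

lemma borel_measurable_outer [measurable]:
  fixes u :: "'w \<Rightarrow> real^'n::finite"
  assumes "u \<in> borel_measurable N" shows "(\<lambda>\<omega>. outer (u \<omega>) (u \<omega>)) \<in> borel_measurable N"
proof -
  have "continuous_on UNIV (\<lambda>u::real^'n. outer u u)"
    unfolding outer_def by (intro continuous_intros)
  from borel_measurable_continuous_onI[OF this] show ?thesis using measurable_compose[OF assms] by blast
qed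

context search_params
begin

lemma search_iter_Suc:
  "search_iter f x \<alpha> l s ws v (Suc n) = search_step (gram ws) n (search_iter f x \<alpha> l s ws v n) (s n)"
  by (simp add: search_step_def Let_def)

lemma search_iter_in:
  assumes ws: "onset (set ws)" "distinct ws" and u: "norm u = 1" "\<forall>w\<in>set ws. w \<bullet> u = 0"
  shows "norm (search_iter f x \<alpha> l s ws u n) = 1 \<and> (\<forall>w\<in>set ws. w \<bullet> search_iter f x \<alpha> l s ws u n = 0)"
proof (induction n)
  case (Suc n)
  then show ?case unfolding search_iter_Suc using search_step_in[OF ws] by blast
qed (use u in simp)

lemma search_start_in:
  assumes ws: "onset (set ws)" "distinct ws" and v: "norm v = 1" "ws \<noteq> [] \<Longrightarrow> (mat 1 - gram ws) *v v \<noteq> 0"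
  shows "norm (search_start ws v) = 1" "\<forall>w\<in>set ws. w \<bullet> search_start ws v = 0"
proof -
  note P = onset_projection[OF ws]
  show "norm (search_start ws v) = 1" using v by (auto simp: search_start_def norm_sgn)
  show "\<forall>w\<in>set ws. w \<bullet> search_start ws v = 0"
  proof
    fix w assume w: "w \<in> set ws"
    have "gram ws *v w = w" using w P(3) by (simp add: span_base)
    then have "w \<bullet> (gram ws *v v) = w \<bullet> v" using P(2)[of w v] by simp
    then show "w \<bullet> search_start ws v = 0"
      using w by (auto simp: search_start_def sgn_div_norm matrix_vector_mult_diff_rdistrib inner_diff_right)
  qed
qed

lemma search_output_onset:
  assumes v: "\<And>i. i < j \<Longrightarrow> norm (v i) = 1"
    and nz: "\<And>i. i \<in> {1..<j} \<Longrightarrow> (mat 1 - gram (search_output f x \<alpha> l s v N i)) *v v i \<noteq> 0"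
  shows "onset (set (search_output f x \<alpha> l s v N j)) \<and> distinct (search_output f x \<alpha> l s v N j)"
  using assms
proof (induction j)
  case 0
  then show ?case by (simp add: onset_def)
next
  case (Suc j)
  define ws where "ws = search_output f x \<alpha> l s v N j"
  have "onset (set ws) \<and> distinct ws"
    unfolding ws_def by (rule Suc.IH) (use Suc.prems in auto)
  then have ws: "onset (set ws)" "distinct ws" by auto
  have "ws \<noteq> [] \<Longrightarrow> (mat 1 - gram ws) *v v j \<noteq> 0"
    using Suc.prems(2)[of j] unfolding ws_def by (cases j) auto
  note start = search_start_in[OF ws _ this]
  define w where "w = search_iter f x \<alpha> l (s j) ws (search_start ws (v j)) (Suc N)"
  have w: "norm w = 1" "\<forall>u\<in>set ws. u \<bullet> w = 0"
    unfolding w_def using search_iter_in[OF ws start] Suc.prems(1)[of j] by (auto simp del: search_iter.simps)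
  have "w \<notin> set ws" using w by (auto simp: norm_eq_1)
  then have "onset (set (ws @ [w])) \<and> distinct (ws @ [w])"
    using ws w by (auto simp: onset_def norm_eq_1 inner_commute)
  moreover have "search_output f x \<alpha> l s v N (Suc j) = ws @ [w]"
    by (simp add: ws_def w_def Let_def del: search_iter.simps)
  ultimately show ?case by simp
qed

lemma search_iter_measurable:
  assumes [measurable]: "(\<lambda>\<omega>. gram (ws \<omega>)) \<in> borel_measurable Q" "u \<in> borel_measurable Q"
    and s: "\<And>i. i < n \<Longrightarrow> s i \<in> borel_measurable Q"
  shows "(\<lambda>\<omega>. search_iter f x \<alpha> l (\<lambda>i. s i \<omega>) (ws \<omega>) (u \<omega>) n) \<in> borel_measurable Q"
  using s
proof (induction n)
  case (Suc n)
  then have [measurable]: "(\<lambda>\<omega>. search_iter f x \<alpha> l (\<lambda>i. s i \<omega>) (ws \<omega>) (u \<omega>) n) \<in> borel_measurable Q" "s n \<in> borel_measurable Q"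
    by auto
  show ?case unfolding search_iter_Suc by measurable
qed simp

lemma search_start_measurable:
  assumes [measurable]: "(\<lambda>\<omega>. gram (ws \<omega>)) \<in> borel_measurable Q" and len: "\<And>\<omega>. length (ws \<omega>) = j"
  shows "(\<lambda>\<omega>. search_start (ws \<omega>) v) \<in> borel_measurable Q"
proof (cases j)
  case 0
  then have "ws \<omega> = []" for \<omega> using len[of \<omega>] by simp
  then show ?thesis by (simp add: search_start_def)
next
  case (Suc i)
  then have "ws \<omega> \<noteq> []" for \<omega> using len[of \<omega>] by auto
  then show ?thesis unfolding search_start_def sgn_div_norm by simp measurable
qed

text \<open>The output is a list, but later updates see it only through its \<open>gram\<close>
  matrix, and whether it is empty is decided by its fixed length. So measurability of this matrix is
  what the recursion passes on.\<close>

lemma gram_search_output_measurable: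
  assumes "\<And>i n. i < j \<Longrightarrow> s i n \<in> borel_measurable Q"
  shows "(\<lambda>\<omega>. gram (search_output f x \<alpha> l (\<lambda>i n. s i n \<omega>) v N j)) \<in> borel_measurable Q"
  using assms
proof (induction j)
  case 0
  then show ?case by (simp add: gram_def)
next
  case (Suc j)
  then have [measurable]: "(\<lambda>\<omega>. gram (search_output f x \<alpha> l (\<lambda>i n. s i n \<omega>) v N j)) \<in> borel_measurable Q" by auto
  have [measurable]: "(\<lambda>\<omega>. search_iter f x \<alpha> l (\<lambda>n. s j n \<omega>) (search_output f x \<alpha> l (\<lambda>i n. s i n \<omega>) v N j)
      (search_start (search_output f x \<alpha> l (\<lambda>i n. s i n \<omega>) v N j) (v j)) (Suc N)) \<in> borel_measurable Q"
    by (intro search_iter_measurable search_start_measurable) (use Suc.prems in auto)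
  show ?case unfolding search_output.simps Let_def gram_append by measurable
qed

end

section \<open>Deflated search loops\<close>

locale search_saddle = search_params f M x \<mu> \<alpha> l L
  for f :: "real^'n::finite \<Rightarrow> real" and M x \<mu> \<alpha> l L +
  fixes V :: "(real^'n) list" and k :: nat
  assumes V: "onset (set V)" "distinct V" "length V = k"
    and V_commute: "hess f x *v (gram V *v y) = gram V *v (hess f x *v y)"
    and V_low: "gram V *v u = u \<Longrightarrow> u \<bullet> (hess f x *v u) \<le> - \<mu> * (norm u)\<^sup>2"
    and V_high: "gram V *v u = 0 \<Longrightarrow> \<mu> * (norm u)\<^sup>2 \<le> u \<bullet> (hess f x *v u)"
begin

text \<open>The distance from \<open>u\<close> to the span of \<open>V\<close>, as
  \<open>gram V\<close> is the orthogonal projection.\<close>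

definition defect :: "real^'n \<Rightarrow> real" where "defect u = norm (u - gram V *v u)"

lemmas PV = onset_projection[OF V(1,2)]

lemma defect_split:
  "(gram V *v u) \<bullet> (u - gram V *v u) = 0" "gram V *v (u - gram V *v u) = 0"
  "(norm u)\<^sup>2 = (norm (gram V *v u))\<^sup>2 + (defect u)\<^sup>2"
proof -
  show z: "gram V *v (u - gram V *v u) = 0" by (simp add: matrix_vector_mult_diff_distrib PV(1))
  show o: "(gram V *v u) \<bullet> (u - gram V *v u) = 0" unfolding PV(2) z by simp
  have "(norm (gram V *v u + (u - gram V *v u)))\<^sup>2 = (norm (gram V *v u))\<^sup>2 + (norm (u - gram V *v u))\<^sup>2"
    by (rule norm_add_Pythagorean) (use o in \<open>simp add: orthogonal_def\<close>)
  then show "(norm u)\<^sup>2 = (norm (gram V *v u))\<^sup>2 + (defect u)\<^sup>2" by (simp add: defect_def)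
qed

lemma defect_le: "defect u \<le> norm u"
  by (rule power2_le_imp_le) (use defect_split(3)[of u] in auto)

text \<open>The bound on \<open>\<bar>\<theta> e\<bar>\<close> comes from testing with the reflection \<open>e - 2 *\<^sub>R (gram V *v e)\<close>, the bound on the defect
  from testing with \<open>e - gram V *v e\<close>, where the Hessian is positive while \<open>\<theta> e\<close> is negative.\<close>
lemma deflated_spectrum:
  assumes ws: "onset (set ws)" "distinct ws" "length ws < k"
    and \<eta>: "\<And>w. w \<in> set ws \<Longrightarrow> defect w \<le> \<eta>" "0 \<le> \<eta>" "4 * M * real k * \<eta> \<le> \<mu>"
  obtains E \<theta> e\<^sub>0 where "onset E" "span E = {y. \<forall>w\<in>set ws. w \<bullet> y = 0}"
    "\<And>e y. e \<in> E \<Longrightarrow> (\<forall>w\<in>set ws. w \<bullet> y = 0) \<Longrightarrow> e \<bullet> (hess f x *v y) = \<theta> e * (e \<bullet> y)"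
    "\<And>e. e \<in> E \<Longrightarrow> \<mu> / 2 \<le> \<bar>\<theta> e\<bar>" "e\<^sub>0 \<in> E" "\<theta> e\<^sub>0 < 0"
    "\<And>e. e \<in> E \<Longrightarrow> \<theta> e < 0 \<Longrightarrow> \<mu> * (defect e)\<^sup>2 \<le> M * real k * \<eta>"
proof -
  define A where "A = hess f x"
  define W where "W = {y. \<forall>w\<in>set ws. w \<bullet> y = 0}"
  \<comment> \<open>The compression to \<open>W\<close>, extended to the whole space; it maps into
    \<open>W\<close> but is symmetric on \<open>W\<close> only.\<close>
  define T where "T y = A *v y - gram ws *v (A *v y)" for y
  note P = onset_projection[OF ws(1,2)]
  have sym: "(A *v a) \<bullet> b = a \<bullet> (A *v b)" for a b unfolding A_def by (rule hess_symmetric)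
  have W: "subspace W" by (auto simp: W_def subspace_def inner_add_right)
  have gW: "gram ws *v y = 0" if "y \<in> W" for y using that P(4) by (simp add: W_def)
  have TW: "T y \<in> W" for y
  proof -
    have "gram ws *v T y = 0" by (simp add: T_def matrix_vector_mult_diff_distrib P(1))
    then show ?thesis using P(4) by (simp add: W_def)
  qed
  have Tin: "T a \<bullet> b = (A *v a) \<bullet> b" if "b \<in> W" for a b
    using P(2)[of "A *v a" b] gW[OF that] by (simp add: T_def inner_diff_left)
  have lin: "linear T" unfolding T_def
    by (intro linear_compose_sub linear_compose[OF matrix_vector_mul_linear matrix_vector_mul_linear, unfolded o_def] matrix_vector_mul_linear)
  have "\<exists>E \<theta>. onset E \<and> span E = W \<and> (\<forall>e\<in>E. T e = \<theta> e *\<^sub>R e)"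
    using Tin sym by (intro self_adjoint_eigenbasis[OF lin W TW]) (metis inner_commute)
  then obtain E \<theta> where E: "onset E" "span E = W" "\<And>e. e \<in> E \<Longrightarrow> T e = \<theta> e *\<^sub>R e" by blast
  have EW: "e \<in> W" if "e \<in> E" for e using span_base[OF that] E(2) by simp
  \<comment> \<open>An eigenvector of the compression is one of \<open>A\<close> up to a component
    in the span of \<open>ws\<close>. The sum is this leak, and it is harmless against vectors
    \<open>y\<close> nearly orthogonal to \<open>ws\<close>.\<close>
  have Ae: "(A *v e) \<bullet> y = \<theta> e * (e \<bullet> y) + (\<Sum>w\<in>set ws. (w \<bullet> (A *v e)) * (w \<bullet> y))" if "e \<in> E" for e y
  proof -
    have "A *v e = T e + gram ws *v (A *v e)" by (simp add: T_def)
    then have "(A *v e) \<bullet> y = (\<theta> e *\<^sub>R e + gram ws *v (A *v e)) \<bullet> y" using E(3)[OF that] by simp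
    then show ?thesis by (simp add: inner_add_left gram_mult[OF ws(2)] inner_sum_left)
  qed
  have sum_bound: "\<bar>\<Sum>w\<in>set ws. (w \<bullet> (A *v e)) * (w \<bullet> y)\<bar> \<le> M * real k * c"
    if e: "e \<in> E" and y: "\<And>w. w \<in> set ws \<Longrightarrow> \<bar>w \<bullet> y\<bar> \<le> c" and c: "0 \<le> c" for e y c
  proof -
    have "\<bar>\<Sum>w\<in>set ws. (w \<bullet> (A *v e)) * (w \<bullet> y)\<bar> \<le> (\<Sum>w\<in>set ws. \<bar>(w \<bullet> (A *v e)) * (w \<bullet> y)\<bar>)"
      by (rule sum_abs)
    also have "\<dots> \<le> (\<Sum>w\<in>set ws. M * c)"
    proof (rule sum_mono)
      fix w assume w: "w \<in> set ws"
      have "\<bar>w \<bullet> (A *v e)\<bar> \<le> norm w * norm (A *v e)" by (rule Cauchy_Schwarz_ineq2)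
      also have "\<dots> \<le> 1 * (M * 1)"
        using hess_norm_le[of x e] onset_norm[OF E(1) e] onset_norm[OF ws(1) w] by (simp add: A_def)
      finally show "\<bar>(w \<bullet> (A *v e)) * (w \<bullet> y)\<bar> \<le> M * c"
        unfolding abs_mult using y[OF w] M_nonneg by (intro mult_mono) auto
    qed
    also have "\<dots> = real (card (set ws)) * (M * c)" by simp
    also have "\<dots> \<le> real k * (M * c)"
      using ws(3) distinct_card[OF ws(2)] M_nonneg c by (intro mult_right_mono) auto
    finally show ?thesis by (simp add: mult_ac)
  qed
  \<comment> \<open>The projection is moved from \<open>e\<close> to \<open>w\<close>, where the
    hypothesis on the defect applies.\<close>
  have dw: "\<bar>w \<bullet> (e - gram V *v e)\<bar> \<le> \<eta>" if w: "w \<in> set ws" and e: "e \<in> E" for w e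
  proof -
    have "w \<bullet> (e - gram V *v e) = (w - gram V *v w) \<bullet> e" by (simp add: inner_diff_left inner_diff_right PV(2))
    also have "\<bar>\<dots>\<bar> \<le> defect w * norm e" unfolding defect_def by (rule Cauchy_Schwarz_ineq2)
    finally show ?thesis using \<eta>(1)[OF w] onset_norm[OF E(1) e] by simp
  qed
  have parts: "(A *v e) \<bullet> (e - gram V *v e) \<ge> \<mu> * (defect e)\<^sup>2"
    "(A *v e) \<bullet> (gram V *v e) \<le> - \<mu> * (norm (gram V *v e))\<^sup>2" for e
  proof -
    define n p where "n = gram V *v e" and "p = e - gram V *v e"
    have Ae: "A *v e = A *v p + A *v n" by (simp add: n_def p_def flip: matrix_vector_right_distrib)
    have np: "(A *v n) \<bullet> p = 0" "(A *v p) \<bullet> n = 0"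
    proof -
      have "(A *v n) \<bullet> p = (gram V *v (A *v e)) \<bullet> p" by (simp add: n_def A_def V_commute)
      also have "\<dots> = 0" unfolding PV(2) p_def defect_split(2) by simp
      finally show "(A *v n) \<bullet> p = 0" .
      then show "(A *v p) \<bullet> n = 0" by (metis inner_commute sym)
    qed
    have "\<mu> * (norm p)\<^sup>2 \<le> p \<bullet> (A *v p)" unfolding A_def by (rule V_high) (simp add: p_def defect_split)
    then show "(A *v e) \<bullet> (e - gram V *v e) \<ge> \<mu> * (defect e)\<^sup>2"
      unfolding defect_def p_def[symmetric] Ae inner_add_left np by (simp add: inner_commute)
    have "n \<bullet> (A *v n) \<le> - \<mu> * (norm n)\<^sup>2" unfolding A_def by (rule V_low) (simp add: n_def PV(1))
    then show "(A *v e) \<bullet> (gram V *v e) \<le> - \<mu> * (norm (gram V *v e))\<^sup>2"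
      unfolding n_def[symmetric] Ae inner_add_left np by (simp add: inner_commute)
  qed
  have pe: "e \<bullet> (e - gram V *v e) = (defect e)\<^sup>2" "e \<bullet> (gram V *v e) = (norm (gram V *v e))\<^sup>2" for e
    using PV(1)[of e] PV(2)[of e "gram V *v e"] PV(2)[of e e] defect_split(1)[of e]
    by (simp_all add: defect_def power2_norm_eq_inner inner_diff_left inner_diff_right inner_commute)
  show ?thesis
  proof (rule that[OF E(1)])
    show "span E = {y. \<forall>w\<in>set ws. w \<bullet> y = 0}" using E(2) by (simp add: W_def)
    show ev: "e \<bullet> (hess f x *v y) = \<theta> e * (e \<bullet> y)" if e: "e \<in> E" and y: "\<forall>w\<in>set ws. w \<bullet> y = 0" for e y
    proof -
      have "y \<in> W" using y by (simp add: W_def)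
      from Tin[OF this, of e] E(3)[OF e] sym[of e y] show ?thesis by (simp add: A_def)
    qed
    show "\<mu> * (defect e)\<^sup>2 \<le> M * real k * \<eta>" if e: "e \<in> E" "\<theta> e < 0" for e
    proof -
      have "\<mu> * (defect e)\<^sup>2 \<le> \<theta> e * (defect e)\<^sup>2 + (\<Sum>w\<in>set ws. (w \<bullet> (A *v e)) * (w \<bullet> (e - gram V *v e)))"
        using parts(1)[of e] unfolding Ae[OF e(1)] pe .
      moreover have "\<theta> e * (defect e)\<^sup>2 \<le> 0" using e(2) by (simp add: mult_nonpos_nonneg)
      moreover have "\<bar>\<Sum>w\<in>set ws. (w \<bullet> (A *v e)) * (w \<bullet> (e - gram V *v e))\<bar> \<le> M * real k * \<eta>"
        by (rule sum_bound[OF e(1) dw[OF _ e(1)] \<eta>(2)])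
      ultimately show ?thesis by linarith
    qed
    show "\<mu> / 2 \<le> \<bar>\<theta> e\<bar>" if e: "e \<in> E" for e
    proof -
      define y where "y = (e - gram V *v e) - gram V *v e"
      have ne: "(norm (gram V *v e))\<^sup>2 + (defect e)\<^sup>2 = 1" using defect_split(3)[of e] onset_norm[OF E(1) e] by simp
      have iy: "z \<bullet> y = z \<bullet> (e - gram V *v e) - z \<bullet> (gram V *v e)" for z
        unfolding y_def by (rule inner_diff_right)
      have "\<mu> * 1 \<le> (A *v e) \<bullet> y"
        unfolding ne[symmetric] iy distrib_left using parts[of e] by linarith
      also have "(A *v e) \<bullet> y = \<theta> e * (e \<bullet> y) + (\<Sum>w\<in>set ws. (w \<bullet> (A *v e)) * (w \<bullet> y))" by (rule Ae[OF e])
      \<comment> \<open>Since \<open>w\<close> is orthogonal to \<open>e\<close>, its product with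
        the reflected vector is twice the one with \<open>e - gram V *v e\<close>. The resulting
        \<open>2 * \<eta>\<close> explains the factor 4 in the hypothesis on \<eta>, which leaves
        \<open>\<mu> / 2\<close>.\<close>
      also have "\<bar>\<Sum>w\<in>set ws. (w \<bullet> (A *v e)) * (w \<bullet> y)\<bar> \<le> M * real k * (2 * \<eta>)"
      proof (rule sum_bound[OF e])
        fix w assume w: "w \<in> set ws"
        have "w \<bullet> e = 0" using EW[OF e] w by (simp add: W_def)
        then have "w \<bullet> y = 2 * (w \<bullet> (e - gram V *v e))"
          unfolding iy using inner_diff_right[of w e "gram V *v e"] by linarith
        then show "\<bar>w \<bullet> y\<bar> \<le> 2 * \<eta>" using dw[OF w e] by (simp add: abs_mult)
      qed (use \<eta> in simp)
      then have "(\<Sum>w\<in>set ws. (w \<bullet> (A *v e)) * (w \<bullet> y)) \<le> \<mu> / 2" using \<eta>(3) by linarith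
      finally have m: "\<mu> / 2 \<le> \<theta> e * (e \<bullet> y)" by linarith
      have "e \<bullet> y = (defect e)\<^sup>2 - (norm (gram V *v e))\<^sup>2"
        unfolding iy pe ..
      then have "\<bar>e \<bullet> y\<bar> \<le> 1" using ne zero_le_power2[of "defect e"] zero_le_power2[of "norm (gram V *v e)"] by linarith
      then have "\<bar>\<theta> e\<bar> * \<bar>e \<bullet> y\<bar> \<le> \<bar>\<theta> e\<bar> * 1" by (intro mult_left_mono) auto
      then show ?thesis using m abs_ge_self[of "\<theta> e * (e \<bullet> y)"] by (simp add: abs_mult)
    qed
    \<comment> \<open>Fewer than \<open>k\<close> conditions cut out \<open>W\<close>, so it
      contains a nonzero vector of the \<open>k\<close>-dimensional span of \<open>V\<close>, where
      the form is negative. If no compressed eigenvalue were negative, the form would be nonnegative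
      on \<open>W\<close>.\<close>
    have "\<exists>e\<in>E. \<theta> e < 0"
    proof (rule ccontr)
      assume no: "\<not> ?thesis"
      have dW: "dim W + dim (span (set ws)) = DIM(real^'n)"
      proof -
        have "W = {y. \<forall>u\<in>span (set ws). orthogonal u y}"
        proof (intro set_eqI iffI)
          fix y assume "y \<in> W"
          then have "orthogonal y u" if "u \<in> span (set ws)" for u
            using orthogonal_to_span[OF that, of y] by (auto simp: W_def orthogonal_def inner_commute)
          then show "y \<in> {y. \<forall>u\<in>span (set ws). orthogonal u y}" by (auto simp: orthogonal_commute)
        qed (auto simp: W_def orthogonal_def span_base)
        then show ?thesis using dim_subspace_orthogonal_to_vectors[of "span (set ws)" UNIV] by simp
      qed
      have "dim (span (set ws)) = length ws" using onset_dim_span[OF ws(1)] distinct_card[OF ws(2)] by simp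
      moreover have "dim (span (set V)) = k" using onset_dim_span[OF V(1)] distinct_card[OF V(2)] V(3) by simp
      moreover have "dim {a + b |a b. a \<in> span (set V) \<and> b \<in> W} + dim (span (set V) \<inter> W) = dim (span (set V)) + dim W"
        by (rule dim_sums_Int[OF subspace_span W])
      moreover have "dim {a + b |a b. a \<in> span (set V) \<and> b \<in> W} \<le> DIM(real^'n)" by (rule dim_subset_UNIV)
      ultimately have "dim (span (set V) \<inter> W) \<noteq> 0" using dW ws(3) by linarith
      then have "\<not> span (set V) \<inter> W \<subseteq> {0}" by (simp only: dim_eq_0 not_False_eq_True)
      then obtain u where u: "u \<in> span (set V)" "u \<in> W" "u \<noteq> 0" by auto
      have uE: "u \<in> span E" "\<forall>w\<in>set ws. w \<bullet> u = 0" using u E(2) by (auto simp: W_def)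
      have "u \<bullet> (A *v u) = (\<Sum>e\<in>E. (e \<bullet> u) *\<^sub>R e) \<bullet> (A *v u)" using onset_expand[OF E(1) uE(1)] by simp
      also have "\<dots> = (\<Sum>e\<in>E. \<theta> e * (e \<bullet> u)\<^sup>2)"
        unfolding inner_sum_left A_def by (intro sum.cong refl) (simp add: ev[OF _ uE(2)] power2_eq_square)
      also have "0 \<le> \<dots>" using no by (intro sum_nonneg mult_nonneg_nonneg) (auto simp: not_less)
      finally have "0 \<le> u \<bullet> (A *v u)" .
      moreover have "u \<bullet> (A *v u) \<le> - \<mu> * (norm u)\<^sup>2" unfolding A_def using u PV(3) by (intro V_low) auto
      moreover have "0 < \<mu> * (norm u)\<^sup>2" using \<mu> u by simp
      ultimately show False by linarith
    qed
    then show "(SOME e. e \<in> E \<and> \<theta> e < 0) \<in> E" "\<theta> (SOME e. e \<in> E \<and> \<theta> e < 0) < 0"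
      by (metis (mono_tags, lifting) someI_ex)+
  qed
qed

text \<open>Expand \<open>u\<close> in \<open>E\<close>. The part along nonnegative eigenvalues has
  length \<open>sqrt (1 - a)\<close> and the projection does not enlarge it; each of the at most
  \<open>CARD('n)\<close> remaining terms has defect at most \<open>c\<close>.\<close>

lemma defect_bound:
  assumes E: "onset E" and u: "u \<in> span E" "norm u = 1" and c: "\<And>e. e \<in> E \<Longrightarrow> \<theta> e < (0::real) \<Longrightarrow> defect e \<le> c" "0 \<le> c"
  shows "defect u \<le> real CARD('n) * c + sqrt (1 - (\<Sum>e\<in>{e\<in>E. \<theta> e < 0}. (e \<bullet> u)\<^sup>2))"
proof -
  define En where "En = {e\<in>E. \<theta> e < 0}"
  have fin: "finite E" by (rule onset_finite[OF E])
  have EnE: "En \<subseteq> E" by (auto simp: En_def)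
  define d where "d y = y - gram V *v y" for y
  have lin: "linear d" unfolding d_def by (intro linear_compose_sub linear_id[unfolded id_def] matrix_vector_mul_linear)
  define p where "p = (\<Sum>e\<in>E - En. (e \<bullet> u) *\<^sub>R e)"
  have "u = p + (\<Sum>e\<in>En. (e \<bullet> u) *\<^sub>R e)"
    using onset_expand[OF E u(1)] sum.subset_diff[OF EnE fin, of "\<lambda>e. (e \<bullet> u) *\<^sub>R e"] by (simp add: p_def)
  then have "d u = d p + (\<Sum>e\<in>En. (e \<bullet> u) *\<^sub>R d e)"
    by (metis (no_types, lifting) linear_add[OF lin] linear_sum[OF lin] linear_scale[OF lin] sum.cong)
  then have "norm (d u) \<le> norm (d p) + norm (\<Sum>e\<in>En. (e \<bullet> u) *\<^sub>R d e)" by (simp add: norm_triangle_ineq)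
  also have "norm (d p) \<le> norm p" using defect_le[of p] by (simp add: d_def defect_def)
  also have "norm p = sqrt (1 - (\<Sum>e\<in>En. (e \<bullet> u)\<^sup>2))"
  proof -
    have "p \<bullet> p = (\<Sum>e\<in>E - En. (e \<bullet> u) * (e \<bullet> u))"
      unfolding p_def by (rule onset_inner_sums[OF onset_subset[OF E]]) auto
    also have "\<dots> = 1 - (\<Sum>e\<in>En. (e \<bullet> u)\<^sup>2)"
      using onset_parseval[OF E u(1)] u(2) sum.subset_diff[OF EnE fin, of "\<lambda>e. (e \<bullet> u)\<^sup>2"] by (simp add: power2_eq_square)
    finally show ?thesis by (simp add: norm_eq_sqrt_inner)
  qed
  also have "norm (\<Sum>e\<in>En. (e \<bullet> u) *\<^sub>R d e) \<le> (\<Sum>e\<in>En. norm ((e \<bullet> u) *\<^sub>R d e))" by (rule norm_sum)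
  also have "\<dots> \<le> (\<Sum>e\<in>En. 1 * c)"
  proof (rule sum_mono)
    fix e assume e: "e \<in> En"
    have "\<bar>e \<bullet> u\<bar> \<le> 1" using Cauchy_Schwarz_ineq2[of e u] onset_norm[OF E, of e] e u by (auto simp: En_def)
    moreover have "norm (d e) \<le> c" using c(1)[of e] e by (simp add: En_def defect_def d_def)
    ultimately show "norm ((e \<bullet> u) *\<^sub>R d e) \<le> 1 * c" unfolding norm_scaleR by (intro mult_mono) auto
  qed
  also have "\<dots> = real (card En) * c" by simp
  also have "\<dots> \<le> real CARD('n) * c"
  proof -
    have "card En \<le> card E" using fin EnE by (rule card_mono)
    also have "\<dots> \<le> CARD('n)" using onset_dim_span[OF E] dim_subset_UNIV[of "span E"] by simp
    finally show ?thesis using c(2) by (intro mult_right_mono) auto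
  qed
  finally show ?thesis by (simp add: En_def d_def defect_def)
qed

end

lemma (in markov_steps) oprs_bounds:
  assumes "test_fn \<phi>" "\<And>u. u \<in> S \<Longrightarrow> 0 \<le> \<phi> u \<and> \<phi> u \<le> 1" "u \<in> S"
  shows "0 \<le> oprs i m \<phi> u" "oprs i m \<phi> u \<le> 1"
proof -
  have t: "test_fn (\<lambda>_. e)" for e by (auto simp: test_fn_def)
  have c: "oprs i m (\<lambda>_. e) u = e" for e
    using oprs_affine[OF assms(1) assms(1,3), of i m 0 0 e] by simp
  show "0 \<le> oprs i m \<phi> u" using oprs_mono[OF t assms(1) _ assms(3), of 0 i m] assms(2) c by simp
  show "oprs i m \<phi> u \<le> 1" using oprs_mono[OF assms(1) t _ assms(3), of 1 i m] assms(2) c by simp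
qed

lemma inner_outer: "outer u u \<bullet> outer v v = (u \<bullet> v)\<^sup>2" for u v :: "real^'n::finite"
proof -
  have "outer u u \<bullet> outer v v = (\<Sum>i\<in>UNIV. \<Sum>j\<in>UNIV. (u $ i * v $ i) * (u $ j * v $ j))"
    by (simp add: inner_vec_def outer_def mult_ac)
  also have "\<dots> = (u \<bullet> v)\<^sup>2" by (simp add: inner_vec_def power2_eq_square sum_product)
  finally show ?thesis .
qed

lemma mat_norm_le_norm: "mat_norm A \<le> norm A" for A :: "real^'n::finite^'n"
  unfolding mat_norm_def
proof (rule onorm_le)
  fix y
  have "norm (A *v y) = L2_set (\<lambda>i. norm ((A *v y) $ i)) UNIV" by (simp add: norm_vec_def)
  also have "\<dots> \<le> L2_set (\<lambda>i. norm (A $ i) * norm y) UNIV"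
    by (intro L2_set_mono) (auto simp: matrix_vector_mul_component Cauchy_Schwarz_ineq2)
  also have "\<dots> = norm A * norm y" by (simp add: L2_set_left_distrib norm_vec_def)
  finally show "norm (A *v y) \<le> norm A * norm y" .
qed

lemma gram_set: "distinct ws \<Longrightarrow> gram ws = (\<Sum>w\<in>set ws. outer w w)"
  unfolding gram_def by (rule sum_list_distinct_conv_sum_set)

context search_saddle
begin

lemma borel_measurable_defect [measurable]:
  assumes [measurable]: "u \<in> borel_measurable Q" shows "(\<lambda>\<omega>. defect (u \<omega>)) \<in> borel_measurable Q"
  unfolding defect_def by measurable

text \<open>Computed in the Frobenius norm, which is \<open>norm\<close> on matrices and dominates
  \<open>mat_norm\<close>. For two orthogonal projections of rank \<open>k\<close> its square is
  twice the sum of the squared defects.\<close>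

lemma gram_close:
  assumes ws: "onset (set ws)" "distinct ws" "length ws = k" and \<eta>: "\<And>w. w \<in> set ws \<Longrightarrow> defect w \<le> \<eta>" "0 \<le> \<eta>"
  shows "mat_norm (gram ws - gram V) \<le> sqrt (2 * real k) * \<eta>"
proof -
  have self: "gram U \<bullet> gram U = real (length U)" if "onset (set U)" "distinct U" for U :: "(real^'n) list"
  proof -
    have "gram U \<bullet> gram U = (\<Sum>a\<in>set U. \<Sum>b\<in>set U. (a \<bullet> b)\<^sup>2)"
      unfolding gram_set[OF that(2)] inner_sum_left unfolding inner_sum_right inner_outer ..
    also have "\<dots> = (\<Sum>a\<in>set U. \<Sum>b\<in>set U. if b = a then 1 else 0)"
      using that(1) by (intro sum.cong refl) (auto simp: onset_def)
    finally show ?thesis using distinct_card[OF that(2)] by simp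
  qed
  have "gram ws \<bullet> gram V = (\<Sum>w\<in>set ws. \<Sum>v\<in>set V. (w \<bullet> v)\<^sup>2)"
    unfolding gram_set[OF ws(2)] gram_set[OF V(2)] inner_sum_left unfolding inner_sum_right inner_outer ..
  also have "\<dots> = (\<Sum>w\<in>set ws. 1 - (defect w)\<^sup>2)"
  proof (rule sum.cong[OF refl])
    fix w assume "w \<in> set ws"
    then have "(norm w)\<^sup>2 = 1" using onset_norm[OF ws(1)] by simp
    moreover have "(norm (gram V *v w))\<^sup>2 = (\<Sum>v\<in>set V. (v \<bullet> w)\<^sup>2)"
      unfolding gram_mult[OF V(2)] power2_norm_eq_inner onset_inner_sums[OF V(1)] by (simp add: power2_eq_square)
    ultimately show "(\<Sum>v\<in>set V. (w \<bullet> v)\<^sup>2) = 1 - (defect w)\<^sup>2"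
      using defect_split(3)[of w] by (simp add: inner_commute)
  qed
  also have "\<dots> = real k - (\<Sum>w\<in>set ws. (defect w)\<^sup>2)" using distinct_card[OF ws(2)] ws(3) by (simp add: sum_subtractf)
  finally have cross: "gram ws \<bullet> gram V = real k - (\<Sum>w\<in>set ws. (defect w)\<^sup>2)" .
  have "(norm (gram ws - gram V))\<^sup>2 = 2 * (\<Sum>w\<in>set ws. (defect w)\<^sup>2)"
    using self[OF ws(1,2)] self[OF V(1,2)] cross ws(3) V(3)
    by (simp add: power2_norm_eq_inner inner_diff_left inner_diff_right inner_commute[of "gram V" "gram ws"])
  also have "\<dots> \<le> 2 * (\<Sum>w\<in>set ws. \<eta>\<^sup>2)"
    using \<eta> by (intro mult_left_mono sum_mono power_mono) (auto simp: defect_def)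
  also have "\<dots> = (sqrt (2 * real k) * \<eta>)\<^sup>2" using distinct_card[OF ws(2)] ws(3) by (simp add: power_mult_distrib)
  finally have "norm (gram ws - gram V) \<le> sqrt (2 * real k) * \<eta>"
    by (rule power2_le_imp_le) (use \<eta> in simp)
  then show ?thesis using mat_norm_le_norm order_trans by blast
qed

text \<open>Markov's inequality on top of \<open>gap_chain_uniform\<close>. A defect above
  \<epsilon> forces \<open>1 - a\<close> to be at least \<open>\<epsilon>\<^sup>2 / 4\<close>, since
  the eigenvectors themselves account for at most \<open>\<epsilon> / 2\<close>. Both the tolerance
  \<eta> for the predecessors and the time \<open>N0\<close> are fixed before the
  predecessors.\<close>

lemma loop_uniform:
  assumes sum: "\<not> summable \<alpha>" "summable (\<lambda>n. (\<alpha> n)\<^sup>2)" and \<epsilon>: "0 < \<epsilon>"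
  obtains \<eta> N0 where "0 < \<eta>"
    "\<And>N ws u. N0 \<le> N \<Longrightarrow> onset (set ws) \<Longrightarrow> distinct ws \<Longrightarrow> length ws < k \<Longrightarrow> (\<And>w. w \<in> set ws \<Longrightarrow> defect w \<le> \<eta>) \<Longrightarrow>
      norm u = 1 \<Longrightarrow> (\<forall>w\<in>set ws. w \<bullet> u = 0) \<Longrightarrow>
      markov_steps.oprs std_gaussian (search_step (gram ws)) N 0 (indicat_real {y. \<epsilon> < defect y}) u \<le> \<epsilon>"
proof -
  obtain n\<^sub>0 where small: "small_from n\<^sub>0" using small_from_exists[OF sum(2)] by blast
  have C0: "0 \<le> C"
  proof -
    have "0 \<le> 12 * c1\<^sup>2 * K 10" using K_nonneg by simp
    then show ?thesis by (simp add: C_def)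
  qed
  have "0 < \<epsilon> * (\<epsilon>\<^sup>2 / 4)" "0 < \<mu>\<^sup>2 / 4" "0 < 2 * \<mu>" using \<epsilon> \<mu> by auto
  from gap_chain_uniform[OF \<alpha> sum this(2) C0 this(3,1), of "std_gaussian :: (real^'n) measure" n\<^sub>0]
  obtain N0 where N0: "\<And>N (step :: nat \<Rightarrow> real^'n \<Rightarrow> real^'n \<Rightarrow> real^'n) S a u. N0 \<le> N \<Longrightarrow>
    gap_chain std_gaussian step S a \<alpha> (2 * \<mu>) (\<mu>\<^sup>2 / 4) C n\<^sub>0 \<Longrightarrow> u \<in> S \<Longrightarrow>
    markov_steps.oprs std_gaussian step N 0 (\<lambda>u. 1 - a u) u \<le> \<epsilon> * (\<epsilon>\<^sup>2 / 4)" by blast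
  \<comment> \<open>The tolerance \<open>c\<close> for each negative eigenvector adds up to
    \<open>\<epsilon> / 2\<close> over the dimension. The first entry of \<eta> meets the hypothesis
    of \<open>deflated_spectrum\<close>, the second makes its conclusion give a defect at most
    \<open>c\<close>; the summands 1 keep the denominators positive.\<close>
  define c where "c = \<epsilon> / (2 * real CARD('n))"
  define D where "D = M * real k"
  define \<eta> where "\<eta> = min (\<mu> / (4 * D + 1)) (c\<^sup>2 * \<mu> / (D + 1))"
  have c: "0 < c" "real CARD('n) * c = \<epsilon> / 2" using \<epsilon> by (auto simp: c_def)
  have D: "0 \<le> D" using M_nonneg by (simp add: D_def)
  have \<eta>: "0 < \<eta>" using \<mu> c D by (simp add: \<eta>_def)
  have "\<eta> * (4 * D + 1) \<le> \<mu>" "\<eta> * (D + 1) \<le> c\<^sup>2 * \<mu>"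
    using D by (auto simp: \<eta>_def pos_le_divide_eq[symmetric] min.coboundedI1 min.coboundedI2)
  then have \<eta>1: "4 * M * real k * \<eta> \<le> \<mu>" and \<eta>2: "M * real k * \<eta> \<le> c\<^sup>2 * \<mu>"
    using \<eta> by (simp_all add: D_def algebra_simps)
  show ?thesis
  proof (rule that[OF \<eta>])
    fix N ws u
    assume N: "N0 \<le> N" and ws: "onset (set ws)" "distinct ws" "length ws < k"
      and df: "\<And>w. w \<in> set ws \<Longrightarrow> defect w \<le> \<eta>" and u: "norm u = 1" "\<forall>w\<in>set ws. w \<bullet> u = 0"
    obtain E \<theta> e\<^sub>0 where E: "onset E" "span E = {y. \<forall>w\<in>set ws. w \<bullet> y = 0}"
      and ev: "\<And>e y. e \<in> E \<Longrightarrow> (\<forall>w\<in>set ws. w \<bullet> y = 0) \<Longrightarrow> e \<bullet> (hess f x *v y) = \<theta> e * (e \<bullet> y)"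
      and gap: "\<And>e. e \<in> E \<Longrightarrow> \<mu> / 2 \<le> \<bar>\<theta> e\<bar>" and e0: "e\<^sub>0 \<in> E" "\<theta> e\<^sub>0 < 0"
      and de: "\<And>e. e \<in> E \<Longrightarrow> \<theta> e < 0 \<Longrightarrow> \<mu> * (defect e)\<^sup>2 \<le> M * real k * \<eta>"
      by (rule deflated_spectrum[OF ws df less_imp_le[OF \<eta>] \<eta>1], assumption, rule that)
    define S where "S = {u. norm u = 1 \<and> (\<forall>w\<in>set ws. w \<bullet> u = 0)}"
    define a where "a = (\<lambda>u. \<Sum>e\<in>{e\<in>E. \<theta> e < 0}. (e \<bullet> u)\<^sup>2)"
    have ch: "gap_chain std_gaussian (search_step (gram ws)) S a \<alpha> (2 * \<mu>) (\<mu>\<^sup>2 / 4) C n\<^sub>0"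
      unfolding S_def a_def by (rule gap_chain_search[OF ws(1,2) E ev gap e0 small])
    interpret gap_chain std_gaussian "search_step (gram ws)" S a \<alpha> "2 * \<mu>" "\<mu>\<^sup>2 / 4" C n\<^sub>0 by (rule ch)
    have uS: "u \<in> S" using u by (simp add: S_def)
    have dc: "defect e \<le> c" if "e \<in> E" "\<theta> e < 0" for e
    proof (rule power2_le_imp_le)
      have "\<mu> * (defect e)\<^sup>2 \<le> \<mu> * c\<^sup>2" using de[OF that] \<eta>2 by (simp add: mult.commute)
      then show "(defect e)\<^sup>2 \<le> c\<^sup>2" using \<mu> by simp
    qed (use c in simp)
    have "indicat_real {y. \<epsilon> < defect y} y \<le> 4 / \<epsilon>\<^sup>2 * (1 - a y)" if y: "y \<in> S" for y
    proof (cases "\<epsilon> < defect y")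
      case True
      have "y \<in> span E" "norm y = 1" using y E(2) by (auto simp: S_def)
      from defect_bound[OF E(1) this dc] c have "defect y \<le> \<epsilon> / 2 + sqrt (1 - a y)" by (simp add: a_def)
      then have "\<epsilon> / 2 \<le> sqrt (1 - a y)" using True by simp
      then have "(\<epsilon> / 2)\<^sup>2 \<le> (sqrt (1 - a y))\<^sup>2" using \<epsilon> by (intro power_mono) auto
      then have "\<epsilon>\<^sup>2 / 4 \<le> 1 - a y" using a_range[OF y] by (simp add: power_divide)
      then show ?thesis using \<epsilon> True by (simp add: field_simps)
    next
      case False
      then show ?thesis using a_range[OF y] by simp
    qed
    moreover have ti: "test_fn (indicat_real {y. \<epsilon> < defect y})"
      unfolding test_fn_def by (auto intro!: exI[of _ 1] simp: indicator_def)
    moreover have "test_fn (\<lambda>u. 4 / \<epsilon>\<^sup>2 * (1 - a u))"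
      using test_fn_affine[OF test_1_a test_1_a, of "4 / \<epsilon>\<^sup>2" 0 0] by simp
    ultimately have "oprs N 0 (indicat_real {y. \<epsilon> < defect y}) u \<le> oprs N 0 (\<lambda>u. 4 / \<epsilon>\<^sup>2 * (1 - a u)) u"
      using uS by (intro oprs_mono) auto
    also have "\<dots> = 4 / \<epsilon>\<^sup>2 * oprs N 0 (\<lambda>u. 1 - a u) u" by (rule oprs_cmult[OF test_1_a uS])
    also have "\<dots> \<le> 4 / \<epsilon>\<^sup>2 * (\<epsilon> * (\<epsilon>\<^sup>2 / 4))" using N0[OF N ch uS] by (intro mult_left_mono) auto
    also have "\<dots> = \<epsilon>" using \<epsilon> by simp
    finally show "oprs N 0 (indicat_real {y. \<epsilon> < defect y}) u \<le> \<epsilon>" .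
  qed
qed

section \<open>From transition operators to random iterates\<close>

abbreviation "tr G \<equiv> markov_steps.oprs std_gaussian (search_step G)"

text \<open>The state space is everything, so that \<open>tr G\<close> is available for every matrix
  \<open>G\<close> and every start. This matters once \<open>G\<close> is random; the operators
  themselves do not depend on the choice of \<open>S\<close>.\<close>

lemma markov_search: "markov_steps (std_gaussian :: (real^'n) measure) (search_step G) UNIV"
proof -
  interpret prob_space "std_gaussian :: (real^'n) measure" by (rule prob_space_std_gaussian)
  show ?thesis
  proof unfold_locales
    show "(\<lambda>p. search_step G n (fst p) (snd p)) \<in> borel \<Otimes>\<^sub>M std_gaussian \<rightarrow>\<^sub>M borel" for n by measurable
  qed simp
qed

lemma tr_simps: "tr G 0 m \<phi> = \<phi>" "tr G (Suc i) m \<phi> u = (\<integral>z. tr G i (Suc m) \<phi> (search_step G m u z) \<partial>std_gaussian)"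
  by (simp_all add: markov_steps.oprs.simps[OF markov_search] markov_steps.opr_def[OF markov_search])

text \<open>Joint measurability in the matrix and the state, because the predecessors, and with them
  the matrix, are random when the operator is applied.\<close>

lemma tr_measurable:
  assumes "\<phi> \<in> borel_measurable borel"
  shows "(\<lambda>p. tr (fst p) i m \<phi> (snd p)) \<in> borel_measurable (borel \<Otimes>\<^sub>M borel)"
proof (induction i arbitrary: m)
  case 0
  then show ?case using assms by (simp add: tr_simps)
next
  case (Suc i)
  interpret prob_space "std_gaussian :: (real^'n) measure" by (rule prob_space_std_gaussian)
  have "(\<lambda>q. (fst (fst q), search_step (fst (fst q)) m (snd (fst q)) (snd q))) \<in> (borel \<Otimes>\<^sub>M borel) \<Otimes>\<^sub>M std_gaussian \<rightarrow>\<^sub>M borel \<Otimes>\<^sub>M borel"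
    by measurable
  from measurable_compose[OF this Suc.IH[of "Suc m"]]
  have "(\<lambda>q. tr (fst (fst q)) i (Suc m) \<phi> (search_step (fst (fst q)) m (snd (fst q)) (snd q))) \<in> borel_measurable ((borel \<Otimes>\<^sub>M borel) \<Otimes>\<^sub>M std_gaussian)"
    by simp
  then show ?case unfolding tr_simps
    by (intro borel_measurable_lebesgue_integral) (simp add: split_def)
qed

lemma tr_bounds:
  assumes "\<phi> \<in> borel_measurable borel" "\<And>u. 0 \<le> \<phi> u \<and> \<phi> u \<le> 1"
  shows "0 \<le> tr G i m \<phi> u" "tr G i m \<phi> u \<le> 1"
proof -
  interpret markov_steps std_gaussian "search_step G" UNIV by (rule markov_search)
  have "test_fn \<phi>" using assms by (auto simp: test_fn_def intro!: exI[of _ 1])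
  from oprs_bounds[OF this] assms(2) show "0 \<le> tr G i m \<phi> u" "tr G i m \<phi> u \<le> 1" by auto
qed

text \<open>The weight \<open>b\<close> is the indicator of the event that the earlier directions are good; it depends on the past only.\<close>
lemma expectation_step:
  fixes b :: "'w \<Rightarrow> real" and G :: "'w \<Rightarrow> real^'n^'n" and Y R :: "'w \<Rightarrow> real^'n"
  assumes P: "prob_space P"
    and Ym: "(\<lambda>\<omega>. (b \<omega>, G \<omega>, Y \<omega>)) \<in> P \<rightarrow>\<^sub>M borel \<Otimes>\<^sub>M (borel \<Otimes>\<^sub>M borel)" and Rm: "R \<in> P \<rightarrow>\<^sub>M borel"
    and D: "distr P (borel \<Otimes>\<^sub>M (borel \<Otimes>\<^sub>M borel)) (\<lambda>\<omega>. (b \<omega>, G \<omega>, Y \<omega>)) \<Otimes>\<^sub>M std_gaussian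
      = distr P ((borel \<Otimes>\<^sub>M (borel \<Otimes>\<^sub>M borel)) \<Otimes>\<^sub>M borel) (\<lambda>\<omega>. ((b \<omega>, G \<omega>, Y \<omega>), R \<omega>))"
    and b: "\<And>\<omega>. 0 \<le> b \<omega> \<and> b \<omega> \<le> 1"
    and \<phi>: "\<phi> \<in> borel_measurable borel" "\<And>u. 0 \<le> \<phi> u \<and> \<phi> u \<le> 1"
  shows "(\<integral>\<omega>. b \<omega> * tr (G \<omega>) (Suc i) m \<phi> (Y \<omega>) \<partial>P) = (\<integral>\<omega>. b \<omega> * tr (G \<omega>) i (Suc m) \<phi> (search_step (G \<omega>) m (Y \<omega>) (R \<omega>)) \<partial>P)"
proof -
  interpret prob_space P by (rule P)
  let ?B = "borel \<Otimes>\<^sub>M (borel \<Otimes>\<^sub>M borel) :: (real \<times> (real^'n^'n) \<times> (real^'n)) measure"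
  let ?Y = "\<lambda>\<omega>. (b \<omega>, G \<omega>, Y \<omega>)"
  \<comment> \<open>Truncation to the unit interval makes \<psi> bounded on the whole product space
    without changing it on the values of \<open>b\<close>.\<close>
  define cl where "cl t = max 0 (min 1 t)" for t :: real
  have cl: "0 \<le> cl t" "cl t \<le> 1" "cl (b \<omega>) = b \<omega>" for t \<omega> using b[of \<omega>] by (auto simp: cl_def)
  define \<psi> where "\<psi> q = cl (fst (fst q)) * tr (fst (snd (fst q))) i (Suc m) \<phi> (search_step (fst (snd (fst q))) m (snd (snd (fst q))) (snd q))" for q
  have "(\<lambda>q. (fst (snd (fst q)), search_step (fst (snd (fst q))) m (snd (snd (fst q))) (snd q))) \<in> ?B \<Otimes>\<^sub>M borel \<rightarrow>\<^sub>M borel \<Otimes>\<^sub>M borel"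
    by measurable
  from measurable_compose[OF this tr_measurable[OF \<phi>(1), of i "Suc m"]]
  have [measurable]: "(\<lambda>q. tr (fst (snd (fst q))) i (Suc m) \<phi> (search_step (fst (snd (fst q))) m (snd (snd (fst q))) (snd q))) \<in> borel_measurable (?B \<Otimes>\<^sub>M borel)"
    by simp
  have \<psi>m: "\<psi> \<in> borel_measurable (?B \<Otimes>\<^sub>M borel)" unfolding \<psi>_def cl_def by measurable
  have \<psi>b: "\<bar>\<psi> q\<bar> \<le> 1" for q
    unfolding \<psi>_def abs_mult using cl(1,2) tr_bounds[OF \<phi>] by (intro mult_le_one) auto
  interpret Y: prob_space "distr P ?B ?Y" by (rule prob_space_distr[OF Ym])
  interpret g: prob_space "std_gaussian :: (real^'n) measure" by (rule prob_space_std_gaussian)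
  interpret pair_prob_space "distr P ?B ?Y" "std_gaussian :: (real^'n) measure" ..
  have int\<psi>: "integrable (distr P ?B ?Y \<Otimes>\<^sub>M std_gaussian) \<psi>"
    by (rule P.integrable_const_bound[where B=1]) (use \<psi>b \<psi>m in auto)
  have "(\<integral>\<omega>. b \<omega> * tr (G \<omega>) i (Suc m) \<phi> (search_step (G \<omega>) m (Y \<omega>) (R \<omega>)) \<partial>P) = (\<integral>\<omega>. \<psi> (?Y \<omega>, R \<omega>) \<partial>P)"
    by (simp add: \<psi>_def cl)
  also have "\<dots> = (\<integral>q. \<psi> q \<partial>distr P (?B \<Otimes>\<^sub>M borel) (\<lambda>\<omega>. (?Y \<omega>, R \<omega>)))"
    by (rule integral_distr[symmetric]) (use Ym Rm \<psi>m in measurable)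
  also have "\<dots> = (\<integral>y. (\<integral>z. \<psi> (y, z) \<partial>std_gaussian) \<partial>distr P ?B ?Y)"
    unfolding D[symmetric] by (rule integral_fst'[OF int\<psi>, symmetric])
  also have "\<dots> = (\<integral>\<omega>. (\<integral>z. \<psi> (?Y \<omega>, z) \<partial>std_gaussian) \<partial>P)"
  proof (rule integral_distr[OF Ym])
    have "(\<lambda>(y, z). \<psi> (y, z)) \<in> borel_measurable (?B \<Otimes>\<^sub>M std_gaussian)" using \<psi>m by simp
    then show "(\<lambda>y. \<integral>z. \<psi> (y, z) \<partial>std_gaussian) \<in> borel_measurable ?B" by (rule g.borel_measurable_lebesgue_integral)
  qed
  also have "\<dots> = (\<integral>\<omega>. b \<omega> * tr (G \<omega>) (Suc i) m \<phi> (Y \<omega>) \<partial>P)"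
    by (simp add: \<psi>_def cl tr_simps)
  finally show ?thesis by simp
qed

end

section \<open>Almost sure convergence\<close>

locale random_search = search_saddle f M x \<mu> \<alpha> l L V k + prob_space P
  for f :: "real^'n::finite \<Rightarrow> real" and M x \<mu> \<alpha> l L V k and P :: "'w measure" +
  fixes r :: "nat \<Rightarrow> nat \<Rightarrow> 'w \<Rightarrow> real^'n" and v :: "nat \<Rightarrow> real^'n"
  assumes r_indep: "indep_vars (\<lambda>_. borel) (\<lambda>(j, n). r j n) ({..<k} \<times> UNIV)"
    and r_distr: "j < k \<Longrightarrow> distr P borel (r j n) = std_gaussian"
    and v_norm: "j < k \<Longrightarrow> norm (v j) = 1"
    and start_nonzero: "AE \<omega> in P. \<forall>N. \<forall>j\<in>{1..<k}.
      (mat 1 - gram (search_output f x \<alpha> l (\<lambda>j n. r j n \<omega>) v N j)) *v v j \<noteq> 0"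
    and \<alpha>_sums: "\<not> summable \<alpha>" "summable (\<lambda>n. (\<alpha> n)\<^sup>2)"
begin

definition out :: "nat \<Rightarrow> nat \<Rightarrow> 'w \<Rightarrow> (real^'n) list" where
  "out N j \<omega> = search_output f x \<alpha> l (\<lambda>j n. r j n \<omega>) v N j"

definition iter :: "nat \<Rightarrow> nat \<Rightarrow> nat \<Rightarrow> 'w \<Rightarrow> real^'n" where
  "iter N j m \<omega> = search_iter f x \<alpha> l (\<lambda>n. r j n \<omega>) (out N j \<omega>) (search_start (out N j \<omega>) (v j)) m"

definition good :: "nat \<Rightarrow> nat \<Rightarrow> real \<Rightarrow> 'w \<Rightarrow> bool" where
  "good N j \<eta> \<omega> \<longleftrightarrow> (\<forall>w\<in>set (out N j \<omega>). defect w \<le> \<eta>)"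

lemma out_Suc: "out N (Suc j) \<omega> = out N j \<omega> @ [iter N j (Suc N) \<omega>]"
  by (simp add: out_def iter_def Let_def)

lemma r_measurable: "j < k \<Longrightarrow> r j n \<in> borel_measurable P"
  using r_indep unfolding indep_vars_def by auto

lemma good_measurable:
  assumes "\<And>i n. i < j \<Longrightarrow> s i n \<in> borel_measurable Q"
  shows "(\<lambda>\<omega>. if \<forall>w\<in>set (search_output f x \<alpha> l (\<lambda>i n. s i n \<omega>) v N j). defect w \<le> \<eta> then 1 else 0 :: real) \<in> borel_measurable Q"
  using assms
proof (induction j)
  case (Suc j)
  let ?ws = "\<lambda>\<omega>. search_output f x \<alpha> l (\<lambda>i n. s i n \<omega>) v N j"
  let ?w = "\<lambda>\<omega>. search_iter f x \<alpha> l (\<lambda>n. s j n \<omega>) (?ws \<omega>) (search_start (?ws \<omega>) (v j)) (Suc N)"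
  have [measurable]: "(\<lambda>\<omega>. if \<forall>w\<in>set (?ws \<omega>). defect w \<le> \<eta> then 1 else 0 :: real) \<in> borel_measurable Q"
    using Suc by auto
  have [measurable]: "?w \<in> borel_measurable Q"
    by (intro search_iter_measurable search_start_measurable gram_search_output_measurable) (use Suc.prems in auto)
  have "(\<lambda>\<omega>. if \<forall>w\<in>set (search_output f x \<alpha> l (\<lambda>i n. s i n \<omega>) v N (Suc j)). defect w \<le> \<eta> then 1 else 0 :: real)
      = (\<lambda>\<omega>. (if \<forall>w\<in>set (?ws \<omega>). defect w \<le> \<eta> then 1 else 0) * (if defect (?w \<omega>) \<le> \<eta> then 1 else 0))"
    unfolding search_output.simps Let_def by (auto simp del: search_iter.simps)
  then show ?case by (simp del: search_output.simps search_iter.simps)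
qed simp

definition ind_good :: "nat \<Rightarrow> nat \<Rightarrow> real \<Rightarrow> 'w \<Rightarrow> real" where
  "ind_good N j \<eta> \<omega> = (if good N j \<eta> \<omega> then 1 else 0)"

lemma ind_good_measurable: "j \<le> k \<Longrightarrow> ind_good N j \<eta> \<in> borel_measurable P"
  unfolding ind_good_def[abs_def] good_def out_def by (rule good_measurable) (simp add: r_measurable)

lemma good_sets: "j \<le> k \<Longrightarrow> {\<omega>\<in>space P. \<not> good N j \<eta> \<omega>} \<in> sets P"
proof -
  assume "j \<le> k"
  note [measurable] = ind_good_measurable[OF this]
  have "{\<omega>\<in>space P. \<not> good N j \<eta> \<omega>} = {\<omega>\<in>space P. ind_good N j \<eta> \<omega> = 0}" by (auto simp: ind_good_def)
  also have "\<dots> \<in> sets P" by measurable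
  finally show ?thesis .
qed

lemma gram_out_measurable: "j \<le> k \<Longrightarrow> (\<lambda>\<omega>. gram (out N j \<omega>)) \<in> borel_measurable P"
  unfolding out_def by (rule gram_search_output_measurable) (simp add: r_measurable)

lemma iter_measurable: "j < k \<Longrightarrow> iter N j m \<in> borel_measurable P"
  unfolding iter_def[abs_def]
  by (intro search_iter_measurable search_start_measurable gram_out_measurable) (auto simp: r_measurable out_def)

text \<open>Before its update, the iterate is a function of past samples only, so the sample used
  for that update is independent of it, of the deflation matrix and of the good event. This is the
  hypothesis on laws in \<open>expectation_step\<close>.\<close>

lemma joint_law:
  fixes N m :: nat and \<eta> :: real
  assumes j: "j < k"
  defines "B \<equiv> borel \<Otimes>\<^sub>M (borel \<Otimes>\<^sub>M borel)" and "Y \<equiv> \<lambda>\<omega>. (ind_good N j \<eta> \<omega>, gram (out N j \<omega>), iter N j m \<omega>)"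
  shows "Y \<in> P \<rightarrow>\<^sub>M B" "distr P B Y \<Otimes>\<^sub>M std_gaussian = distr P (B \<Otimes>\<^sub>M borel) (\<lambda>\<omega>. (Y \<omega>, r j m \<omega>))"
proof -
  \<comment> \<open>The past consists of all samples of the earlier loops and the first
    \<open>m\<close> samples of loop \<open>j\<close>; sample \<open>m\<close> itself is
    fresh.\<close>
  define I1 where "I1 = {(i, n). i < j} \<union> {(i, n). i = j \<and> n < m}"
  define I2 where "I2 = {(j, m)}"
  let ?F = "\<lambda>(j, n). r j n"
  define X1 where "X1 \<omega> = restrict (\<lambda>i. ?F i \<omega>) I1" for \<omega>
  define X2 where "X2 \<omega> = restrict (\<lambda>i. ?F i \<omega>) I2" for \<omega>
  let ?P1 = "PiM I1 (\<lambda>_. borel :: (real^'n) measure)" and ?P2 = "PiM I2 (\<lambda>_. borel :: (real^'n) measure)"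
  have "indep_var ?P1 X1 ?P2 X2"
    unfolding X1_def X2_def by (rule indep_var_restrict[OF r_indep]) (use j in \<open>auto simp: I1_def I2_def\<close>)
  then have X: "X1 \<in> P \<rightarrow>\<^sub>M ?P1" "X2 \<in> P \<rightarrow>\<^sub>M ?P2"
    and law: "distr P ?P1 X1 \<Otimes>\<^sub>M distr P ?P2 X2 = distr P (?P1 \<Otimes>\<^sub>M ?P2) (\<lambda>\<omega>. (X1 \<omega>, X2 \<omega>))"
    unfolding indep_var_distribution_eq by auto
  define ws where "ws y = search_output f x \<alpha> l (\<lambda>i n. y (i, n)) v N j" for y :: "nat \<times> nat \<Rightarrow> real^'n"
  define g1 where "g1 y = (if \<forall>w\<in>set (ws y). defect w \<le> \<eta> then 1 else 0 :: real, gram (ws y),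
    search_iter f x \<alpha> l (\<lambda>n. y (j, n)) (ws y) (search_start (ws y) (v j)) m)" for y
  define g2 where "g2 y = y (j, m)" for y :: "nat \<times> nat \<Rightarrow> real^'n"
  have comp: "(\<lambda>y. y i) \<in> borel_measurable ?P1" if "i \<in> I1" for i using that by measurable
  have g1m: "g1 \<in> ?P1 \<rightarrow>\<^sub>M B"
  proof -
    have 1: "(\<lambda>y. if \<forall>w\<in>set (ws y). defect w \<le> \<eta> then 1 else 0 :: real) \<in> borel_measurable ?P1"
      unfolding ws_def by (rule good_measurable) (rule comp, simp add: I1_def)
    have 2: "(\<lambda>y. gram (ws y)) \<in> borel_measurable ?P1"
      unfolding ws_def by (rule gram_search_output_measurable) (rule comp, simp add: I1_def)
    have 3: "(\<lambda>y. search_iter f x \<alpha> l (\<lambda>n. y (j, n)) (ws y) (search_start (ws y) (v j)) m) \<in> borel_measurable ?P1"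
    proof (intro search_iter_measurable search_start_measurable 2)
      show "length (ws y) = j" for y by (simp add: ws_def)
      show "(\<lambda>y. y (j, i)) \<in> borel_measurable ?P1" if "i < m" for i by (rule comp) (simp add: I1_def that)
    qed
    show ?thesis unfolding g1_def[abs_def] B_def using 1 2 3 by measurable
  qed
  have g2m: "g2 \<in> ?P2 \<rightarrow>\<^sub>M borel" unfolding g2_def[abs_def] I2_def by measurable
  have R: "r j m = (\<lambda>\<omega>. g2 (X2 \<omega>))" by (simp add: g2_def X2_def I2_def)
  have Yg: "Y = (\<lambda>\<omega>. g1 (X1 \<omega>))"
  proof
    fix \<omega>
    have w: "ws (X1 \<omega>) = out N j \<omega>"
      unfolding ws_def out_def by (rule search_output_cong) (simp add: X1_def I1_def)
    have "search_iter f x \<alpha> l (\<lambda>n. X1 \<omega> (j, n)) (out N j \<omega>) (search_start (out N j \<omega>) (v j)) m = iter N j m \<omega>"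
      unfolding iter_def by (rule search_iter_cong) (simp add: X1_def I1_def)
    then show "Y \<omega> = g1 (X1 \<omega>)" by (simp add: Y_def g1_def w ind_good_def good_def)
  qed
  show "Y \<in> P \<rightarrow>\<^sub>M B" unfolding Yg by (rule measurable_compose[OF X(1) g1m])
  have d1: "distr P B Y = distr (distr P ?P1 X1) B g1" unfolding Yg by (subst distr_distr[OF g1m X(1)]) (simp add: comp_def)
  have d2: "std_gaussian = distr (distr P ?P2 X2) borel g2"
    unfolding r_distr[OF j, of m, symmetric] R by (subst distr_distr[OF g2m X(2)]) (simp add: comp_def)
  interpret d2: prob_space "std_gaussian :: (real^'n) measure" by (rule prob_space_std_gaussian)
  have "distr P B Y \<Otimes>\<^sub>M std_gaussian = distr (distr P ?P1 X1 \<Otimes>\<^sub>M distr P ?P2 X2) (B \<Otimes>\<^sub>M borel) (\<lambda>(y, z). (g1 y, g2 z))"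
  proof -
    have "sigma_finite_measure (distr (distr P ?P2 X2) borel g2)"
      unfolding d2[symmetric] by (rule prob_space_imp_sigma_finite[OF prob_space_std_gaussian])
    then show ?thesis unfolding d1 by (subst d2) (rule pair_measure_distr, use g1m g2m in auto)
  qed
  also have "\<dots> = distr P (B \<Otimes>\<^sub>M borel) (\<lambda>\<omega>. (Y \<omega>, r j m \<omega>))"
    unfolding law Yg R
    by (subst distr_distr) (use X g1m g2m in \<open>auto simp: comp_def split_def intro!: measurable_Pair measurable_compose[OF measurable_fst] measurable_compose[OF measurable_snd]\<close>)
  finally show "distr P B Y \<Otimes>\<^sub>M std_gaussian = distr P (B \<Otimes>\<^sub>M borel) (\<lambda>\<omega>. (Y \<omega>, r j m \<omega>))" .
qed

text \<open>Each \<open>expectation_step\<close> trades one transition operator for one random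
  update. At \<open>i = n\<close> no operator is left: the bound of \<open>loop_uniform\<close>,
  valid for each fixed start, becomes a bound for the last iterate on the good event.\<close>

lemma loop_expectation:
  assumes j: "j < k" and \<phi>: "\<phi> \<in> borel_measurable borel" "\<And>u. 0 \<le> \<phi> u \<and> \<phi> u \<le> 1" and i: "i \<le> n"
  shows "(\<integral>\<omega>. ind_good N j \<eta> \<omega> * tr (gram (out N j \<omega>)) n 0 \<phi> (iter N j 0 \<omega>) \<partial>P)
    = (\<integral>\<omega>. ind_good N j \<eta> \<omega> * tr (gram (out N j \<omega>)) (n - i) i \<phi> (iter N j i \<omega>) \<partial>P)"
  using i
proof (induction i)
  case (Suc i)
  have "(\<integral>\<omega>. ind_good N j \<eta> \<omega> * tr (gram (out N j \<omega>)) (n - i) i \<phi> (iter N j i \<omega>) \<partial>P)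
    = (\<integral>\<omega>. ind_good N j \<eta> \<omega> * tr (gram (out N j \<omega>)) (Suc (n - Suc i)) i \<phi> (iter N j i \<omega>) \<partial>P)"
    using Suc.prems by (simp add: Suc_diff_Suc)
  also have "\<dots> = (\<integral>\<omega>. ind_good N j \<eta> \<omega> * tr (gram (out N j \<omega>)) (n - Suc i) (Suc i) \<phi>
      (search_step (gram (out N j \<omega>)) i (iter N j i \<omega>) (r j i \<omega>)) \<partial>P)"
    by (rule expectation_step[OF prob_space_axioms joint_law(1)[OF j] r_measurable[OF j] joint_law(2)[OF j] _ \<phi>])
      (auto simp: ind_good_def)
  also have "\<dots> = (\<integral>\<omega>. ind_good N j \<eta> \<omega> * tr (gram (out N j \<omega>)) (n - Suc i) (Suc i) \<phi> (iter N j (Suc i) \<omega>) \<partial>P)"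
    by (simp only: iter_def search_iter_Suc)
  finally show ?case using Suc by simp
qed simp

lemma out_onset:
  "AE \<omega> in P. \<forall>N. \<forall>j\<le>k. onset (set (out N j \<omega>)) \<and> distinct (out N j \<omega>)"
  using start_nonzero
proof eventually_elim
  case (elim \<omega>)
  then show ?case unfolding out_def by (intro allI impI search_output_onset v_norm) auto
qed

text \<open>The same \<epsilon> serves as tolerance and as failure probability, so a single
  parameter shrinks along the induction. A new loop dictates how good its predecessors must be, and
  the induction hypothesis provides that for all large \<open>N\<close>.\<close>

lemma good_probability:
  assumes "j \<le> k" "0 < \<epsilon>"
  shows "\<exists>N0. \<forall>N\<ge>N0. prob {\<omega>\<in>space P. \<not> good N j \<epsilon> \<omega>} \<le> \<epsilon>"
  using assms
proof (induction j arbitrary: \<epsilon>)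
  case 0
  then show ?case by (simp add: good_def out_def)
next
  case (Suc j)
  then have j: "j < k" and e2: "0 < \<epsilon> / 2" by auto
  obtain \<eta> N1 where \<eta>: "0 < \<eta>" and loop: "\<And>N ws u. N1 \<le> N \<Longrightarrow> onset (set ws) \<Longrightarrow> distinct ws \<Longrightarrow> length ws < k \<Longrightarrow>
      (\<And>w. w \<in> set ws \<Longrightarrow> defect w \<le> \<eta>) \<Longrightarrow> norm u = 1 \<Longrightarrow> (\<forall>w\<in>set ws. w \<bullet> u = 0) \<Longrightarrow>
      tr (gram ws) N 0 (indicat_real {y. \<epsilon> / 2 < defect y}) u \<le> \<epsilon> / 2"
    using loop_uniform[OF \<alpha>_sums e2] by blast
  \<comment> \<open>Small enough for the next loop, for the tolerance \<epsilon> of the old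
    directions, and for their failure to use only half of the probability \<epsilon>; the new
    direction uses the other half.\<close>
  define \<eta>' where "\<eta>' = min \<eta> (\<epsilon> / 2)"
  have \<eta>': "0 < \<eta>'" "\<eta>' \<le> \<eta>" "\<eta>' \<le> \<epsilon> / 2" using \<eta> e2 by (auto simp: \<eta>'_def)
  obtain N2 where N2: "\<And>N. N2 \<le> N \<Longrightarrow> prob {\<omega>\<in>space P. \<not> good N j \<eta>' \<omega>} \<le> \<eta>'"
    using Suc.IH[of \<eta>'] j \<eta>' by auto
  show ?case
  proof (intro exI[of _ "max N1 N2"] allI impI)
    fix N assume N: "max N1 N2 \<le> N"
    define \<phi> where "\<phi> = indicat_real {y. \<epsilon> / 2 < defect y}"
    have \<phi>: "\<phi> \<in> borel_measurable borel" "0 \<le> \<phi> u \<and> \<phi> u \<le> 1" for u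
      unfolding \<phi>_def by (auto simp: indicator_def)
    define Z where "Z = {\<omega>\<in>space P. good N j \<eta>' \<omega> \<and> \<epsilon> / 2 < defect (iter N j (Suc N) \<omega>)}"
    note [measurable] = ind_good_measurable[OF less_imp_le[OF j]] iter_measurable[OF j] gram_out_measurable[OF less_imp_le[OF j]]
    have Z_eq: "Z = {\<omega>\<in>space P. ind_good N j \<eta>' \<omega> = 1 \<and> \<epsilon> / 2 < defect (iter N j (Suc N) \<omega>)}"
      by (auto simp: Z_def ind_good_def)
    have Z: "Z \<in> sets P" unfolding Z_eq by measurable
    have "prob Z = (\<integral>\<omega>. indicat_real Z \<omega> \<partial>P)" using Z by simp
    also have "\<dots> = (\<integral>\<omega>. ind_good N j \<eta>' \<omega> * tr (gram (out N j \<omega>)) (Suc N - Suc N) (Suc N) \<phi> (iter N j (Suc N) \<omega>) \<partial>P)"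
      by (intro Bochner_Integration.integral_cong refl) (simp add: tr_simps \<phi>_def ind_good_def Z_def indicator_def)
    also have "\<dots> = (\<integral>\<omega>. ind_good N j \<eta>' \<omega> * tr (gram (out N j \<omega>)) (Suc N) 0 \<phi> (iter N j 0 \<omega>) \<partial>P)"
      by (rule loop_expectation[OF j \<phi> order_refl, symmetric])
    also have "\<dots> \<le> (\<integral>\<omega>. \<epsilon> / 2 \<partial>P)"
    proof (rule integral_mono_AE)
      have "(\<lambda>\<omega>. (gram (out N j \<omega>), iter N j 0 \<omega>)) \<in> P \<rightarrow>\<^sub>M borel \<Otimes>\<^sub>M borel" by measurable
      from measurable_compose[OF this tr_measurable[OF \<phi>(1), of "Suc N" 0]]
      have [measurable]: "(\<lambda>\<omega>. tr (gram (out N j \<omega>)) (Suc N) 0 \<phi> (iter N j 0 \<omega>)) \<in> borel_measurable P" by simp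
      show "integrable P (\<lambda>\<omega>. ind_good N j \<eta>' \<omega> * tr (gram (out N j \<omega>)) (Suc N) 0 \<phi> (iter N j 0 \<omega>))"
      proof (rule integrable_const_bound[where B=1])
        show "AE \<omega> in P. norm (ind_good N j \<eta>' \<omega> * tr (gram (out N j \<omega>)) (Suc N) 0 \<phi> (iter N j 0 \<omega>)) \<le> 1"
          using tr_bounds[OF \<phi>] by (intro AE_I2) (auto simp: ind_good_def)
      qed measurable
      show "AE \<omega> in P. ind_good N j \<eta>' \<omega> * tr (gram (out N j \<omega>)) (Suc N) 0 \<phi> (iter N j 0 \<omega>) \<le> \<epsilon> / 2"
        using start_nonzero out_onset
      proof eventually_elim
        case (elim \<omega>)
        show ?case
        proof (cases "good N j \<eta>' \<omega>")
          case True
          have ws: "onset (set (out N j \<omega>))" "distinct (out N j \<omega>)" using elim(2) j by auto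
          have "out N j \<omega> \<noteq> [] \<Longrightarrow> (mat 1 - gram (out N j \<omega>)) *v v j \<noteq> 0"
          proof -
            assume "out N j \<omega> \<noteq> []"
            moreover have "length (out N j \<omega>) = j" by (simp add: out_def)
            ultimately have "j \<in> {1..<k}" using j by (cases "j = 0") auto
            then show ?thesis using elim(1) unfolding out_def by blast
          qed
          note start = search_start_in[OF ws v_norm[OF j] this]
          have "tr (gram (out N j \<omega>)) (Suc N) 0 \<phi> (iter N j 0 \<omega>) \<le> \<epsilon> / 2"
            unfolding \<phi>_def
          proof (rule loop[OF _ ws])
            show "N1 \<le> Suc N" using N by simp
            show "length (out N j \<omega>) < k" using j by (simp add: out_def)
            show "defect w \<le> \<eta>" if "w \<in> set (out N j \<omega>)" for w
              using True that \<eta>'(2) unfolding good_def by fastforce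
            show "norm (iter N j 0 \<omega>) = 1" "\<forall>w\<in>set (out N j \<omega>). w \<bullet> iter N j 0 \<omega> = 0"
              using start by (simp_all add: iter_def)
          qed
          then show ?thesis using True by (simp add: ind_good_def)
        qed (use e2 in \<open>simp add: ind_good_def\<close>)
      qed
    qed simp
    also have "\<dots> = \<epsilon> / 2" using prob_space by simp
    finally have pZ: "prob Z \<le> \<epsilon> / 2" .
    have "{\<omega>\<in>space P. \<not> good N (Suc j) \<epsilon> \<omega>} \<subseteq> {\<omega>\<in>space P. \<not> good N j \<eta>' \<omega>} \<union> Z"
    proof
      fix \<omega> assume \<omega>: "\<omega> \<in> {\<omega>\<in>space P. \<not> good N (Suc j) \<epsilon> \<omega>}"
      show "\<omega> \<in> {\<omega>\<in>space P. \<not> good N j \<eta>' \<omega>} \<union> Z"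
      proof (cases "good N j \<eta>' \<omega>")
        case True
        then have "defect w \<le> \<epsilon>" if "w \<in> set (out N j \<omega>)" for w
          using that \<eta>' e2 unfolding good_def by fastforce
        then have "\<epsilon> < defect (iter N j (Suc N) \<omega>)" using \<omega> by (auto simp: good_def out_Suc)
        then show ?thesis using \<omega> True e2 by (simp add: Z_def)
      qed (use \<omega> in simp)
    qed
    then have "prob {\<omega>\<in>space P. \<not> good N (Suc j) \<epsilon> \<omega>} \<le> prob ({\<omega>\<in>space P. \<not> good N j \<eta>' \<omega>} \<union> Z)"
      using good_sets[OF less_imp_le[OF j]] Z by (intro finite_measure_mono) auto
    also have "\<dots> \<le> prob {\<omega>\<in>space P. \<not> good N j \<eta>' \<omega>} + prob Z"
      using good_sets[OF less_imp_le[OF j]] Z by (intro measure_Un_le) auto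
    also have "\<dots> \<le> \<eta>' + \<epsilon> / 2" using N2[of N] N pZ by (intro add_mono) auto
    finally show "prob {\<omega>\<in>space P. \<not> good N (Suc j) \<epsilon> \<omega>} \<le> \<epsilon>" using \<eta>'(3) by simp
  qed
qed

text \<open>Failure for every \<open>N\<close> at once is contained in each single failure event,
  also in the one with a smaller tolerance \<open>s\<close>, whose probability is at most
  \<open>s\<close> for suitable \<open>N\<close>. Hence it is a null event, and no rate of
  convergence enters.\<close>

lemma search_converges:
  assumes \<epsilon>: "0 < \<epsilon>"
  shows "AE \<omega> in P. \<exists>N. mat_norm (gram (out N k \<omega>) - gram V) \<le> \<epsilon>"
proof -
  \<comment> \<open>With \<open>2 * k + 1\<close> in place of \<open>2 * k\<close> the denominator
    is positive for every \<open>k\<close>.\<close>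
  define \<eta> where "\<eta> = \<epsilon> / sqrt (2 * real k + 1)"
  have \<eta>: "0 < \<eta>" using \<epsilon> by (simp add: \<eta>_def)
  have \<eta>\<epsilon>: "sqrt (2 * real k) * \<eta> \<le> \<epsilon>"
  proof -
    have "sqrt (2 * real k) * \<eta> \<le> sqrt (2 * real k + 1) * \<eta>" using \<eta> by (intro mult_right_mono real_sqrt_le_mono) auto
    also have "\<dots> = \<epsilon>" by (simp add: \<eta>_def)
    finally show ?thesis .
  qed
  define Z where "Z = (\<Inter>N. {\<omega>\<in>space P. \<not> good N k \<eta> \<omega>})"
  have Zs: "Z \<in> sets P" unfolding Z_def by (intro sets.countable_INT) (auto simp: good_sets)
  have "prob Z \<le> t" if t: "0 < t" for t
  proof -
    define s where "s = min t \<eta>"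
    obtain N where N: "prob {\<omega>\<in>space P. \<not> good N k s \<omega>} \<le> s"
      using good_probability[of k s] t \<eta> by (auto simp: s_def)
    have "Z \<subseteq> {\<omega>\<in>space P. \<not> good N k \<eta> \<omega>}" by (auto simp: Z_def)
    also have "\<dots> \<subseteq> {\<omega>\<in>space P. \<not> good N k s \<omega>}" by (force simp: good_def s_def)
    finally have "prob Z \<le> prob {\<omega>\<in>space P. \<not> good N k s \<omega>}" by (intro finite_measure_mono good_sets) auto
    then show ?thesis using N by (simp add: s_def)
  qed
  then have "prob Z \<le> 0" by (rule field_le_epsilon[of _ 0, simplified]) auto
  then have "prob Z = 0" using measure_nonneg[of P Z] by linarith
  then have "AE \<omega> in P. \<omega> \<notin> Z" using Zs by (simp add: AE_iff_null_sets[symmetric] null_sets_def emeasure_eq_measure AE_not_in)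
  then show ?thesis using out_onset AE_space
  proof eventually_elim
    case (elim \<omega>)
    then obtain N where N: "good N k \<eta> \<omega>" by (auto simp: Z_def)
    have "mat_norm (gram (out N k \<omega>) - gram V) \<le> sqrt (2 * real k) * \<eta>"
      using elim(2) N \<eta> by (intro gram_close) (auto simp: out_def good_def)
    then show ?case using \<eta>\<epsilon> by (meson order_trans)
  qed
qed

end

theorem proposition4p6:
  fixes f :: "real ^ 'n::finite \<Rightarrow> real"
    and x xs :: "real ^ 'n"
    and k :: nat
    and \<delta> \<mu> M L l0 \<epsilon> :: real
    and \<alpha> l :: "nat \<Rightarrow> real"
    and P :: "'w measure"
    and r :: "nat \<Rightarrow> nat \<Rightarrow> 'w \<Rightarrow> real ^ 'n"
    and v :: "nat \<Rightarrow> real ^ 'n"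
    and V V0 :: "(real ^ 'n) list"
  assumes "CARD('n) \<ge> 2" and "1 \<le> k" and "k \<le> CARD('n) - 1"
    and "C_smooth 6 f"
    and "\<And>i y. i \<in> {2..6} \<Longrightarrow> dnorm i f y \<le> M"
    and "index_saddle f k xs"
    and "\<delta> > 0" and "0 < \<mu>" and "\<mu> < M"
    and "\<And>y i. norm (y - xs) \<le> \<delta> \<Longrightarrow> i < CARD('n) \<Longrightarrow>
           - M \<le> eigvals (hess f y) ! i \<and> eigvals (hess f y) ! i \<le> M \<and>
           (if i < k then eigvals (hess f y) ! i < - \<mu> else \<mu> < eigvals (hess f y) ! i)"
    and "\<And>n. \<alpha> n > 0" and "\<not> summable \<alpha>" and "summable (\<lambda>n. (\<alpha> n)\<^sup>2)"
    and "\<And>n. l n > 0" and "L > 0" and "\<And>n. l n \<le> L * sqrt (\<alpha> n)"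
    and "norm (x - xs) \<le> \<delta>"
    and "l0 > 0" and "\<mu> - M * l0\<^sup>2 * real CARD('n) / 2 > 0"
    and "low_eigenvectors (hess f x) k V"
    and "low_eigenvectors (hess (smooth f l0) x) k V0"
    and "prob_space P"
    and "prob_space.indep_vars P (\<lambda>_. borel) (\<lambda>(j, n). r j n) ({..<k} \<times> UNIV)"
    and "\<And>j n. j < k \<Longrightarrow> distr P borel (r j n) = std_gaussian"
    and "\<And>j. j < k \<Longrightarrow> norm (v j) = 1"
    and "AE \<omega> in P. \<forall>N. \<forall>j\<in>{1..<k}.
           (mat 1 - gram (search_output f x \<alpha> l (\<lambda>j n. r j n \<omega>) v N j)) *v v j \<noteq> 0"
    and "AE \<omega> in P. \<forall>N. \<forall>j<k.
           not_trapped f x \<alpha> l (\<lambda>n. r j n \<omega>)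
             (search_output f x \<alpha> l (\<lambda>j n. r j n \<omega>) v N j) (v j) (k - j)"
    and "\<epsilon> > 0"
  shows "AE \<omega> in P. \<exists>N.
           mat_norm (gram (search_output f x \<alpha> l (\<lambda>j n. r j n \<omega>) v N k) - gram V) \<le> \<epsilon> \<and>
           mat_norm (gram (search_output f x \<alpha> l (\<lambda>j n. r j n \<omega>) v N k) - gram V0)
             \<le> \<epsilon> + sqrt (2 * real k) * M * l0\<^sup>2 * real CARD('n) / (4 * \<mu>)"
proof -
  note ass = assms
  interpret P: prob_space P by (rule ass(22))
  interpret smooth_fun f M by unfold_locales (use ass(4,5) in auto)
  define A where "A = hess f x"
  define d where "d = real CARD('n)"
  define h where "h = M * l0\<^sup>2 * d / 2"
  have k: "k \<le> CARD('n)" using ass(3) by simp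
  have VE: "low_eigenvectors A k V" using ass(20) by (simp add: A_def)
  have gap: "if i < k then eigvals A ! i < - \<mu> else \<mu> < eigvals A ! i" if "i < CARD('n)" for i
    using ass(10)[OF ass(17) that] by (simp add: A_def)
  have symA: "(A *v a) \<bullet> b = a \<bullet> (A *v b)" for a b unfolding A_def by (rule hess_symmetric)
  note o = low_eigenvectors_onset[OF VE]
  note PV = onset_projection[OF o(1,2)]
  obtain \<theta> where \<theta>: "\<And>v. v \<in> set V \<Longrightarrow> A *v v = \<theta> v *\<^sub>R v" using low_eigenvectors_eigen[OF VE] by blast
  note com = gram_commute[OF symA o(1,2) \<theta>]
  have lo: "eigvals A ! i \<le> - \<mu>" if "i < k" for i using gap[of i] that k by simp
  have hi: "\<mu> \<le> eigvals A ! i" if "k \<le> i" "i < CARD('n)" for i using gap[of i] that by simp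
  have neg: "- \<mu> < \<mu>" using ass(8) by simp
  have low: "u \<bullet> (A *v u) \<le> - \<mu> * (norm u)\<^sup>2" if "gram V *v u = u" for u
    using low_eigenvectors_forms(1)[OF symA VE k lo hi neg] that PV(3) by blast
  have high: "\<mu> * (norm u)\<^sup>2 \<le> u \<bullet> (A *v u)" if "gram V *v u = 0" for u
    using low_eigenvectors_forms(2)[OF symA VE k lo hi neg] that PV(4) by blast
  \<comment> \<open>Test \<open>A *v u\<close> against \<open>p - n\<close>, the reflection of
    \<open>u\<close> that flips its part in the span of \<open>V\<close>. It has the norm of
    \<open>u\<close>, and on it the negative and the positive part of the form add up.\<close>
  have lower: "\<mu> * norm u \<le> norm (A *v u)" for u
  proof (cases "u = 0")
    case False
    define n p where "n = gram V *v u" and "p = u - gram V *v u"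
    have gp: "gram V *v p = 0" and gn: "gram V *v n = n" by (simp_all add: n_def p_def PV(1) matrix_vector_mult_diff_distrib)
    have np: "n \<bullet> p = 0" using PV(2)[of n p] gp gn by simp
    have An: "p \<bullet> (A *v n) = 0" using PV(2)[of p "A *v u"] gp com[of u] by (simp add: n_def)
    have Ap: "n \<bullet> (A *v p) = 0" using symA[of n p] An by (simp add: inner_commute)
    have u: "u = p + n" by (simp add: n_def p_def)
    have nu: "(norm u)\<^sup>2 = (norm p)\<^sup>2 + (norm n)\<^sup>2" "(norm (p - n))\<^sup>2 = (norm p)\<^sup>2 + (norm n)\<^sup>2"
      using np unfolding u power2_norm_eq_inner
      by (simp_all add: inner_add_left inner_add_right inner_diff_left inner_diff_right inner_commute)
    have "A *v u = A *v p + A *v n" by (simp add: u matrix_vector_right_distrib)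
    then have "(p - n) \<bullet> (A *v u) = p \<bullet> (A *v p) - n \<bullet> (A *v n)"
      using An Ap by (simp add: inner_diff_left inner_add_right)
    moreover have "\<mu> * (norm p)\<^sup>2 \<le> p \<bullet> (A *v p)" "n \<bullet> (A *v n) \<le> - \<mu> * (norm n)\<^sup>2"
      using high[OF gp] low[OF gn] by auto
    ultimately have "\<mu> * (norm u)\<^sup>2 \<le> (p - n) \<bullet> (A *v u)" by (simp add: nu(1) distrib_left)
    also have "\<dots> \<le> norm (p - n) * norm (A *v u)" by (rule norm_cauchy_schwarz)
    also have "norm (p - n) = norm u" using nu by (metis norm_ge_zero power2_eq_imp_eq)
    finally have "norm u * (\<mu> * norm u) \<le> norm u * norm (A *v u)" by (simp add: power2_eq_square mult_ac)
    then show ?thesis using False by simp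
  qed simp
  interpret random_search f M x \<mu> \<alpha> l L V k P r v
  proof unfold_locales
    show "\<mu> * norm u \<le> norm (hess f x *v u)" for u using lower by (simp add: A_def)
    show "hess f x *v (gram V *v y) = gram V *v (hess f x *v y)" for y using com by (simp add: A_def)
    show "u \<bullet> (hess f x *v u) \<le> - \<mu> * (norm u)\<^sup>2" if "gram V *v u = u" for u using low[OF that] by (simp add: A_def)
    show "\<mu> * (norm u)\<^sup>2 \<le> u \<bullet> (hess f x *v u)" if "gram V *v u = 0" for u using high[OF that] by (simp add: A_def)
  qed (use ass o in auto)
  have conv: "AE \<omega> in P. \<exists>N. mat_norm (gram (out N k \<omega>) - gram V) \<le> \<epsilon>" by (rule search_converges[OF ass(28)])
  have VV0: "mat_norm (gram V - gram V0) \<le> sqrt (2 * real k) * M * l0\<^sup>2 * real CARD('n) / (4 * \<mu>)"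
  proof -
    have h: "0 \<le> h" "h < \<mu>" using ass(19) M_nonneg by (auto simp: h_def d_def)
    have "mat_norm (gram V - gram V0) \<le> h / (sqrt 2 * \<mu>)"
    proof (rule gram_perturbation[OF symA _ VE _ k gap _ h])
      show "(hess (smooth f l0) x *v a) \<bullet> b = a \<bullet> (hess (smooth f l0) x *v b)" for a b by (rule hess_smooth_symmetric)
      show "low_eigenvectors (hess (smooth f l0) x) k V0" by (rule ass(21))
      show "\<bar>a \<bullet> (hess (smooth f l0) x *v b - A *v b)\<bar> \<le> h * norm a * norm b" for a b
        using hess_smooth_perturbation[of a l0 x b] by (simp add: A_def h_def d_def)
    qed
    also have "h / (sqrt 2 * \<mu>) = sqrt 2 * M * l0\<^sup>2 * d / (4 * \<mu>)"
    proof -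
      have "sqrt 2 * sqrt 2 = (2 :: real)" by simp
      then show ?thesis unfolding h_def using ass(8)
        by (simp add: field_simps)
    qed
    \<comment> \<open>The comparison in operator norm brings no factor depending on
      \<open>k\<close>; the stated constant follows from \<open>1 \<le> k\<close>.\<close>
    also have "\<dots> \<le> sqrt (2 * real k) * M * l0\<^sup>2 * d / (4 * \<mu>)"
    proof -
      have "sqrt 2 \<le> sqrt (2 * real k)" using ass(2) by simp
      then show ?thesis using M_nonneg ass(8) by (intro divide_right_mono mult_right_mono) (auto simp: d_def)
    qed
    finally show ?thesis by (simp add: d_def)
  qed
  have tri: "mat_norm (B - gram V0) \<le> mat_norm (B - gram V) + mat_norm (gram V - gram V0)" for B
  proof -
    have bl: "bounded_linear (\<lambda>y. D *v y)" for D :: "real^'n^'n" by (rule matrix_vector_mul_bounded_linear)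
    have "(\<lambda>y. (B - gram V0) *v y) = (\<lambda>y. (B - gram V) *v y + (gram V - gram V0) *v y)"
      by (simp flip: matrix_vector_mult_add_rdistrib)
    then show ?thesis unfolding mat_norm_def using onorm_triangle[OF bl bl, of "B - gram V" "gram V - gram V0"] by simp
  qed
  show ?thesis using conv unfolding out_def
  proof eventually_elim
    case (elim \<omega>)
    then obtain N where N: "mat_norm (gram (search_output f x \<alpha> l (\<lambda>j n. r j n \<omega>) v N k) - gram V) \<le> \<epsilon>" by blast
    have "mat_norm (gram (search_output f x \<alpha> l (\<lambda>j n. r j n \<omega>) v N k) - gram V0)
        \<le> \<epsilon> + sqrt (2 * real k) * M * l0\<^sup>2 * real CARD('n) / (4 * \<mu>)"
      using tri[of "gram (search_output f x \<alpha> l (\<lambda>j n. r j n \<omega>) v N k)"] N VV0 by linarith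
    with N show ?case by blast
  qed
qed

end
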